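(* Let $n,m\ge1$ be integers and let $\Omega=\Omega_1\times\Omega_2\subset\mathbb{R}^n\times\mathbb{T}^m$, where $\Omega_1\subset\mathbb{R}^n$ is nonempty, open and $2\pi\mathbb{Z}^n$-invariant, and $\Omega_2\subset\mathbb{T}^m$ is nonempty and open. There exists a constant $C$ such that for all $\lambda\in\mathbb{R}$ and all $u\in H^2(\mathbb{R}^n\times\mathbb{T}^m)$, $f\in L^2(\mathbb{R}^n\times\mathbb{T}^m)$ with $$(\Delta_{x,y}-\lambda)u=f,$$ we have $$\|u\|_{L^2(\mathbb{R}^n\times\mathbb{T}^m)}\le C\big(\|f\|_{L^2(\mathbb{R}^n\times\mathbb{T}^m)}+\|u\|_{L^2(\Omega)}\big),$$ with $C$ independent of $\lambda$.
   Context: $\mathbb{T}=\mathbb{R}/2\pi\mathbb{Z}$; points of $\mathbb{R}^n\times\mathbb{T}^m$ are written $(x,y)$ and $\Delta_{x,y}$ is the flat Laplacian. $2\pi\mathbb{Z}^n$-invariant means $\Omega_1+2\pi k=\Omega_1$ for all $k\in\mathbb{Z}^n$. *)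

theory Defs
  imports "HOL-Analysis.Analysis"
begin

definition circle_rel :: "real \<Rightarrow> real \<Rightarrow> bool"
  where "circle_rel s t \<longleftrightarrow> (\<exists>k::int. s - t = 2 * pi * of_int k)"

lemma equivp_circle_rel: "equivp circle_rel"
proof (rule equivpI)
  show "reflp circle_rel"
    unfolding reflp_def circle_rel_def by (auto intro: exI[of _ 0])
  show "symp circle_rel"
    unfolding symp_def circle_rel_def
  proof (intro allI impI, elim exE)
    fix x y :: real and k :: int
    assume "x - y = 2 * pi * of_int k"
    then show "\<exists>k::int. y - x = 2 * pi * of_int k"
      by (intro exI[of _ "- k"]) simp
  qed
  show "transp circle_rel"
    unfolding transp_def circle_rel_def
  proof (intro allI impI, elim exE)
    fix x y z :: real and k l :: int
    assume "x - y = 2 * pi * of_int k" "y - z = 2 * pi * of_int l"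
    then show "\<exists>k::int. x - z = 2 * pi * of_int k"
      by (intro exI[of _ "k + l"]) (simp add: algebra_simps)
  qed
qed

quotient_type circle = real / circle_rel
  morphisms rep_circle to_circle
  by (rule equivp_circle_rel)

instantiation circle :: topological_space
begin

definition open_circle :: "circle set \<Rightarrow> bool"
  where "open_circle U \<longleftrightarrow> open (to_circle -` U)"

instance
proof
  show "open (UNIV :: circle set)"
    by (simp add: open_circle_def)
  show "open (S \<inter> T)" if "open S" "open T" for S T :: "circle set"
    using that by (simp add: open_circle_def open_Int)
  show "open (\<Union> K)" if "\<forall>S\<in>K. open S" for K :: "circle set set"
    using that by (auto simp: open_circle_def vimage_Union)
qed

end

text \<open>The torus of dimension \<open>CARD('m)\<close> is \<open>circle ^ 'm\<close>, with the library's product topology.\<close>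

definition cover :: "(real ^ 'n) \<times> (real ^ 'm) \<Rightarrow> (real ^ 'n) \<times> (circle ^ 'm)"
  where "cover p = (fst p, \<chi> i. to_circle (snd p $ i))"

lemma continuous_on_to_circle: "continuous_on UNIV to_circle"
  by (simp add: continuous_on_open_vimage open_circle_def)

lemma continuous_on_cover: "continuous_on UNIV cover"
proof -
  have "continuous_on UNIV (\<lambda>p :: (real ^ 'n) \<times> (real ^ 'm). to_circle (snd p $ i))" for i
    by (rule continuous_on_compose2[OF continuous_on_to_circle]) (auto intro!: continuous_intros)
  then show ?thesis
    unfolding cover_def by (intro continuous_intros)
qed

lemma surj_cover: "surj cover"
proof (rule surjI)
  fix z :: "(real ^ 'n) \<times> (circle ^ 'm)"
  show "cover (fst z, \<chi> i. rep_circle (snd z $ i)) = z"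
    by (simp add: cover_def prod_eq_iff vec_eq_iff Quotient_abs_rep[OF Quotient_circle])
qed

text \<open>The flat measure: the image of Lebesgue measure on the fundamental domain
  \<open>y \<in> [0, 2\<pi>)\<^sup>m\<close>, so each circle has total mass \<open>2\<pi>\<close>.\<close>

definition flat :: "((real ^ 'n) \<times> (circle ^ 'm)) measure"
  where "flat = distr (restrict_space lborel (UNIV \<times> {y. \<forall>i. 0 \<le> y $ i \<and> y $ i < 2 * pi})) borel cover"

lemma cover_measurable [measurable]: "cover \<in> borel_measurable (restrict_space lborel A)"
  by (intro measurable_restrict_space1)
    (simp add: borel_measurable_continuous_onI continuous_on_cover)

text \<open>Elements of \<open>L\<^sup>2\<close> are represented by Borel functions; equations between them are
  required almost everywhere.\<close>

definition L2 :: "((real ^ 'n) \<times> (circle ^ 'm) \<Rightarrow> complex) \<Rightarrow> bool"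
  where "L2 u \<longleftrightarrow> u \<in> borel_measurable flat \<and> integrable flat (\<lambda>z. (norm (u z))\<^sup>2)"

definition L2_norm :: "((real ^ 'n) \<times> (circle ^ 'm)) set \<Rightarrow> ((real ^ 'n) \<times> (circle ^ 'm) \<Rightarrow> complex) \<Rightarrow> real"
  where "L2_norm A u = sqrt (LINT z:A|flat. (norm (u z))\<^sup>2)"

text \<open>Derivatives are computed upstairs. As \<open>\<phi> \<circ> cover\<close> is periodic, the choice of the
  preimage of \<open>z\<close> is irrelevant: see \<open>pderiv_cover\<close> below.\<close>

definition pderiv ::
    "(real ^ 'n) \<times> (real ^ 'm) \<Rightarrow> ((real ^ 'n) \<times> (circle ^ 'm) \<Rightarrow> complex)
      \<Rightarrow> (real ^ 'n) \<times> (circle ^ 'm) \<Rightarrow> complex"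
  where "pderiv b \<phi> z = frechet_derivative (\<phi> \<circ> cover) (at (inv cover z)) b"

lemma pderiv_cover:
  assumes "(\<phi> \<circ> cover) differentiable (at p)"
  shows "pderiv b \<phi> (cover p) = frechet_derivative (\<phi> \<circ> cover) (at p) b"
proof -
  define q where "q = inv cover (cover p)"
  have q: "cover q = cover p"
    unfolding q_def by (rule surj_f_inv_f[OF surj_cover])
  have per: "cover (r + (p - q)) = cover r" for r
  proof -
    have "to_circle (snd r $ i + (snd p $ i - snd q $ i)) = to_circle (snd r $ i)" for i
    proof -
      have "to_circle (snd q $ i) = to_circle (snd p $ i)"
        using q by (simp add: cover_def vec_eq_iff)
      then have "circle_rel (snd p $ i) (snd q $ i)"
        using circle.abs_eq_iff by metis
      then show ?thesis
        unfolding circle.abs_eq_iff by (simp add: circle_rel_def)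
    qed
    moreover have "fst p = fst q"
      using q by (simp add: cover_def)
    ultimately show ?thesis
      by (simp add: cover_def vec_eq_iff)
  qed
  let ?D = "frechet_derivative (\<phi> \<circ> cover) (at p)"
  have D: "((\<phi> \<circ> cover) has_derivative ?D) (at (q + (p - q)))"
    using assms by (simp add: frechet_derivative_works)
  have "((\<lambda>r. r + (p - q)) has_derivative (\<lambda>h. h)) (at q)"
    by (auto intro!: derivative_eq_intros)
  from has_derivative_compose[OF this D]
  have "((\<phi> \<circ> cover) has_derivative ?D) (at q)"
    by (simp add: per o_def)
  then have "?D = frechet_derivative (\<phi> \<circ> cover) (at q)"
    by (rule frechet_derivative_at)
  then show ?thesis
    by (simp add: pderiv_def q_def)
qed

text \<open>A multi-index is a list of coordinate directions; its order is the length of the list.\<close>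

definition pderivs ::
    "((real ^ 'n) \<times> (real ^ 'm)) list \<Rightarrow> ((real ^ 'n) \<times> (circle ^ 'm) \<Rightarrow> complex)
      \<Rightarrow> (real ^ 'n) \<times> (circle ^ 'm) \<Rightarrow> complex"
  where "pderivs bs = foldr pderiv bs"

definition smooth :: "((real ^ 'n) \<times> (circle ^ 'm) \<Rightarrow> complex) \<Rightarrow> bool"
  where "smooth \<phi> \<longleftrightarrow>
    (\<forall>bs. set bs \<subseteq> Basis \<longrightarrow> (\<forall>p. (pderivs bs \<phi> \<circ> cover) differentiable (at p)))"

definition test_function :: "((real ^ 'n) \<times> (circle ^ 'm) \<Rightarrow> complex) \<Rightarrow> bool"
  where "test_function \<phi> \<longleftrightarrow> smooth \<phi> \<and> compact (closure {z. \<phi> z \<noteq> 0})"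

definition has_weak_pderivs ::
    "((real ^ 'n) \<times> (circle ^ 'm) \<Rightarrow> complex) \<Rightarrow> ((real ^ 'n) \<times> (circle ^ 'm) \<Rightarrow> complex)
      \<Rightarrow> ((real ^ 'n) \<times> (real ^ 'm)) list \<Rightarrow> bool"
  where "has_weak_pderivs u v bs \<longleftrightarrow>
    (\<forall>\<phi>. test_function \<phi> \<longrightarrow>
      (LINT z|flat. u z * pderivs bs \<phi> z) = (-1) ^ length bs * (LINT z|flat. v z * \<phi> z))"

definition sobolev :: "nat \<Rightarrow> ((real ^ 'n) \<times> (circle ^ 'm) \<Rightarrow> complex) \<Rightarrow> bool"
  where "sobolev k u \<longleftrightarrow> L2 u \<and>
    (\<forall>bs. set bs \<subseteq> Basis \<and> length bs \<le> k \<longrightarrow> (\<exists>v. L2 v \<and> has_weak_pderivs u v bs))"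

text \<open>The weak derivative is unique up to null sets; \<open>weak_pderivs\<close> selects a representative.\<close>

definition weak_pderivs ::
    "((real ^ 'n) \<times> (real ^ 'm)) list \<Rightarrow> ((real ^ 'n) \<times> (circle ^ 'm) \<Rightarrow> complex)
      \<Rightarrow> (real ^ 'n) \<times> (circle ^ 'm) \<Rightarrow> complex"
  where "weak_pderivs bs u = (SOME v. L2 v \<and> has_weak_pderivs u v bs)"

definition laplacian ::
    "((real ^ 'n) \<times> (circle ^ 'm) \<Rightarrow> complex) \<Rightarrow> (real ^ 'n) \<times> (circle ^ 'm) \<Rightarrow> complex"
  where "laplacian u z = (\<Sum>b\<in>Basis. weak_pderivs [b, b] u z)"

definition periodic_set :: "(real ^ 'n) set \<Rightarrow> bool"
  where "periodic_set A \<longleftrightarrow>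
    (\<forall>k :: int ^ 'n. (\<lambda>x. x + (2 * pi) *\<^sub>R (\<chi> i. of_int (k $ i))) ` A = A)"

end

theory Submission
  imports Defs
begin

text \<open>After multiplication by a smooth cutoff at scale \<open>R\<close> in \<open>x\<close>, the function \<open>u\<close> lives on a torus with
  sides \<open>2 \<pi> R\<close> in \<open>x\<close> and \<open>2 \<pi>\<close> in \<open>y\<close>. Its Fourier coefficients, indexed by \<open>\<xi> \<in> (1/R) \<int>\<^sup>n \<times> \<int>\<^sup>m\<close>, get
  multiplied by \<open>- |\<xi>|\<^sup>2 - \<lambda>\<close> under the equation, up to an error \<open>O(1/R)\<close>, so that the part of \<open>u\<close> with
  \<open>||\<xi>|\<^sup>2 + \<lambda>| > 1\<close> is bounded by \<open>f\<close>. What remains is a lower bound for the mean of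
  \<open>\<chi> |\<Sum> a\<^sub>\<xi> e\<^bsup>i\<xi>x\<^esup>|\<^sup>2\<close> with \<open>\<xi>\<close> in a shell \<open>||\<xi>|\<^sup>2 - \<mu>| \<le> 1\<close>, uniform in \<open>\<mu>\<close> and \<open>R\<close>, where \<open>\<chi>\<close> is a
  \<open>2 \<pi>\<close>-periodic tent supported over the observation set.

  As \<open>\<chi>\<close> is periodic, frequencies in different cosets of the integer lattice do not interact; this
  plays the role of the Floquet decomposition. Inside a coset one argues as Connes did for eigenfunctions
  on tori. Approximate \<open>\<chi>\<close> by a trigonometric polynomial of degree \<open>J\<close> and split the frequencies into
  clusters linked by steps of length at most \<open>J\<close>: distinct clusters do not interact up to a small error.
  A cluster either spans a proper affine subspace, which is covered by induction on the dimension, or it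
  contains affinely independent points at bounded mutual distance. In the latter case the differences of
  the values \<open>|\<xi>|\<^sup>2\<close> bound the centre of the shell, so all frequencies lie in a set of bounded diameter,
  and the operators \<open>u(x + h) - e\<^bsup>ilh\<^esup> u(x)\<close> remove them one after the other.\<close>

subsection \<open>Means over period cells\<close>

text \<open>The constant has to survive two limits at once: \<lambda> tending to minus infinity,
  where the shell is large and thin, and \<open>R\<close> tending to infinity, where it contains
  ever more frequencies. So no bound may depend on the number of frequencies or on the volume of the
  cell. Integrals are therefore normalised to means, and the tent depends on \<open>x\<close>
  through \<open>cosdist\<close> alone: the mean of a polynomial in \<open>cosdist\<close> against
  an exponential obeys a recursion that does not see the periods. Frequencies are counted only
  inside one bounded cluster, where the count is at most that of the lattice points in a ball. The
  operators that remove frequencies translate by a short step, so every removal costs half the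
  radius of the tent; this is affordable because the number of removals is bounded beforehand. The
  error of the cutoff is controlled by \<open>u\<close> and its gradient, which may grow with
  |\<lambda>|. This does no harm, since for each fixed \<open>u\<close> the error vanishes as
  \<open>R\<close> grows.\<close>

definition freq_lattice :: "('a::euclidean_space \<Rightarrow> nat) \<Rightarrow> 'a set"
  where "freq_lattice N = {\<xi>. \<forall>b\<in>Basis. real (N b) * (\<xi> \<bullet> b) \<in> \<int>}"

definition int_lattice :: "'a::euclidean_space set"
  where "int_lattice = {\<xi>. \<forall>b\<in>Basis. \<xi> \<bullet> b \<in> \<int>}"

definition cell :: "'a::euclidean_space \<Rightarrow> ('a \<Rightarrow> nat) \<Rightarrow> 'a set"
  where "cell \<alpha> N = {x. \<forall>b\<in>Basis. \<alpha> \<bullet> b \<le> x \<bullet> b \<and> x \<bullet> b < \<alpha> \<bullet> b + 2 * pi * real (N b)}"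

text \<open>With this normalisation the exponentials with frequencies in
  \<open>freq_lattice N\<close> are orthonormal over every cell, so that no volume enters the
  constants.\<close>

definition avg :: "'a::euclidean_space \<Rightarrow> ('a \<Rightarrow> nat) \<Rightarrow> 'a measure"
  where "avg \<alpha> N = density lborel (\<lambda>x. ennreal (indicator (cell \<alpha> N) x / measure lborel (cell \<alpha> N)))"

lemma freq_lattice_diff: "\<xi> \<in> freq_lattice N \<Longrightarrow> \<eta> \<in> freq_lattice N \<Longrightarrow> \<xi> - \<eta> \<in> freq_lattice N"
  by (auto simp: freq_lattice_def inner_diff_left right_diff_distrib)

lemma freq_lattice_add: "\<xi> \<in> freq_lattice N \<Longrightarrow> \<eta> \<in> freq_lattice N \<Longrightarrow> \<xi> + \<eta> \<in> freq_lattice N"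
  by (auto simp: freq_lattice_def inner_add_left distrib_left)

lemma int_lattice_diff: "\<xi> \<in> int_lattice \<Longrightarrow> \<eta> \<in> int_lattice \<Longrightarrow> \<xi> - \<eta> \<in> int_lattice"
  by (auto simp: int_lattice_def inner_diff_left)

lemma int_lattice_add: "\<xi> \<in> int_lattice \<Longrightarrow> \<eta> \<in> int_lattice \<Longrightarrow> \<xi> + \<eta> \<in> int_lattice"
  by (auto simp: int_lattice_def inner_add_left)

lemma int_lattice_subset_freq_lattice: "int_lattice \<subseteq> freq_lattice N"
  by (auto simp: freq_lattice_def int_lattice_def)

lemma Basis_in_int_lattice: "b \<in> Basis \<Longrightarrow> b \<in> int_lattice"
  by (auto simp: int_lattice_def inner_Basis)

lemma zero_in_freq_lattice [simp]: "0 \<in> freq_lattice N"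
  by (auto simp: freq_lattice_def)

lemma finite_freq_lattice_bounded:
  fixes N :: "'a::euclidean_space \<Rightarrow> nat"
  assumes N: "\<And>b. b \<in> Basis \<Longrightarrow> 0 < N b"
  shows "finite {\<xi> \<in> freq_lattice N. norm \<xi> \<le> D}"
proof -
  let ?S = "{\<xi> \<in> freq_lattice N. norm \<xi> \<le> D}"
  define \<Phi> where "\<Phi> \<xi> = restrict (\<lambda>b. real (N b) * (\<xi> \<bullet> b)) Basis" for \<xi> :: 'a
  have "\<Phi> ` ?S \<subseteq> Pi\<^sub>E Basis (\<lambda>b. {t. t \<in> \<int> \<and> \<bar>t\<bar> \<le> real (N b) * D})"
  proof (rule image_subsetI, rule PiE_I)
    fix \<xi> b assume \<xi>: "\<xi> \<in> ?S" and b: "b \<in> (Basis :: 'a set)"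
    have "\<bar>\<xi> \<bullet> b\<bar> \<le> D"
      using Basis_le_norm[OF b, of \<xi>] \<xi> by auto
    then show "\<Phi> \<xi> b \<in> {t. t \<in> \<int> \<and> \<bar>t\<bar> \<le> real (N b) * D}"
      using \<xi> b by (auto simp: \<Phi>_def freq_lattice_def abs_mult intro!: mult_left_mono)
  qed (auto simp: \<Phi>_def)
  then have "finite (\<Phi> ` ?S)"
    by (rule finite_subset) (auto intro!: finite_PiE finite_abs_int_segment)
  moreover have "inj_on \<Phi> ?S"
  proof (rule inj_onI)
    fix \<xi> \<eta> assume "\<Phi> \<xi> = \<Phi> \<eta>"
    then have eq: "real (N b) * (\<xi> \<bullet> b) = real (N b) * (\<eta> \<bullet> b)" if "b \<in> Basis" for b
      using that by (auto simp: \<Phi>_def dest: fun_cong[of _ _ b])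
    show "\<xi> = \<eta>"
    proof (rule euclidean_eqI)
      fix b :: 'a assume b: "b \<in> Basis"
      from eq[OF b] N[OF b] show "\<xi> \<bullet> b = \<eta> \<bullet> b" by simp
    qed
  qed
  ultimately show ?thesis
    by (rule finite_imageD)
qed

lemma int_lattice_eq_freq_lattice: "int_lattice = freq_lattice (\<lambda>_. 1)"
  by (simp add: int_lattice_def freq_lattice_def)

lemma finite_int_lattice_bounded: "finite {\<xi> \<in> int_lattice. norm \<xi> \<le> D}"
  unfolding int_lattice_eq_freq_lattice by (rule finite_freq_lattice_bounded) simp

locale period_cell =
  fixes N :: "'a::euclidean_space \<Rightarrow> nat" and \<alpha> :: 'a
  assumes N_pos: "b \<in> Basis \<Longrightarrow> 0 < N b"
begin

abbreviation "corner \<equiv> \<alpha> + (\<Sum>b\<in>Basis. (2 * pi * real (N b)) *\<^sub>R b)"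

lemma corner_inner: "b \<in> Basis \<Longrightarrow> corner \<bullet> b = \<alpha> \<bullet> b + 2 * pi * real (N b)"
  by (simp add: inner_add_left inner_sum_left_Basis)

lemma cell_subset: "cell \<alpha> N \<subseteq> cbox \<alpha> corner"
  by (fastforce simp: cell_def mem_box corner_inner)

lemma box_subset_cell: "box \<alpha> corner \<subseteq> cell \<alpha> N"
  by (auto simp: cell_def mem_box corner_inner intro: less_imp_le)

lemma cell_measurable [measurable]: "cell \<alpha> N \<in> sets borel"
  unfolding cell_def by measurable

lemma cell_fmeasurable: "cell \<alpha> N \<in> fmeasurable lborel"
  by (rule fmeasurableI2[OF _ cell_subset]) auto

lemma measure_cell_pos: "0 < measure lborel (cell \<alpha> N)"
proof -
  have "0 < measure lborel (box \<alpha> corner)"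
    using N_pos by (subst measure_lborel_box_eq) (auto simp: corner_inner intro!: prod_pos)
  also have "\<dots> \<le> measure lborel (cell \<alpha> N)"
    by (rule measure_mono_fmeasurable[OF box_subset_cell _ cell_fmeasurable]) auto
  finally show ?thesis .
qed

lemma space_avg [simp]: "space (avg \<alpha> N) = UNIV"
  and sets_avg [measurable_cong, simp]: "sets (avg \<alpha> N) = sets borel"
  by (simp_all add: avg_def)

lemma integral_avg:
  fixes f :: "'a \<Rightarrow> 'b::{banach, second_countable_topology}"
  assumes "f \<in> borel_measurable borel"
  shows "integral\<^sup>L (avg \<alpha> N) f
      = (LINT x|lborel. (indicator (cell \<alpha> N) x / measure lborel (cell \<alpha> N)) *\<^sub>R f x)"
  unfolding avg_def by (rule integral_density) (use assms in auto)

lemma integrable_avg_iff: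
  fixes f :: "'a \<Rightarrow> 'b::{banach, second_countable_topology}"
  assumes "f \<in> borel_measurable borel"
  shows "integrable (avg \<alpha> N) f \<longleftrightarrow> set_integrable lborel (cell \<alpha> N) f"
proof -
  let ?V = "measure lborel (cell \<alpha> N)"
  have "integrable (avg \<alpha> N) f \<longleftrightarrow> integrable lborel (\<lambda>x. (indicator (cell \<alpha> N) x / ?V) *\<^sub>R f x)"
    unfolding avg_def by (rule integrable_density) (use assms in auto)
  also have "(\<lambda>x. (indicator (cell \<alpha> N) x / ?V) *\<^sub>R f x) = (\<lambda>x. inverse ?V *\<^sub>R (indicator (cell \<alpha> N) x *\<^sub>R f x))"
    by (auto simp: divide_inverse mult.commute)
  also have "integrable lborel \<dots> \<longleftrightarrow> set_integrable lborel (cell \<alpha> N) f"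
  proof
    assume "integrable lborel (\<lambda>x. inverse ?V *\<^sub>R (indicator (cell \<alpha> N) x *\<^sub>R f x))"
    then have "integrable lborel (\<lambda>x. ?V *\<^sub>R (inverse ?V *\<^sub>R (indicator (cell \<alpha> N) x *\<^sub>R f x)))"
      by (rule integrable_scaleR_right)
    then show "set_integrable lborel (cell \<alpha> N) f"
      using measure_cell_pos by (simp add: set_integrable_def flip: mult.assoc)
  qed (unfold set_integrable_def, rule integrable_scaleR_right)
  finally show ?thesis .
qed

lemma integral_avg_set:
  fixes f :: "'a \<Rightarrow> 'b::{banach, second_countable_topology}"
  assumes "f \<in> borel_measurable borel"
  shows "(LINT x:cell \<alpha> N|lborel. f x) = measure lborel (cell \<alpha> N) *\<^sub>R integral\<^sup>L (avg \<alpha> N) f"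
  using measure_cell_pos assms unfolding set_lebesgue_integral_def
  by (subst integral_avg) (simp_all flip: integral_scaleR_right)

lemma integrable_continuous:
  fixes f :: "'a \<Rightarrow> 'b::{banach, second_countable_topology}"
  assumes "continuous_on UNIV f"
  shows "integrable (avg \<alpha> N) f"
proof -
  have "set_integrable lborel (cbox \<alpha> corner) f"
    unfolding set_integrable_def
    by (rule borel_integrable_compact) (use assms continuous_on_subset in auto)
  then have "set_integrable lborel (cell \<alpha> N) f"
    by (rule set_integrable_subset) (use cell_subset in auto)
  then show ?thesis
    by (simp add: integrable_avg_iff assms borel_measurable_continuous_onI)
qed

lemma integral_const:
  fixes c :: "'b::{banach, second_countable_topology}"
  shows "(LINT x|avg \<alpha> N. c) = c"
proof -
  have "(LINT x|avg \<alpha> N. c) = (LINT x|lborel. indicator (cell \<alpha> N) x *\<^sub>R (inverse (measure lborel (cell \<alpha> N)) *\<^sub>R c))"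
    by (subst integral_avg) (auto simp: divide_inverse)
  also have "\<dots> = measure lborel (cell \<alpha> N) *\<^sub>R (inverse (measure lborel (cell \<alpha> N)) *\<^sub>R c)"
    using cell_fmeasurable
    by (intro has_bochner_integral_integral_eq has_bochner_integral_indicator) (auto simp: fmeasurable_def)
  finally show ?thesis
    using measure_cell_pos by simp
qed

text \<open>The cell moved by \<open>t\<close> along \<open>b\<close> is the cell without its first
  slab \<open>?A\<close> and with the slab \<open>?B\<close> added at the other end. The slab
  \<open>?B\<close> is \<open>?A\<close> moved by one full period, so both carry the same
  integral.\<close>

lemma integral_translate:
  fixes f :: "'a \<Rightarrow> 'b::{banach, second_countable_topology}"
  assumes f: "continuous_on UNIV f" and b: "b \<in> Basis"
    and per: "\<And>x. f (x + (2 * pi * real (N b)) *\<^sub>R b) = f x"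
    and t: "0 \<le> t" "t \<le> 2 * pi * real (N b)"
  shows "(LINT x|avg \<alpha> N. f (x + t *\<^sub>R b)) = integral\<^sup>L (avg \<alpha> N) f"
proof -
  let ?P = "2 * pi * real (N b)" and ?Q = "cell \<alpha> N"
  let ?R = "{x. \<forall>d\<in>Basis - {b}. \<alpha> \<bullet> d \<le> x \<bullet> d \<and> x \<bullet> d < \<alpha> \<bullet> d + 2 * pi * real (N d)}"
  let ?S = "{x. \<forall>d\<in>Basis. \<alpha> \<bullet> d \<le> (x - t *\<^sub>R b) \<bullet> d \<and> (x - t *\<^sub>R b) \<bullet> d < \<alpha> \<bullet> d + 2 * pi * real (N d)}"
  let ?A = "?R \<inter> {x. \<alpha> \<bullet> b \<le> x \<bullet> b \<and> x \<bullet> b < \<alpha> \<bullet> b + t}"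
  let ?B = "?R \<inter> {x. \<alpha> \<bullet> b + ?P \<le> x \<bullet> b \<and> x \<bullet> b < \<alpha> \<bullet> b + ?P + t}"
  have Pr: "(\<forall>d\<in>Basis. Q d) \<longleftrightarrow> (\<forall>d\<in>Basis - {b}. Q d) \<and> Q b" for Q
    using b by blast
  have bd: "b \<bullet> d = 0" if "d \<in> Basis - {b}" for d
    using that b by (auto simp: inner_Basis)
  have S: "?S = ?R \<inter> {x. \<alpha> \<bullet> b + t \<le> x \<bullet> b \<and> x \<bullet> b < \<alpha> \<bullet> b + ?P + t}"
    using b by (subst Pr) (auto simp: inner_diff_left bd)
  have Q: "?Q = ?R \<inter> {x. \<alpha> \<bullet> b \<le> x \<bullet> b \<and> x \<bullet> b < \<alpha> \<bullet> b + ?P}"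
    unfolding cell_def by (subst Pr) auto
  have ind: "indicator ?S x = indicat_real ?Q x - indicator ?A x + indicator ?B x" for x
    unfolding S Q using t by (auto simp: indicator_def)
  have meas [measurable]: "?R \<in> sets borel" by measurable
  have [measurable]: "f \<in> borel_measurable borel"
    using f by (rule borel_measurable_continuous_onI)
  let ?a = "(\<Sum>d\<in>Basis. (\<alpha> \<bullet> d) *\<^sub>R d)" and ?c = "(\<Sum>d\<in>Basis. (\<alpha> \<bullet> d + 2 * (2 * pi * real (N d))) *\<^sub>R d)"
  have int: "integrable lborel (\<lambda>x. indicat_real X x *\<^sub>R f x)" if "X \<in> sets borel" "X \<subseteq> cbox ?a ?c" for X
  proof -
    have "set_integrable lborel (cbox ?a ?c) f"
      unfolding set_integrable_def
      by (rule borel_integrable_compact) (use f continuous_on_subset in auto)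
    then have "set_integrable lborel X f"
      by (rule set_integrable_subset) (use that in auto)
    then show ?thesis by (simp add: set_integrable_def)
  qed
  have sub: "X \<subseteq> cbox ?a ?c" if "X \<subseteq> ?R \<inter> {x. \<alpha> \<bullet> b \<le> x \<bullet> b \<and> x \<bullet> b \<le> \<alpha> \<bullet> b + 2 * ?P}" for X
  proof
    fix x assume "x \<in> X"
    then have x: "x \<in> ?R" "\<alpha> \<bullet> b \<le> x \<bullet> b" "x \<bullet> b \<le> \<alpha> \<bullet> b + 2 * ?P"
      using that by auto
    have "\<alpha> \<bullet> d \<le> x \<bullet> d \<and> x \<bullet> d \<le> \<alpha> \<bullet> d + 2 * (2 * pi * real (N d))" if d: "d \<in> Basis" for d
    proof (cases "d = b")
      case True then show ?thesis using x by simp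
    next
      case False
      then have "\<alpha> \<bullet> d \<le> x \<bullet> d" "x \<bullet> d < \<alpha> \<bullet> d + 2 * pi * real (N d)" using x d by auto
      moreover have "0 \<le> 2 * pi * real (N d)" by simp
      ultimately show ?thesis by linarith
    qed
    then show "x \<in> cbox ?a ?c"
      by (simp add: mem_box inner_sum_left_Basis)
  qed
  have P0: "0 \<le> ?P" by simp
  have mA: "?A \<in> sets borel" and mB: "?B \<in> sets borel"
    by measurable
  have iQ: "integrable lborel (\<lambda>x. indicat_real ?Q x *\<^sub>R f x)"
    by (rule int[OF cell_measurable sub]) (use P0 in \<open>auto simp: Q\<close>)
  have iA: "integrable lborel (\<lambda>x. indicat_real ?A x *\<^sub>R f x)"
    by (rule int[OF mA sub]) (use P0 t in auto)
  have iB: "integrable lborel (\<lambda>x. indicat_real ?B x *\<^sub>R f x)"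
    by (rule int[OF mB sub]) (use P0 t in auto)
  have tr: "(LINT x|lborel. g (x + c)) = integral\<^sup>L lborel g"
    if [measurable]: "g \<in> borel_measurable borel" for g :: "'a \<Rightarrow> 'b" and c
    by (subst (2) lborel_distr_plus[symmetric, of c]) (subst integral_distr, auto simp: add.commute)
  have AB: "(LINT x|lborel. indicat_real ?B x *\<^sub>R f x) = (LINT x|lborel. indicat_real ?A x *\<^sub>R f x)"
  proof -
    have "x + ?P *\<^sub>R b \<in> ?B \<longleftrightarrow> x \<in> ?A" for x
      using b by (auto simp: inner_add_left bd)
    then have "indicat_real ?B (x + ?P *\<^sub>R b) = indicat_real ?A x" for x
      unfolding indicator_def by presburger
    then show ?thesis
      using mA mB by (subst tr[symmetric, of _ "?P *\<^sub>R b"]) (simp_all add: per)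
  qed
  have QS: "x + t *\<^sub>R b \<in> ?S \<longleftrightarrow> x \<in> ?Q" for x
    by (simp add: cell_def)
  have "(LINT x|lborel. indicat_real ?Q x *\<^sub>R f (x + t *\<^sub>R b)) = (LINT x|lborel. indicat_real ?S x *\<^sub>R f x)"
  proof (subst (2) tr[symmetric, of _ "t *\<^sub>R b"])
    have "?S \<in> sets borel" by measurable
    then show "(\<lambda>x. indicat_real ?S x *\<^sub>R f x) \<in> borel_measurable borel" by measurable
    have "indicat_real ?S (x + t *\<^sub>R b) = indicat_real ?Q x" for x
      using QS[of x] unfolding indicator_def by presburger
    then show "(LINT x|lborel. indicat_real ?Q x *\<^sub>R f (x + t *\<^sub>R b))
        = (LINT x|lborel. indicat_real ?S (x + t *\<^sub>R b) *\<^sub>R f (x + t *\<^sub>R b))" by simp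
  qed
  also have "\<dots> = (LINT x|lborel. indicat_real ?Q x *\<^sub>R f x - indicat_real ?A x *\<^sub>R f x + indicat_real ?B x *\<^sub>R f x)"
    unfolding ind scaleR_add_left scaleR_diff_left ..
  also have "\<dots> = (LINT x|lborel. indicat_real ?Q x *\<^sub>R f x)"
    using iQ iA iB AB by simp
  finally have "(LINT x:?Q|lborel. f (x + t *\<^sub>R b)) = (LINT x:?Q|lborel. f x)"
    by (simp add: set_lebesgue_integral_def)
  then show ?thesis
    using measure_cell_pos by (simp add: integral_avg_set)
qed

text \<open>A translation along \<open>b\<close> preserves the mean, yet multiplies it by
  \<open>cis (t * (\<xi> \<bullet> b))\<close>. The mean vanishes as soon as this factor differs
  from 1.\<close>

lemma integral_cis:
  assumes \<xi>: "\<xi> \<in> freq_lattice N"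
  shows "(LINT x|avg \<alpha> N. cis (\<xi> \<bullet> x)) = (if \<xi> = 0 then 1 else 0)"
proof (cases "\<xi> = 0")
  case False
  then obtain b where b: "b \<in> Basis" "\<xi> \<bullet> b \<noteq> 0"
    using euclidean_all_zero_iff by blast
  let ?P = "2 * pi * real (N b)"
  \<comment> \<open>The first bound keeps the translation within one period, the second keeps the
    angle in (0, pi], where its cosine is below 1.\<close>
  define t where "t = min ?P (pi / \<bar>\<xi> \<bullet> b\<bar>)"
  have t: "0 < t" "t \<le> ?P" "t * \<bar>\<xi> \<bullet> b\<bar> \<le> pi"
    using b N_pos[OF b(1)] by (auto simp: t_def min_def field_simps)
  have ne: "cis (t * (\<xi> \<bullet> b)) \<noteq> 1"
  proof
    assume "cis (t * (\<xi> \<bullet> b)) = 1"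
    then have "cos (t * (\<xi> \<bullet> b)) = 1" by (simp add: complex_eq_iff)
    then have c: "cos (t * \<bar>\<xi> \<bullet> b\<bar>) = cos 0" by (simp add: abs_if split: if_splits)
    have "cos (t * \<bar>\<xi> \<bullet> b\<bar>) < cos 0"
      by (rule cos_monotone_0_pi) (use t b in auto)
    with c show False by simp
  qed
  have "(LINT x|avg \<alpha> N. cis (\<xi> \<bullet> (x + t *\<^sub>R b))) = (LINT x|avg \<alpha> N. cis (\<xi> \<bullet> x))"
  proof (rule integral_translate[OF _ b(1)])
    obtain k :: int where k: "real (N b) * (\<xi> \<bullet> b) = of_int k"
      using \<xi> b by (auto simp: freq_lattice_def Ints_def)
    have "cis (\<xi> \<bullet> x + 2 * pi * (real (N b) * (\<xi> \<bullet> b))) = cis (\<xi> \<bullet> x)" for x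
      unfolding k by (simp flip: cis_mult add: cis_multiple_2pi)
    then show "cis (\<xi> \<bullet> (x + ?P *\<^sub>R b)) = cis (\<xi> \<bullet> x)" for x
      by (simp add: inner_add_right mult.assoc)
  qed (use t in \<open>auto intro!: continuous_intros\<close>)
  moreover have "(LINT x|avg \<alpha> N. cis (\<xi> \<bullet> (x + t *\<^sub>R b))) = cis (t * (\<xi> \<bullet> b)) * (LINT x|avg \<alpha> N. cis (\<xi> \<bullet> x))"
    unfolding inner_add_right inner_scaleR_right cis_mult[symmetric]
    by (subst mult.commute) (rule integral_mult_right_zero)
  ultimately show ?thesis
    using ne False by auto
qed (use integral_const[of "1::complex"] in simp)

end

subsection \<open>Trigonometric sums and tent functions\<close>

definition trig :: "('a \<Rightarrow> complex) \<Rightarrow> 'a set \<Rightarrow> 'a::euclidean_space \<Rightarrow> complex"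
  where "trig a \<Lambda> x = (\<Sum>\<xi>\<in>\<Lambda>. a \<xi> * cis (\<xi> \<bullet> x))"

text \<open>A periodic stand-in for the squared distance, vanishing exactly on the translates of
  \<open>p\<close> by 2 pi times the integer lattice. Being itself a trigonometric polynomial of
  degree 1 in each coordinate, it turns polynomials of degree \<open>J\<close> into couplings of
  range \<open>J\<close> between frequencies.\<close>

definition cosdist :: "'a \<Rightarrow> 'a::euclidean_space \<Rightarrow> real"
  where "cosdist p x = (\<Sum>b\<in>Basis. 1 - cos ((x - p) \<bullet> b))"

definition tent :: "'a \<Rightarrow> real \<Rightarrow> 'a::euclidean_space \<Rightarrow> real"
  where "tent p r x = max 0 (1 - cosdist p x / r)"

abbreviation coef_sq :: "('a \<Rightarrow> complex) \<Rightarrow> 'a set \<Rightarrow> real"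
  where "coef_sq a \<Lambda> \<equiv> (\<Sum>\<xi>\<in>\<Lambda>. (norm (a \<xi>))\<^sup>2)"

abbreviation tent_energy :: "'a::euclidean_space \<Rightarrow> real \<Rightarrow> ('a \<Rightarrow> nat) \<Rightarrow> 'a \<Rightarrow> ('a \<Rightarrow> complex) \<Rightarrow> 'a set \<Rightarrow> real"
  where "tent_energy p r N \<alpha> a \<Lambda> \<equiv> (LINT x|avg \<alpha> N. tent p r x * (norm (trig a \<Lambda> x))\<^sup>2)"

text \<open>The mean of \<open>cosdist p x ^ j * cis (m \<bullet> x)\<close>. The recursion does not mention the cell, which makes
  the constants below independent of the periods.\<close>

primrec moment :: "'a \<Rightarrow> nat \<Rightarrow> 'a::euclidean_space \<Rightarrow> complex"
  where "moment p 0 m = (if m = 0 then 1 else 0)"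
  | "moment p (Suc j) m = (\<Sum>b\<in>Basis. moment p j m
      - (cis (- (p \<bullet> b)) * moment p j (m + b) + cis (p \<bullet> b) * moment p j (m - b)) / 2)"

text \<open>Holds of the frequency differences that a polynomial of degree \<open>J\<close> in
  \<open>cosdist\<close> cannot bridge: either they leave the integer lattice or some coordinate is
  too large.\<close>

definition far :: "nat \<Rightarrow> 'a::euclidean_space \<Rightarrow> bool"
  where "far J m \<longleftrightarrow> m \<notin> int_lattice \<or> (\<exists>b\<in>Basis. \<bar>m \<bullet> b\<bar> > real J)"

lemma continuous_on_trig [continuous_intros]:
  fixes f :: "'b::t2_space \<Rightarrow> 'a::euclidean_space"
  shows "continuous_on S f \<Longrightarrow> continuous_on S (\<lambda>x. trig a \<Lambda> (f x))"
  unfolding trig_def by (intro continuous_intros)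

lemma continuous_on_cosdist [continuous_intros]:
  fixes f :: "'b::t2_space \<Rightarrow> 'a::euclidean_space"
  shows "continuous_on S f \<Longrightarrow> continuous_on S (\<lambda>x. cosdist p (f x))"
  unfolding cosdist_def by (auto intro!: continuous_intros)

lemma continuous_on_tent [continuous_intros]:
  fixes f :: "'b::t2_space \<Rightarrow> 'a::euclidean_space"
  shows "continuous_on S f \<Longrightarrow> continuous_on S (\<lambda>x. tent p r (f x))"
  unfolding tent_def by (cases "r = 0") (auto intro!: continuous_intros)

lemma cosdist_nonneg: "0 \<le> cosdist p x"
  unfolding cosdist_def by (intro sum_nonneg) auto

lemma cosdist_le: "cosdist p (x :: 'a::euclidean_space) \<le> 2 * DIM('a)"
proof -
  have "1 - cos ((x - p) \<bullet> b) \<le> 2" for b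
    using cos_ge_minus_one[of "(x - p) \<bullet> b"] by linarith
  then have "cosdist p x \<le> (\<Sum>b\<in>(Basis :: 'a set). 2)"
    unfolding cosdist_def by (intro sum_mono)
  then show ?thesis by simp
qed

lemma tent_nonneg: "0 \<le> tent p r x"
  by (simp add: tent_def)

lemma tent_le_1: "0 < r \<Longrightarrow> tent p r x \<le> 1"
  using cosdist_nonneg[of p x] by (simp add: tent_def)

lemma cosdist_shift:
  assumes b: "b \<in> Basis" and t: "0 \<le> t"
  shows "\<bar>cosdist p (x + t *\<^sub>R b) - cosdist p x\<bar> \<le> t"
proof -
  have lip: "\<bar>cos u - cos v\<bar> \<le> \<bar>u - v\<bar>" for u v :: real
  proof -
    have "\<bar>cos u - cos v\<bar> = 2 * (\<bar>sin ((u + v) / 2)\<bar> * \<bar>sin ((v - u) / 2)\<bar>)"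
      by (subst cos_diff_cos) (simp add: abs_mult)
    also have "\<dots> \<le> 2 * (1 * \<bar>(v - u) / 2\<bar>)"
      by (intro mult_left_mono mult_mono abs_sin_x_le_abs_x) auto
    finally show ?thesis by simp
  qed
  have "cosdist p (x + t *\<^sub>R b) - cosdist p x
      = (\<Sum>d\<in>Basis. cos ((x - p) \<bullet> d) - cos ((x - p) \<bullet> d + t * (b \<bullet> d)))"
    unfolding cosdist_def by (simp flip: sum_subtractf add: algebra_simps inner_diff_left inner_add_left)
  also have "\<dots> = (\<Sum>d\<in>Basis. if d = b then cos ((x - p) \<bullet> b) - cos ((x - p) \<bullet> b + t) else 0)"
    using b by (intro sum.cong) (auto simp: inner_Basis)
  also have "\<dots> = cos ((x - p) \<bullet> b) - cos ((x - p) \<bullet> b + t)"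
    using b by simp
  finally show ?thesis
    using lip[of "(x - p) \<bullet> b" "(x - p) \<bullet> b + t"] t by simp
qed

lemma tent_half_le: "0 < r \<Longrightarrow> tent p (r / 2) x \<le> tent p r x"
  using cosdist_nonneg[of p x] by (auto simp: tent_def max_def field_simps)

text \<open>Halving the radius leaves room for a translation: where the left-hand side is nonzero,
  \<open>cosdist\<close> at \<open>x\<close> is at most r/2 + r/4, so the tent of radius
  \<open>r\<close> is still at least 1/4 there. This is the origin of the factor 4.\<close>

lemma tent_half_shift:
  assumes r: "0 < r" and b: "b \<in> Basis" and t: "0 \<le> t" "t \<le> r / 4"
  shows "tent p (r / 2) (x - t *\<^sub>R b) \<le> 4 * tent p r x"
proof -
  define s where "s = cosdist p (x - t *\<^sub>R b)"
  have s: "0 \<le> s" "\<bar>cosdist p x - s\<bar> \<le> t"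
    using cosdist_shift[OF b t(1), of p "x - t *\<^sub>R b"] by (auto simp: s_def cosdist_nonneg)
  show ?thesis
  proof (cases "s < r / 2")
    case True
    have "1 - s / (r / 2) \<le> 1" using s r by simp
    then have "tent p (r / 2) (x - t *\<^sub>R b) \<le> 1"
      by (simp add: tent_def s_def)
    moreover have "cosdist p x \<le> 3 / 4 * r" using True s t by linarith
    then have "1 / 4 \<le> tent p r x"
      using r by (simp add: tent_def max_def field_simps)
    ultimately show ?thesis by linarith
  next
    case False
    then have "tent p (r / 2) (x - t *\<^sub>R b) = 0"
      using r by (simp add: tent_def field_simps flip: s_def)
    then show ?thesis using tent_nonneg[of p r x] by simp
  qed
qed

lemma far_mono: "far J m \<Longrightarrow> i \<le> J \<Longrightarrow> far i m"
  unfolding far_def by force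

lemma far_SucD:
  assumes "far (Suc J) m" "b \<in> Basis"
  shows "far J (m + b)" "far J (m - b)" "far J m"
proof -
  have *: "far J (m + c)" if c: "c = b \<or> c = - b" for c
  proof (cases "m \<in> int_lattice")
    case True
    then obtain d where d: "d \<in> Basis" "real (Suc J) < \<bar>m \<bullet> d\<bar>"
      using assms by (auto simp: far_def)
    have "\<bar>c \<bullet> d\<bar> \<le> 1"
      using c d assms by (auto simp: inner_Basis)
    then have "real J < \<bar>(m + c) \<bullet> d\<bar>"
      using d by (simp add: inner_add_left)
    then show ?thesis using d by (auto simp: far_def)
  next
    case False
    have c': "c \<in> int_lattice"
      using c assms by (auto simp: int_lattice_def inner_Basis)
    have "m + c \<notin> int_lattice"
      using False int_lattice_diff[OF _ c', of "m + c"] by auto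
    then show ?thesis by (auto simp: far_def)
  qed
  show "far J (m + b)" "far J (m - b)"
    using *[of b] *[of "- b"] by auto
  show "far J m"
    using assms(1) by (rule far_mono) simp
qed

text \<open>Each step of the recursion moves \<open>m\<close> by at most one basis vector, so
  \<open>j\<close> steps never arrive at 0, the only frequency where the recursion starts with a
  nonzero value.\<close>

lemma moment_far: "far j m \<Longrightarrow> moment p j m = 0"
proof (induction j arbitrary: m)
  case 0
  then show ?case by (auto simp: far_def int_lattice_def)
next
  case (Suc j)
  then show ?case by (auto intro!: sum.neutral simp: far_SucD)
qed

lemma norm_sq_trig:
  "complex_of_real ((norm (trig a \<Lambda> x))\<^sup>2) = (\<Sum>\<xi>\<in>\<Lambda>. \<Sum>\<eta>\<in>\<Lambda>. a \<xi> * cnj (a \<eta>) * cis ((\<xi> - \<eta>) \<bullet> x))"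
proof -
  have "cis (\<xi> \<bullet> x) * cnj (cis (\<eta> \<bullet> x)) = cis ((\<xi> - \<eta>) \<bullet> x)" for \<xi> \<eta>
    by (simp add: cis_cnj cis_mult inner_diff_left)
  then have eq: "(a \<xi> * cis (\<xi> \<bullet> x)) * cnj (a \<eta> * cis (\<eta> \<bullet> x)) = a \<xi> * cnj (a \<eta>) * cis ((\<xi> - \<eta>) \<bullet> x)" for \<xi> \<eta>
    by (metis (no_types, lifting) complex_cnj_mult mult.assoc mult.left_commute)
  show ?thesis
    unfolding complex_norm_square trig_def cnj_sum sum_product eq ..
qed

context period_cell
begin

abbreviation mean_sq :: "('a \<Rightarrow> complex) \<Rightarrow> real"
  where "mean_sq v \<equiv> (LINT x|avg \<alpha> N. (norm (v x))\<^sup>2)"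

lemma integral_moment:
  assumes "m \<in> freq_lattice N"
  shows "(LINT x|avg \<alpha> N. complex_of_real (cosdist p x ^ j) * cis (m \<bullet> x)) = moment p j m"
  using assms
proof (induction j arbitrary: m)
  case 0
  then show ?case by (simp add: integral_cis)
next
  case (Suc j)
  have inN: "m + b \<in> freq_lattice N" "m - b \<in> freq_lattice N" if "b \<in> Basis" for b
    using that Suc.prems Basis_in_int_lattice int_lattice_subset_freq_lattice
    by (blast intro: freq_lattice_add freq_lattice_diff)+
  let ?g = "\<lambda>m x. complex_of_real (cosdist p x ^ j) * cis (m \<bullet> x)"
  have int: "integrable (avg \<alpha> N) (?g m)" for m
    by (intro integrable_continuous continuous_intros)
  have cc: "complex_of_real (1 - cos ((x - p) \<bullet> b)) * cis (m \<bullet> x)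
      = cis (m \<bullet> x) - (cis (- (p \<bullet> b)) * cis ((m + b) \<bullet> x) + cis (p \<bullet> b) * cis ((m - b) \<bullet> x)) / 2" for x b
  proof -
    have "complex_of_real (cos ((x - p) \<bullet> b)) = (cis ((x - p) \<bullet> b) + cis (- ((x - p) \<bullet> b))) / 2"
      by (simp add: complex_eq_iff)
    moreover have "cis ((x - p) \<bullet> b) * cis (m \<bullet> x) = cis (- (p \<bullet> b)) * cis ((m + b) \<bullet> x)"
      "cis (- ((x - p) \<bullet> b)) * cis (m \<bullet> x) = cis (p \<bullet> b) * cis ((m - b) \<bullet> x)"
      by (simp_all add: cis_mult inner_add_left inner_diff_left inner_diff_right algebra_simps inner_commute)
    ultimately show ?thesis
      by (simp add: left_diff_distrib distrib_right add_divide_distrib)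
  qed
  have "complex_of_real (cosdist p x ^ Suc j) * cis (m \<bullet> x) = (\<Sum>b\<in>Basis. ?g m x
      - (cis (- (p \<bullet> b)) * ?g (m + b) x + cis (p \<bullet> b) * ?g (m - b) x) / 2)" for x
  proof -
    have "complex_of_real (cosdist p x ^ Suc j) * cis (m \<bullet> x)
       = (\<Sum>b\<in>Basis. complex_of_real (cosdist p x ^ j) * (complex_of_real (1 - cos ((x - p) \<bullet> b)) * cis (m \<bullet> x)))"
      by (simp add: cosdist_def[of p x] sum_distrib_left sum_distrib_right mult_ac)
    also have "\<dots> = (\<Sum>b\<in>Basis. ?g m x
      - (cis (- (p \<bullet> b)) * ?g (m + b) x + cis (p \<bullet> b) * ?g (m - b) x) / 2)"
      unfolding cc by (intro sum.cong refl) (simp add: algebra_simps add_divide_distrib)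
    finally show ?thesis .
  qed
  then have "(LINT x|avg \<alpha> N. complex_of_real (cosdist p x ^ Suc j) * cis (m \<bullet> x))
      = (LINT x|avg \<alpha> N. (\<Sum>b\<in>Basis. ?g m x
      - (cis (- (p \<bullet> b)) * ?g (m + b) x + cis (p \<bullet> b) * ?g (m - b) x) / 2))"
    by simp
  also have "\<dots> = (\<Sum>b\<in>Basis. moment p j m
      - (cis (- (p \<bullet> b)) * moment p j (m + b) + cis (p \<bullet> b) * moment p j (m - b)) / 2)"
    using int Suc.IH Suc.prems inN
    by (subst Bochner_Integration.integral_sum)
       (auto intro!: sum.cong Bochner_Integration.integrable_diff Bochner_Integration.integrable_add
         integrable_divide integrable_mult_right)
  finally show ?case by simp
qed

text \<open>The right-hand side no longer mentions the cell. This is what makes energies over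
  different cells comparable and shows which pairs of frequencies interact.\<close>

lemma integral_poly_trig:
  fixes c :: "nat \<Rightarrow> real"
  assumes \<Lambda>: "\<Lambda> \<subseteq> freq_lattice N"
  shows "complex_of_real (LINT x|avg \<alpha> N. (\<Sum>i\<le>J. c i * cosdist p x ^ i) * (norm (trig a \<Lambda> x))\<^sup>2)
    = (\<Sum>\<xi>\<in>\<Lambda>. \<Sum>\<eta>\<in>\<Lambda>. a \<xi> * cnj (a \<eta>) * (\<Sum>i\<le>J. c i * moment p i (\<xi> - \<eta>)))"
proof -
  let ?g = "\<lambda>\<xi> \<eta> i x. complex_of_real (cosdist p x ^ i) * cis ((\<xi> - \<eta>) \<bullet> x)"
  have int: "integrable (avg \<alpha> N) (?g \<xi> \<eta> i)" for \<xi> \<eta> i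
    by (intro integrable_continuous continuous_intros)
  have "complex_of_real (LINT x|avg \<alpha> N. (\<Sum>i\<le>J. c i * cosdist p x ^ i) * (norm (trig a \<Lambda> x))\<^sup>2)
     = (LINT x|avg \<alpha> N. complex_of_real ((\<Sum>i\<le>J. c i * cosdist p x ^ i) * (norm (trig a \<Lambda> x))\<^sup>2))"
    by (rule integral_complex_of_real[symmetric])
  also have "\<dots> = (LINT x|avg \<alpha> N. (\<Sum>\<xi>\<in>\<Lambda>. \<Sum>\<eta>\<in>\<Lambda>. a \<xi> * cnj (a \<eta>) * (\<Sum>i\<le>J. c i * ?g \<xi> \<eta> i x)))"
    unfolding of_real_mult norm_sq_trig
    by (simp add: sum_distrib_left sum_distrib_right mult_ac)
  also have "\<dots> = (\<Sum>\<xi>\<in>\<Lambda>. \<Sum>\<eta>\<in>\<Lambda>. a \<xi> * cnj (a \<eta>) * (\<Sum>i\<le>J. c i * integral\<^sup>L (avg \<alpha> N) (?g \<xi> \<eta> i)))"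
    using int by (simp add: Bochner_Integration.integral_sum)
  also have "\<dots> = (\<Sum>\<xi>\<in>\<Lambda>. \<Sum>\<eta>\<in>\<Lambda>. a \<xi> * cnj (a \<eta>) * (\<Sum>i\<le>J. c i * moment p i (\<xi> - \<eta>)))"
    using \<Lambda> by (intro sum.cong refl arg_cong2[where f = "(*)"] integral_moment freq_lattice_diff) auto
  finally show ?thesis .
qed

lemma integral_norm_sq_trig:
  assumes "finite \<Lambda>" "\<Lambda> \<subseteq> freq_lattice N"
  shows "mean_sq (trig a \<Lambda>) = coef_sq a \<Lambda>"
proof -
  have "complex_of_real (mean_sq (trig a \<Lambda>))
      = (\<Sum>\<xi>\<in>\<Lambda>. \<Sum>\<eta>\<in>\<Lambda>. a \<xi> * cnj (a \<eta>) * (if \<xi> = \<eta> then 1 else 0))"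
    using integral_poly_trig[OF assms(2), of "\<lambda>_. 1" 0 0 a] by simp
  also have "\<dots> = (\<Sum>\<xi>\<in>\<Lambda>. a \<xi> * cnj (a \<xi>))"
    using assms(1) by (intro sum.cong refl) (simp add: if_distrib[of "\<lambda>z. _ * z"] cong: if_cong)
  also have "\<dots> = complex_of_real (coef_sq a \<Lambda>)"
    by (simp add: complex_norm_square[symmetric])
  finally show ?thesis
    using of_real_eq_iff by blast
qed

text \<open>For the approximating polynomial the energy splits exactly into the blocks, because
  moments between different blocks vanish. Replacing the tent by the polynomial costs \<epsilon>
  times the sum of squares, once on the blocks and once on the whole, hence
  \<open>2 * \<epsilon>\<close>. The labels \<open>cl\<close> are left general since the lemma
  serves for cosets as well as for clusters.\<close>

lemma block_lower_bound:
  fixes c :: "nat \<Rightarrow> real" and cl :: "'a \<Rightarrow> 'c"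
  assumes fin: "finite \<Lambda>" and \<Lambda>: "\<Lambda> \<subseteq> freq_lattice N"
    and approx: "\<And>x. \<bar>tent p r x - (\<Sum>i\<le>J. c i * cosdist p x ^ i)\<bar> \<le> \<epsilon>"
    and sep: "\<And>\<xi> \<eta>. \<xi> \<in> \<Lambda> \<Longrightarrow> \<eta> \<in> \<Lambda> \<Longrightarrow> cl \<xi> \<noteq> cl \<eta> \<Longrightarrow> far J (\<xi> - \<eta>)"
    and block: "\<And>y. y \<in> cl ` \<Lambda> \<Longrightarrow> \<gamma> * (\<Sum>\<xi> | \<xi> \<in> \<Lambda> \<and> cl \<xi> = y. (norm (a \<xi>))\<^sup>2)
        \<le> tent_energy p r N \<alpha> a {\<xi> \<in> \<Lambda>. cl \<xi> = y}"
  shows "(\<gamma> - 2 * \<epsilon>) * coef_sq a \<Lambda>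
        \<le> tent_energy p r N \<alpha> a \<Lambda>"
proof -
  define P where "P x = (\<Sum>i\<le>J. c i * cosdist p x ^ i)" for x
  define B where "B y = {\<xi> \<in> \<Lambda>. cl \<xi> = y}" for y
  define S where "S X = coef_sq a X" for X
  define T where "T X = tent_energy p r N \<alpha> a X" for X
  define U where "U X = (LINT x|avg \<alpha> N. P x * (norm (trig a X x))\<^sup>2)" for X
  have contP: "continuous_on UNIV P"
    unfolding P_def by (intro continuous_intros)
  have TU: "\<bar>T X - U X\<bar> \<le> \<epsilon> * S X" if "X \<subseteq> \<Lambda>" for X
  proof -
    have X: "finite X" "X \<subseteq> freq_lattice N" using that fin \<Lambda> finite_subset by auto
    have "T X - U X = (LINT x|avg \<alpha> N. (tent p r x - P x) * (norm (trig a X x))\<^sup>2)"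
      unfolding T_def U_def left_diff_distrib
      by (rule Bochner_Integration.integral_diff[symmetric])
         (intro integrable_continuous continuous_intros contP)+
    also have "\<bar>\<dots>\<bar> \<le> (LINT x|avg \<alpha> N. \<epsilon> * (norm (trig a X x))\<^sup>2)"
    proof (rule integral_abs_bound_integral)
      show "\<bar>(tent p r x - P x) * (norm (trig a X x))\<^sup>2\<bar> \<le> \<epsilon> * (norm (trig a X x))\<^sup>2" for x
        unfolding abs_mult using approx[of x] by (intro mult_mono) (auto simp: P_def)
    qed (intro integrable_continuous continuous_intros contP)+
    also have "\<dots> = \<epsilon> * S X"
      using X by (simp add: integral_norm_sq_trig S_def)
    finally show ?thesis .
  qed
  have sum_blocks: "(\<Sum>\<xi>\<in>\<Lambda>. g \<xi>) = (\<Sum>y\<in>cl ` \<Lambda>. \<Sum>\<xi>\<in>B y. g \<xi>)" for g :: "'a \<Rightarrow> complex"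
    unfolding B_def using fin by (rule sum.image_gen)
  have sum_blocks': "(\<Sum>\<xi>\<in>\<Lambda>. g \<xi>) = (\<Sum>y\<in>cl ` \<Lambda>. \<Sum>\<xi>\<in>B y. g \<xi>)" for g :: "'a \<Rightarrow> real"
    unfolding B_def using fin by (rule sum.image_gen)
  have U_blocks: "U \<Lambda> = (\<Sum>y\<in>cl ` \<Lambda>. U (B y))"
  proof -
    define K where "K \<xi> \<eta> = a \<xi> * cnj (a \<eta>) * (\<Sum>i\<le>J. c i * moment p i (\<xi> - \<eta>))" for \<xi> \<eta>
    have U: "complex_of_real (U X) = (\<Sum>\<xi>\<in>X. \<Sum>\<eta>\<in>X. K \<xi> \<eta>)" if "X \<subseteq> \<Lambda>" for X
      unfolding U_def P_def K_def using that \<Lambda> by (intro integral_poly_trig) auto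
    have K0: "K \<xi> \<eta> = 0" if "\<xi> \<in> \<Lambda>" "\<eta> \<in> \<Lambda>" "cl \<xi> \<noteq> cl \<eta>" for \<xi> \<eta>
    proof -
      have "moment p i (\<xi> - \<eta>) = 0" if "i \<le> J" for i
        using far_mono[OF sep[OF \<open>\<xi> \<in> \<Lambda>\<close> \<open>\<eta> \<in> \<Lambda>\<close> \<open>cl \<xi> \<noteq> cl \<eta>\<close>] that] by (rule moment_far)
      then show ?thesis by (simp add: K_def)
    qed
    have "complex_of_real (U \<Lambda>) = (\<Sum>y\<in>cl ` \<Lambda>. \<Sum>\<xi>\<in>B y. \<Sum>\<eta>\<in>\<Lambda>. K \<xi> \<eta>)"
      by (subst U[OF subset_refl], rule sum_blocks)
    also have "\<dots> = (\<Sum>y\<in>cl ` \<Lambda>. \<Sum>\<xi>\<in>B y. \<Sum>\<eta>\<in>B y. K \<xi> \<eta>)"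
    proof (rule sum.cong[OF refl], rule sum.cong[OF refl])
      fix y \<xi> assume \<xi>: "\<xi> \<in> B y"
      have "K \<xi> \<eta> = 0" if "\<eta> \<in> \<Lambda> - B y" for \<eta>
        using \<xi> that by (intro K0) (auto simp: B_def)
      then show "(\<Sum>\<eta>\<in>\<Lambda>. K \<xi> \<eta>) = (\<Sum>\<eta>\<in>B y. K \<xi> \<eta>)"
        using fin by (intro sum.mono_neutral_right) (auto simp: B_def)
    qed
    also have "\<dots> = (\<Sum>y\<in>cl ` \<Lambda>. complex_of_real (U (B y)))"
      by (intro sum.cong refl, subst U) (auto simp: B_def)
    finally show ?thesis
      by (metis of_real_eq_iff of_real_sum)
  qed
  have S_blocks: "S \<Lambda> = (\<Sum>y\<in>cl ` \<Lambda>. S (B y))"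
    unfolding S_def by (rule sum_blocks')
  have "(\<gamma> - \<epsilon>) * S (B y) \<le> U (B y)" if "y \<in> cl ` \<Lambda>" for y
  proof -
    have "\<gamma> * S (B y) \<le> T (B y)"
      using block[OF that] by (simp add: B_def S_def T_def)
    moreover have "\<bar>T (B y) - U (B y)\<bar> \<le> \<epsilon> * S (B y)"
      by (rule TU) (auto simp: B_def)
    ultimately show ?thesis by (simp add: left_diff_distrib)
  qed
  then have "(\<Sum>y\<in>cl ` \<Lambda>. (\<gamma> - \<epsilon>) * S (B y)) \<le> U \<Lambda>"
    unfolding U_blocks by (intro sum_mono)
  then have "(\<gamma> - \<epsilon>) * S \<Lambda> \<le> U \<Lambda>"
    by (simp add: S_blocks sum_distrib_left)
  moreover have "\<bar>T \<Lambda> - U \<Lambda>\<bar> \<le> \<epsilon> * S \<Lambda>"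
    by (rule TU) simp
  ultimately have "(\<gamma> - 2 * \<epsilon>) * S \<Lambda> \<le> T \<Lambda>"
    by (simp add: left_diff_distrib algebra_simps)
  then show ?thesis by (simp add: S_def T_def)
qed

end

text \<open>The tent is a continuous function of the single number \<open>cosdist p x\<close>, which
  stays in a compact interval; Weierstrass in one variable suffices. Degree and coefficients are
  independent of any cell.\<close>

lemma tent_poly_approx:
  fixes p :: "'a::euclidean_space"
  assumes "0 < \<epsilon>"
  obtains J and c :: "nat \<Rightarrow> real" where "\<And>x. \<bar>tent p r x - (\<Sum>i\<le>J. c i * cosdist p x ^ i)\<bar> \<le> \<epsilon>"
proof -
  have "continuous_on {0..2 * real DIM('a)} (\<lambda>s. max 0 (1 - s / r))"
    by (cases "r = 0") (auto intro!: continuous_intros)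
  then obtain g where g: "real_polynomial_function g"
    "\<And>s. s \<in> {0..2 * real DIM('a)} \<Longrightarrow> \<bar>max 0 (1 - s / r) - g s\<bar> < \<epsilon>"
    using Stone_Weierstrass_real_polynomial_function[OF compact_Icc _ assms] by metis
  then obtain c J where c: "g = (\<lambda>s. \<Sum>i\<le>J. c i * s ^ i)"
    using real_polynomial_function_iff_sum by metis
  show thesis
  proof (rule that)
    show "\<bar>tent p r x - (\<Sum>i\<le>J. c i * cosdist p x ^ i)\<bar> \<le> \<epsilon>" for x
      using g(2)[of "cosdist p x"] cosdist_nonneg[of p x] cosdist_le[of p x]
      by (simp add: c tent_def)
  qed
qed

lemma period_cell_one: "period_cell (\<lambda>_. 1)"
  by unfold_locales simp

text \<open>Polynomials in \<open>cosdist\<close> have the same mean over all cells, so up to an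
  arbitrary error the mean of the tent may be taken over one reference cell, where it is positive by
  continuity.\<close>

lemma tent_mean_pos:
  fixes p :: "'a::euclidean_space"
  assumes r: "0 < r"
  shows "\<exists>c>0. \<forall>N \<alpha>. period_cell N \<longrightarrow> c \<le> (LINT x|avg \<alpha> N. tent p r x)"
proof -
  \<comment> \<open>The reference cell is centred at \<open>p\<close>, so that it contains every
    ball around \<open>p\<close> of radius at most 1.\<close>
  let ?\<alpha>0 = "p - (\<Sum>b\<in>Basis. pi *\<^sub>R b)"
  interpret one: period_cell "\<lambda>_::'a. 1" ?\<alpha>0
    by (rule period_cell_one)
  define c where "c = (LINT x|avg ?\<alpha>0 (\<lambda>_. 1). tent p r x)"
  have "c \<le> (LINT x|avg \<alpha> N. tent p r x)" if N: "period_cell N" for \<alpha> N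
  proof (rule field_le_epsilon)
    interpret period_cell N \<alpha> by (rule N)
    fix e :: real assume "0 < e"
    then have "0 < e / 2" by simp
    then obtain J d where d: "\<And>x. \<bar>tent p r x - (\<Sum>i\<le>J. d i * cosdist p x ^ i)\<bar> \<le> e / 2"
      using tent_poly_approx by metis
    let ?P = "\<lambda>x. \<Sum>i\<le>J. d i * cosdist p x ^ i"
    have eq: "integral\<^sup>L (avg \<alpha> N) ?P = integral\<^sup>L (avg ?\<alpha>0 (\<lambda>_. 1)) ?P"
    proof -
      \<comment> \<open>The single frequency 0 with coefficient 1 gives a sum of modulus 1, which
        turns the formula for energies into one for the mean of the polynomial alone.\<close>
      have *: "complex_of_real (LINT x|avg \<alpha> N. ?P x * (norm (trig (\<lambda>_. 1) {0} x))\<^sup>2)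
          = complex_of_real (LINT x|avg ?\<alpha>0 (\<lambda>_. 1). ?P x * (norm (trig (\<lambda>_. 1) {0} x))\<^sup>2)"
        by (subst integral_poly_trig, simp, subst one.integral_poly_trig, auto)
      then show ?thesis
        unfolding of_real_eq_iff by (simp add: trig_def)
    qed
    have d': "tent p r x \<le> ?P x + e / 2" "?P x - e / 2 \<le> tent p r x" for x
      using d[of x] by linarith+
    have "c \<le> (LINT x|avg ?\<alpha>0 (\<lambda>_. 1). ?P x + e / 2)"
      unfolding c_def
      by (intro integral_mono one.integrable_continuous continuous_intros d')
    also have "\<dots> = (LINT x|avg ?\<alpha>0 (\<lambda>_. 1). ?P x) + (LINT x|avg ?\<alpha>0 (\<lambda>_. 1). e / 2)"
      by (rule Bochner_Integration.integral_add) (intro one.integrable_continuous continuous_intros)+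
    also have "(LINT x|avg ?\<alpha>0 (\<lambda>_. 1). e / 2) = e / 2"
      by (rule one.integral_const)
    also have "(LINT x|avg ?\<alpha>0 (\<lambda>_. 1). ?P x) + e / 2 = (LINT x|avg \<alpha> N. ?P x) - (LINT x|avg \<alpha> N. e / 2) + e"
      unfolding eq integral_const by simp
    also have "(LINT x|avg \<alpha> N. ?P x) - (LINT x|avg \<alpha> N. e / 2) = (LINT x|avg \<alpha> N. ?P x - e / 2)"
      by (rule Bochner_Integration.integral_diff[symmetric]) (intro integrable_continuous continuous_intros)+
    also have "(LINT x|avg \<alpha> N. ?P x - e / 2) \<le> (LINT x|avg \<alpha> N. tent p r x)"
      by (intro integral_mono integrable_continuous continuous_intros d')
    finally show "c \<le> (LINT x|avg \<alpha> N. tent p r x) + e" by simp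
  qed
  moreover have "0 < c"
  proof -
    have "isCont (tent p r) p"
      using continuous_on_tent[OF continuous_on_id, of UNIV p r] by (simp add: continuous_on_eq_continuous_at)
    moreover have "tent p r p = 1" by (simp add: tent_def cosdist_def)
    ultimately obtain d where d: "0 < d" "\<And>x. dist x p < d \<Longrightarrow> dist (tent p r x) 1 < 1 / 2"
      unfolding continuous_at_eps_delta by (metis half_gt_zero zero_less_one)
    define e where "e = min d 1"
    have e: "0 < e" "e \<le> d" "e \<le> 1" using d by (auto simp: e_def)
    have ball: "ball p e \<subseteq> cell ?\<alpha>0 (\<lambda>_. 1)"
    proof
      fix x assume x: "x \<in> ball p e"
      have "\<bar>(x - p) \<bullet> b\<bar> < pi" if "b \<in> Basis" for b
        using Basis_le_norm[OF that, of "x - p"] x e pi_gt3 by (simp add: dist_norm norm_minus_commute)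
      then show "x \<in> cell ?\<alpha>0 (\<lambda>_. 1)"
        by (fastforce simp: cell_def inner_diff_left inner_sum_left_Basis abs_less_iff)
    qed
    let ?V = "measure lborel (cell ?\<alpha>0 (\<lambda>_. 1))"
    have low: "1 / 2 * indicator (ball p e) x \<le> indicator (cell ?\<alpha>0 (\<lambda>_. 1)) x * tent p r x" for x
    proof (cases "x \<in> ball p e")
      case True
      then have "dist (tent p r x) 1 < 1 / 2" using d(2)[of x] e by (simp add: dist_commute)
      then have "1 / 2 \<le> tent p r x" unfolding dist_real_def by linarith
      moreover have "x \<in> cell ?\<alpha>0 (\<lambda>_. 1)" using True ball by blast
      ultimately show ?thesis using True by simp
    qed (simp add: tent_nonneg)
    have "0 < 1 / 2 * measure lborel (ball p e)"
      using e by (simp add: content_ball_pos)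
    also have "\<dots> = (LINT x|lborel. 1 / 2 * indicator (ball p e) x)"
      by simp
    also have "\<dots> \<le> (LINT x:cell ?\<alpha>0 (\<lambda>_. 1)|lborel. tent p r x)"
      unfolding set_lebesgue_integral_def real_scaleR_def
    proof (rule integral_mono)
      show "integrable lborel (\<lambda>x. 1 / 2 * indicat_real (ball p e) x)"
        by (intro integrable_mult_right integrable_real_indicator) (auto intro!: emeasure_bounded_finite simp flip: infinity_ennreal_def)
      show "integrable lborel (\<lambda>x. indicat_real (cell ?\<alpha>0 (\<lambda>_. 1)) x * tent p r x)"
        using one.integrable_continuous[OF continuous_on_tent[OF continuous_on_id], of p r]
        by (subst (asm) one.integrable_avg_iff)
           (auto simp: set_integrable_def intro!: borel_measurable_continuous_onI continuous_intros)
    qed (rule low)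
    also have "\<dots> = ?V * c"
      unfolding c_def by (subst one.integral_avg_set)
        (auto intro!: borel_measurable_continuous_onI continuous_intros)
    finally show ?thesis
      using one.measure_cell_pos by (simp add: zero_less_mult_iff)
  qed
  ultimately show ?thesis by blast
qed

subsection \<open>Frequencies in a set of bounded diameter\<close>

definition diffs :: "'a::ab_group_add set \<Rightarrow> 'a set"
  where "diffs F = {\<xi> - \<eta> |\<xi> \<eta>. \<xi> \<in> F \<and> \<eta> \<in> F}"

definition int_ball :: "real \<Rightarrow> 'a::euclidean_space set"
  where "int_ball D = {v \<in> int_lattice. norm v \<le> D}"

lemma diffsI: "\<xi> \<in> F \<Longrightarrow> \<eta> \<in> F \<Longrightarrow> \<xi> - \<eta> \<in> diffs F"
  by (auto simp: diffs_def)

lemma diffs_subsetI: "(\<And>\<xi> \<eta>. \<xi> \<in> F \<Longrightarrow> \<eta> \<in> F \<Longrightarrow> \<xi> - \<eta> \<in> X) \<Longrightarrow> diffs F \<subseteq> X"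
  by (auto simp: diffs_def)

lemma finite_int_ball: "finite (int_ball D)"
  unfolding int_ball_def by (rule finite_int_lattice_bounded)

lemma norm_cis_diff_sq: "(norm (cis u - cis v))\<^sup>2 = 2 - 2 * cos (u - v)"
proof -
  have "(norm (cis u - cis v))\<^sup>2 = (cos u - cos v)\<^sup>2 + (sin u - sin v)\<^sup>2"
    by (simp add: cmod_power2)
  also have "\<dots> = ((cos u)\<^sup>2 + (sin u)\<^sup>2) + ((cos v)\<^sup>2 + (sin v)\<^sup>2) - 2 * (cos u * cos v + sin u * sin v)"
    by (simp only: power2_diff) (simp add: algebra_simps)
  finally show ?thesis by (simp add: cos_diff)
qed

lemma norm_diff_sq_le:
  fixes x y :: "'a::real_normed_vector"
  shows "(norm (x - y))\<^sup>2 \<le> 2 * (norm x)\<^sup>2 + 2 * (norm y)\<^sup>2"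
proof -
  have "(norm (x - y))\<^sup>2 \<le> (norm x + norm y)\<^sup>2"
    by (intro power_mono norm_triangle_ineq4) auto
  also have "\<dots> \<le> 2 * (norm x)\<^sup>2 + 2 * (norm y)\<^sup>2"
    using sum_squares_bound[of "norm x" "norm y"] by (simp add: power2_sum)
  finally show ?thesis .
qed

context period_cell
begin

lemma trig_periodic:
  assumes "\<Lambda> \<subseteq> freq_lattice N" "b \<in> Basis"
  shows "trig a \<Lambda> (x + (2 * pi * real (N b)) *\<^sub>R b) = trig a \<Lambda> x"
  unfolding trig_def
proof (intro sum.cong refl arg_cong2[where f = "(*)"])
  fix \<xi> assume "\<xi> \<in> \<Lambda>"
  then obtain k :: int where k: "real (N b) * (\<xi> \<bullet> b) = of_int k"
    using assms by (auto simp: freq_lattice_def Ints_def)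
  have "cis (\<xi> \<bullet> x + 2 * pi * (real (N b) * (\<xi> \<bullet> b))) = cis (\<xi> \<bullet> x)"
    unfolding k by (simp flip: cis_mult add: cis_multiple_2pi)
  then show "cis (\<xi> \<bullet> (x + (2 * pi * real (N b)) *\<^sub>R b)) = cis (\<xi> \<bullet> x)"
    by (simp add: inner_add_right mult.assoc)
qed

end

lemma cosdist_periodic:
  assumes "b \<in> Basis"
  shows "cosdist p (x + (2 * pi * real n) *\<^sub>R b) = cosdist p x"
  unfolding cosdist_def
proof (intro sum.cong refl)
  fix d :: 'a assume "d \<in> Basis"
  have "cos (u + 2 * pi * real n) = cos u" for u
    using cos_2npi[of n] sin_2npi[of n] by (simp add: cos_add mult.commute mult.left_commute)
  moreover have eq: "(x + (2 * pi * real n) *\<^sub>R b - p) \<bullet> d = (x - p) \<bullet> d + (if d = b then 2 * pi * real n else 0)"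
    using assms \<open>d \<in> Basis\<close> by (simp add: inner_Basis inner_diff_left inner_add_left)
  ultimately show "1 - cos ((x + (2 * pi * real n) *\<^sub>R b - p) \<bullet> d) = 1 - cos ((x - p) \<bullet> d)"
    by (simp add: eq)
qed

text \<open>The difference operator built from a second frequency \<open>l\<close> removes
  \<open>l\<close>, keeps the coefficient at \<open>k\<close> up to a factor bounded below, and is
  controlled by the energy for a tent of twice the radius. As the radius halves in each round, the
  induction on the number of frequencies is over all \<open>r\<close>. The constant depends on
  \<open>p\<close>, \<open>r\<close>, \<open>D\<close> and \<open>j\<close>, but on neither the cell
  nor the frequencies.\<close>

lemma single_coeff_bound:
  fixes p :: "'a::euclidean_space"
  assumes "0 < r"
  shows "\<exists>c>0. \<forall>N \<alpha> F a k. period_cell N \<longrightarrow> finite F \<longrightarrow> card F \<le> j \<longrightarrow> k \<in> F \<longrightarrow> F \<subseteq> freq_lattice N \<longrightarrow>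
    diffs F \<subseteq> int_ball D \<longrightarrow>
    c * (norm (a k))\<^sup>2 \<le> tent_energy p r N \<alpha> a F"
  (is "\<exists>c>0. ?P j r c")
  using assms
proof (induction j arbitrary: r)
  case 0
  show ?case by (intro exI[of _ 1]) auto
next
  case (Suc j)
  obtain c0 where c0: "0 < c0" "\<And>N \<alpha>. period_cell N \<Longrightarrow> c0 \<le> (LINT x|avg \<alpha> N. tent p r x)"
    using tent_mean_pos[OF Suc.prems, of p] by blast
  have "0 < r / 2" using Suc.prems by simp
  obtain c1 where c1: "0 < c1" "?P j (r / 2) c1" using Suc.IH[OF \<open>0 < r / 2\<close>] by (elim exE conjE)
  note c1 = c1(1) c1(2)[rule_format]
  \<comment> \<open>The bound r/4 is what the shifted tent of half radius tolerates. The other bound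
    keeps \<open>t * \<bar>m\<bar>\<close> in [t, pi] for every integer \<open>m\<close> with 1
    \<le> |m| \<le> |D|, where the cosine is at most \<open>cos t\<close>.\<close>
  define t where "t = min (r / 4) (pi / (\<bar>D\<bar> + 1))"
  have t: "0 < t" "t \<le> r / 4" "t \<le> pi" "t * \<bar>D\<bar> \<le> pi"
  proof -
    show "0 < t" using Suc.prems by (simp add: t_def)
    show "t \<le> r / 4" unfolding t_def by (rule min.cobounded1)
    have *: "t \<le> pi / (\<bar>D\<bar> + 1)" unfolding t_def by (rule min.cobounded2)
    then have "t * (\<bar>D\<bar> + 1) \<le> pi" by (simp add: field_simps)
    then have "t * \<bar>D\<bar> + t \<le> pi" by (simp add: algebra_simps)
    moreover have "0 \<le> t * \<bar>D\<bar>" using \<open>0 < t\<close> by simp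
    ultimately show "t \<le> pi" "t * \<bar>D\<bar> \<le> pi" using \<open>0 < t\<close> by linarith+
  qed
  define \<tau> where "\<tau> = 2 - 2 * cos t"
  have \<tau>: "0 < \<tau>"
    using cos_monotone_0_pi[of 0 t] t by (simp add: \<tau>_def)
  \<comment> \<open>\<open>c0\<close> serves a single remaining frequency. The 10 is 2 * 4 + 2: the
    squared difference costs a factor 2 on each term, and the translated one a further 4.\<close>
  define c where "c = min c0 (c1 * \<tau> / 10)"
  have "0 < c" using c0(1) c1(1) \<tau> by (simp add: c_def)
  moreover have "c * (norm (a k))\<^sup>2 \<le> tent_energy p r N \<alpha> a F"
    if N: "period_cell N" and F: "finite F" "card F \<le> Suc j" "k \<in> F" "F \<subseteq> freq_lattice N"
      and diffs: "diffs F \<subseteq> int_ball D" for N \<alpha> F a k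
  proof -
    have D: "\<forall>\<xi>\<in>F. \<forall>\<eta>\<in>F. \<xi> - \<eta> \<in> int_lattice \<and> norm (\<xi> - \<eta>) \<le> D"
      using diffs by (auto simp: diffs_def int_ball_def)
    interpret period_cell N \<alpha> by (rule N)
    show ?thesis
    proof (cases "F = {k}")
      case True
      have "c * (norm (a k))\<^sup>2 \<le> (LINT x|avg \<alpha> N. tent p r x) * (norm (a k))\<^sup>2"
        using c0(2)[OF N, of \<alpha>] by (intro mult_right_mono) (auto simp: c_def)
      then show ?thesis
        by (simp add: True trig_def norm_mult power_mult_distrib)
    next
      case False
      then obtain l where l: "l \<in> F" "l \<noteq> k" using F(3) by blast
      then obtain b where b: "b \<in> Basis" "(k - l) \<bullet> b \<noteq> 0"
        using euclidean_all_zero_iff[of "k - l"] by auto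
      define u where "u = trig a F"
      define a' where "a' \<xi> = a \<xi> * (cis (\<xi> \<bullet> (t *\<^sub>R b)) - cis (l \<bullet> (t *\<^sub>R b)))" for \<xi>
      have u': "trig a' (F - {l}) x = u (x + t *\<^sub>R b) - cis (l \<bullet> (t *\<^sub>R b)) * u x" for x
      proof -
        have "trig a' (F - {l}) x = trig a' F x"
          unfolding trig_def using F(1) by (intro sum.mono_neutral_left) (auto simp: a'_def)
        also have "\<dots> = u (x + t *\<^sub>R b) - cis (l \<bullet> (t *\<^sub>R b)) * u x"
          unfolding trig_def u_def sum_distrib_left sum_subtractf[symmetric]
          by (intro sum.cong refl) (simp add: a'_def inner_add_right algebra_simps flip: cis_mult)
        finally show ?thesis .
      qed
      have cu: "continuous_on S f \<Longrightarrow> continuous_on S (\<lambda>x. u (f x))" for S and f :: "'a \<Rightarrow> 'a"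
        unfolding u_def by (rule continuous_on_trig)
      let ?I = "LINT x|avg \<alpha> N. tent p r x * (norm (u x))\<^sup>2"
      have tau: "\<tau> \<le> (norm (cis (k \<bullet> (t *\<^sub>R b)) - cis (l \<bullet> (t *\<^sub>R b))))\<^sup>2"
      proof -
        define m where "m = (k - l) \<bullet> b"
        have "m \<in> \<int>" "m \<noteq> 0" "\<bar>m\<bar> \<le> \<bar>D\<bar>"
          using D F(3) l b Basis_le_norm[OF b(1), of "k - l"] by (force simp: m_def int_lattice_def)+
        then have m: "1 \<le> \<bar>m\<bar>" "\<bar>m\<bar> \<le> \<bar>D\<bar>"
          using Ints_nonzero_abs_ge1 by blast+
        have "t * 1 \<le> t * \<bar>m\<bar>" "t * \<bar>m\<bar> \<le> t * \<bar>D\<bar>"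
          using m t by (intro mult_left_mono; simp)+
        then have "0 \<le> t" "t \<le> t * \<bar>m\<bar>" "t * \<bar>m\<bar> \<le> pi"
          using t by linarith+
        then have "cos (t * \<bar>m\<bar>) \<le> cos t"
          by (rule cos_monotone_0_pi_le)
        moreover have "cos (t * \<bar>m\<bar>) = cos (t * m)"
          by (simp add: abs_if)
        moreover have "k \<bullet> (t *\<^sub>R b) - l \<bullet> (t *\<^sub>R b) = t * m"
          by (simp add: m_def inner_diff_left algebra_simps)
        ultimately show ?thesis
          unfolding norm_cis_diff_sq \<tau>_def by simp
      qed
      have "c1 * (norm (a k))\<^sup>2 * \<tau> \<le> c1 * (norm (a' k))\<^sup>2"
        using tau c1(1) by (auto simp: a'_def norm_mult power_mult_distrib intro!: mult_left_mono)
      also have "\<dots> \<le> (LINT x|avg \<alpha> N. tent p (r / 2) x * (norm (trig a' (F - {l}) x))\<^sup>2)"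
        using F l D by (intro c1(2) N diffs_subsetI) (auto simp: int_ball_def)
      also have "\<dots> \<le> (LINT x|avg \<alpha> N. 2 * (tent p (r / 2) x * (norm (u (x + t *\<^sub>R b)))\<^sup>2)
            + 2 * (tent p (r / 2) x * (norm (u x))\<^sup>2))"
      proof (intro integral_mono integrable_continuous continuous_intros cu)
        show "tent p (r / 2) x * (norm (trig a' (F - {l}) x))\<^sup>2 \<le> 2 * (tent p (r / 2) x * (norm (u (x + t *\<^sub>R b)))\<^sup>2)
            + 2 * (tent p (r / 2) x * (norm (u x))\<^sup>2)" for x
          unfolding u' using mult_left_mono[OF norm_diff_sq_le[of "u (x + t *\<^sub>R b)" "cis (l \<bullet> (t *\<^sub>R b)) * u x"] tent_nonneg[of p "r / 2" x]]
          by (simp add: norm_mult algebra_simps)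
      qed
      also have "\<dots> = 2 * (LINT x|avg \<alpha> N. tent p (r / 2) x * (norm (u (x + t *\<^sub>R b)))\<^sup>2)
            + 2 * (LINT x|avg \<alpha> N. tent p (r / 2) x * (norm (u x))\<^sup>2)"
        by (subst Bochner_Integration.integral_add)
          (auto intro!: integrable_continuous continuous_intros cu integrable_mult_right)
      also have "(LINT x|avg \<alpha> N. tent p (r / 2) x * (norm (u (x + t *\<^sub>R b)))\<^sup>2)
          = (LINT x|avg \<alpha> N. tent p (r / 2) (x - t *\<^sub>R b) * (norm (u x))\<^sup>2)"
      proof -
        have "(LINT x|avg \<alpha> N. tent p (r / 2) (x + t *\<^sub>R b - t *\<^sub>R b) * (norm (u (x + t *\<^sub>R b)))\<^sup>2)
          = (LINT x|avg \<alpha> N. tent p (r / 2) (x - t *\<^sub>R b) * (norm (u x))\<^sup>2)"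
        proof (rule integral_translate[OF _ b(1)])
          have "cosdist p (x + (2 * pi * real (N b)) *\<^sub>R b - t *\<^sub>R b) = cosdist p (x - t *\<^sub>R b)" for x
            using cosdist_periodic[OF b(1), of p "x - t *\<^sub>R b" "N b"] by (simp add: algebra_simps)
          then show "tent p (r / 2) (x + (2 * pi * real (N b)) *\<^sub>R b - t *\<^sub>R b) * (norm (u (x + (2 * pi * real (N b)) *\<^sub>R b)))\<^sup>2
            = tent p (r / 2) (x - t *\<^sub>R b) * (norm (u x))\<^sup>2" for x
            unfolding u_def tent_def by (simp add: trig_periodic[OF F(4) b(1)])
          have "2 * pi * 1 \<le> 2 * pi * real (N b)"
            using N_pos[OF b(1)] by (intro mult_left_mono) auto
          then show "t \<le> 2 * pi * real (N b)" using t by linarith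
        qed (use t in \<open>auto intro!: continuous_intros cu\<close>)
        then show ?thesis by simp
      qed
      also have "\<dots> \<le> (LINT x|avg \<alpha> N. 4 * (tent p r x * (norm (u x))\<^sup>2))"
      proof (intro integral_mono integrable_continuous continuous_intros cu)
        show "tent p (r / 2) (x - t *\<^sub>R b) * (norm (u x))\<^sup>2 \<le> 4 * (tent p r x * (norm (u x))\<^sup>2)" for x
          using mult_right_mono[OF tent_half_shift[OF Suc.prems b(1), of t p x] zero_le_power2[of "norm (u x)"]] t
          by (simp add: mult.assoc)
      qed
      also have "(LINT x|avg \<alpha> N. 4 * (tent p r x * (norm (u x))\<^sup>2)) = 4 * ?I"
        by simp
      also have "(LINT x|avg \<alpha> N. tent p (r / 2) x * (norm (u x))\<^sup>2) \<le> ?I"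
        by (intro integral_mono integrable_continuous continuous_intros cu mult_right_mono tent_half_le Suc.prems) auto
      finally have "c1 * (norm (a k))\<^sup>2 * \<tau> \<le> 10 * ?I" by simp
      then have "c1 * \<tau> / 10 * (norm (a k))\<^sup>2 \<le> ?I" by (simp add: field_simps)
      moreover have "c * (norm (a k))\<^sup>2 \<le> c1 * \<tau> / 10 * (norm (a k))\<^sup>2"
        by (intro mult_right_mono) (auto simp: c_def)
      ultimately show ?thesis by (simp add: u_def)
    qed
  qed
  ultimately show ?case by blast
qed

text \<open>Subtracting one member embeds \<open>F\<close> into the lattice ball, so its size is at
  most \<open>n\<close> and the bounds on single coefficients can be added up. The denominator
  \<open>n + 1\<close> also covers an empty ball.\<close>

lemma bounded_cluster_bound:
  fixes p :: "'a::euclidean_space"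
  assumes r: "0 < r"
  shows "\<exists>c>0. \<forall>N \<alpha> F a. period_cell N \<longrightarrow> finite F \<longrightarrow> F \<subseteq> freq_lattice N \<longrightarrow>
    diffs F \<subseteq> int_ball D \<longrightarrow>
    c * coef_sq a F \<le> tent_energy p r N \<alpha> a F"
proof -
  define n where "n = card (int_ball D :: 'a set)"
  obtain c where c: "0 < c" "\<And>N \<alpha> F a k. \<lbrakk>period_cell N; finite F; card F \<le> n; k \<in> F; F \<subseteq> freq_lattice N;
     diffs F \<subseteq> int_ball D\<rbrakk> \<Longrightarrow>
    c * (norm (a k))\<^sup>2 \<le> tent_energy p r N \<alpha> a F"
    using single_coeff_bound[OF r, where j = n and D = D and p = p] by (elim exE conjE) (erule that, simp)
  have "c / (real n + 1) * coef_sq a F \<le> tent_energy p r N \<alpha> a F"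
    if N: "period_cell N" and F: "finite F" "F \<subseteq> freq_lattice N"
      and diffs: "diffs F \<subseteq> int_ball D" for N \<alpha> F a
  proof -
    have D: "\<forall>\<xi>\<in>F. \<forall>\<eta>\<in>F. \<xi> - \<eta> \<in> int_lattice \<and> norm (\<xi> - \<eta>) \<le> D"
      using diffs by (auto simp: diffs_def int_ball_def)
    let ?I = "LINT x|avg \<alpha> N. tent p r x * (norm (trig a F x))\<^sup>2"
    have I0: "0 \<le> ?I" by (intro integral_nonneg_AE) (auto simp: tent_nonneg)
    have card: "card F \<le> n"
    proof (cases "F = {}")
      case False
      then obtain \<eta> where \<eta>: "\<eta> \<in> F" by blast
      have "card F = card ((\<lambda>\<xi>. \<xi> - \<eta>) ` F)"
        by (subst card_image) auto
      also have "\<dots> \<le> n"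
        unfolding n_def using D \<eta> by (intro card_mono finite_int_ball) (auto simp: int_ball_def)
      finally show ?thesis .
    qed simp
    have "c * coef_sq a F = (\<Sum>\<xi>\<in>F. c * (norm (a \<xi>))\<^sup>2)"
      by (simp add: sum_distrib_left)
    also have "\<dots> \<le> (\<Sum>\<xi>\<in>F. ?I)"
      using c(2)[OF N F(1) card _ F(2) diffs] by (intro sum_mono) auto
    also have "\<dots> \<le> (real n + 1) * ?I"
      using I0 card by (auto intro!: mult_right_mono)
    finally show ?thesis
      by (simp add: field_simps)
  qed
  then show ?thesis
    using c(1) by (intro exI[of _ "c / (real n + 1)"]) auto
qed

subsection \<open>Clusters of frequencies in a shell\<close>

text \<open>When \<open>v\<close> leaves the span of \<open>B\<close>, its component
  \<open>z\<close> orthogonal to that span is the only new direction. Control of \<xi> on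
  \<open>v\<close> and on \<open>y\<close> controls it on \<open>z\<close>, at the price of a
  division by \<open>norm z\<close>.\<close>

lemma span_inner_bound:
  fixes B :: "'a::euclidean_space set"
  assumes "finite B"
  shows "\<exists>K\<ge>0. \<forall>\<xi>. (\<forall>v\<in>B. \<bar>\<xi> \<bullet> v\<bar> \<le> E) \<longrightarrow> (\<forall>w\<in>span B. \<bar>\<xi> \<bullet> w\<bar> \<le> K * norm w)"
  using assms
proof induction
  case empty
  then show ?case by (intro exI[of _ 0]) auto
next
  case (insert v B)
  then obtain K where K: "0 \<le> K"
    "\<And>\<xi> w. \<forall>v\<in>B. \<bar>\<xi> \<bullet> v\<bar> \<le> E \<Longrightarrow> w \<in> span B \<Longrightarrow> \<bar>\<xi> \<bullet> w\<bar> \<le> K * norm w"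
    by blast
  show ?case
  proof (cases "v \<in> span B")
    case True
    then show ?thesis
      using K by (intro exI[of _ K]) (auto simp: span_redundant)
  next
    case False
    obtain y z where y: "y \<in> span B" and orth: "\<And>w. w \<in> span B \<Longrightarrow> orthogonal z w" and v: "v = y + z"
      using orthogonal_subspace_decomp_exists[of B v] by blast
    have z: "z \<noteq> 0" using False y v by auto
    define K' where "K' = K + (\<bar>E\<bar> + K * norm y) / norm z"
    have "\<bar>\<xi> \<bullet> w\<bar> \<le> K' * norm w" if \<xi>: "\<forall>u\<in>insert v B. \<bar>\<xi> \<bullet> u\<bar> \<le> E" and w: "w \<in> span (insert v B)" for \<xi> w
    proof -
      obtain c where c: "w - c *\<^sub>R v \<in> span B"
        using w span_breakdown_eq by blast
      define w' where "w' = w - c *\<^sub>R v + c *\<^sub>R y"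
      have w': "w' \<in> span B" unfolding w'_def using c y by (intro span_add span_scale)
      have wz: "w = c *\<^sub>R z + w'" by (simp add: w'_def v algebra_simps)
      have "(norm w)\<^sup>2 = (norm (c *\<^sub>R z))\<^sup>2 + (norm w')\<^sup>2"
        unfolding wz by (rule norm_add_Pythagorean) (use orth[OF w'] in \<open>simp add: orthogonal_def\<close>)
      then have "(norm (c *\<^sub>R z))\<^sup>2 \<le> (norm w)\<^sup>2" "(norm w')\<^sup>2 \<le> (norm w)\<^sup>2" by simp_all
      then have le: "\<bar>c\<bar> * norm z \<le> norm w" "norm w' \<le> norm w"
        using power2_le_imp_le[OF _ norm_ge_zero] by fastforce+
      have c_le: "\<bar>c\<bar> \<le> norm w / norm z" using le(1) z by (simp add: field_simps)
      have "\<bar>\<xi> \<bullet> y\<bar> \<le> K * norm y" "\<bar>\<xi> \<bullet> w'\<bar> \<le> K * norm w'"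
        using K(2) \<xi> y w' by auto
      moreover have "\<bar>\<xi> \<bullet> v\<bar> \<le> \<bar>E\<bar>" using \<xi> by auto
      moreover have "\<xi> \<bullet> z = \<xi> \<bullet> v - \<xi> \<bullet> y" by (simp add: v inner_add_right)
      ultimately have z_le: "\<bar>\<xi> \<bullet> z\<bar> \<le> \<bar>E\<bar> + K * norm y" and w'_le: "\<bar>\<xi> \<bullet> w'\<bar> \<le> K * norm w"
        using mult_left_mono[OF le(2) K(1)] by linarith+
      have "\<bar>\<xi> \<bullet> w\<bar> \<le> \<bar>c\<bar> * \<bar>\<xi> \<bullet> z\<bar> + \<bar>\<xi> \<bullet> w'\<bar>"
        unfolding wz inner_add_right by (simp flip: abs_mult)
      also have "\<dots> \<le> norm w / norm z * (\<bar>E\<bar> + K * norm y) + K * norm w"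
        using c_le z_le w'_le by (intro add_mono mult_mono) auto
      also have "\<dots> = K' * norm w"
        by (simp add: K'_def algebra_simps add_divide_distrib)
      finally show ?thesis .
    qed
    moreover have "0 \<le> K'" using K(1) by (simp add: K'_def)
    ultimately show ?thesis by blast
  qed
qed

text \<open>The constant for one \<open>B\<close> deteriorates as its vectors become nearly
  dependent. Inside a fixed finite set there are only finitely many choices of \<open>B\<close>, and
  the sum of their constants serves all of them. Here the discreteness of the lattice
  enters.\<close>

lemma span_inner_bound_uniform:
  fixes F :: "'a::euclidean_space set"
  assumes "finite F"
  shows "\<exists>K\<ge>0. \<forall>B\<subseteq>F. \<forall>\<xi>. (\<forall>v\<in>B. \<bar>\<xi> \<bullet> v\<bar> \<le> E) \<longrightarrow> (\<forall>w\<in>span B. \<bar>\<xi> \<bullet> w\<bar> \<le> K * norm w)"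
proof -
  have "\<forall>B\<in>Pow F. \<exists>K\<ge>0. \<forall>\<xi>. (\<forall>v\<in>B. \<bar>\<xi> \<bullet> v\<bar> \<le> E) \<longrightarrow> (\<forall>w\<in>span B. \<bar>\<xi> \<bullet> w\<bar> \<le> K * norm w)"
    using span_inner_bound finite_subset[OF _ assms] by blast
  then obtain K where K: "\<And>B. B \<subseteq> F \<Longrightarrow> 0 \<le> K B"
    "\<And>B \<xi> w. B \<subseteq> F \<Longrightarrow> \<forall>v\<in>B. \<bar>\<xi> \<bullet> v\<bar> \<le> E \<Longrightarrow> w \<in> span B \<Longrightarrow> \<bar>\<xi> \<bullet> w\<bar> \<le> K B * norm w"
    by (metis PowI)
  have le: "K B \<le> sum K (Pow F)" if "B \<subseteq> F" for B
    using that assms K(1) by (intro member_le_sum) auto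
  have "\<bar>\<xi> \<bullet> w\<bar> \<le> sum K (Pow F) * norm w"
    if "B \<subseteq> F" "\<forall>v\<in>B. \<bar>\<xi> \<bullet> v\<bar> \<le> E" "w \<in> span B" for B \<xi> w
    using K(2)[OF that] mult_right_mono[OF le[OF that(1)] norm_ge_zero[of w]] by linarith
  moreover have "0 \<le> sum K (Pow F)"
    using K(1) by (intro sum_nonneg) auto
  ultimately show ?thesis by blast
qed

definition shell :: "real \<Rightarrow> 'a::real_normed_vector set \<Rightarrow> bool"
  where "shell \<mu> \<Lambda> \<longleftrightarrow> (\<forall>\<xi>\<in>\<Lambda>. \<bar>(norm \<xi>)\<^sup>2 - \<mu>\<bar> \<le> 1)"

lemma shellD: "shell \<mu> \<Lambda> \<Longrightarrow> \<xi> \<in> \<Lambda> \<Longrightarrow> \<bar>(norm \<xi>)\<^sup>2 - \<mu>\<bar> \<le> 1"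
  by (simp add: shell_def)

lemma shell_subset: "shell \<mu> \<Lambda> \<Longrightarrow> \<Lambda>' \<subseteq> \<Lambda> \<Longrightarrow> shell \<mu> \<Lambda>'"
  by (auto simp: shell_def)

text \<open>Since \<open>\<xi>0\<close> and \<open>\<xi>0 + v\<close> lie in the same shell,
  expanding the squares gives \<open>\<bar>\<xi>0 \<bullet> v\<bar> \<le> 1 + D\<^sup>2 / 2\<close>,
  in which \<mu> has cancelled. So \<open>\<xi>0\<close> is bounded on the span of \<open>B\<close>,
  and the same expansion for \<open>w = \<xi> - \<xi>0\<close> in that span reads
  \<open>norm w ^ 2 \<le> 2 + 2 * K * norm w\<close>.\<close>

lemma shell_span_bounded:
  "\<exists>D'. \<forall>\<Lambda> \<mu> \<xi>0 B \<xi>. shell \<mu> \<Lambda> \<longrightarrow>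
    B \<subseteq> (int_ball D :: 'a::euclidean_space set) \<longrightarrow> \<xi>0 \<in> \<Lambda> \<longrightarrow> (+) \<xi>0 ` B \<subseteq> \<Lambda> \<longrightarrow>
    \<xi> \<in> \<Lambda> \<longrightarrow> \<xi> - \<xi>0 \<in> span B \<longrightarrow> norm (\<xi> - \<xi>0) \<le> D'"
proof -
  obtain K where K: "0 \<le> K" and K_le: "\<forall>B\<subseteq>(int_ball D :: 'a set).
     \<forall>\<xi>. (\<forall>v\<in>B. \<bar>\<xi> \<bullet> v\<bar> \<le> 1 + D\<^sup>2 / 2) \<longrightarrow> (\<forall>w\<in>span B. \<bar>\<xi> \<bullet> w\<bar> \<le> K * norm w)"
    using span_inner_bound_uniform[OF finite_int_ball[of D], of "1 + D\<^sup>2 / 2"] by (elim exE conjE)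
  have expand: "(norm (\<xi> + v))\<^sup>2 = (norm \<xi>)\<^sup>2 + 2 * (\<xi> \<bullet> v) + (norm v)\<^sup>2" for \<xi> v :: 'a
    by (simp add: power2_norm_eq_inner inner_add_left inner_add_right inner_commute)
  have "norm (\<xi> - \<xi>0) \<le> 2 * K + 2"
    if sh: "shell \<mu> \<Lambda>" and B: "B \<subseteq> (int_ball D :: 'a set)"
      and \<xi>0: "\<xi>0 \<in> \<Lambda>" and Bsh: "(+) \<xi>0 ` B \<subseteq> \<Lambda>" and \<xi>: "\<xi> \<in> \<Lambda>" and w: "\<xi> - \<xi>0 \<in> span B" for \<Lambda> \<mu> \<xi>0 B \<xi>
  proof -
    have "\<bar>\<xi>0 \<bullet> v\<bar> \<le> 1 + D\<^sup>2 / 2" if v: "v \<in> B" for v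
    proof -
      have "\<bar>(norm \<xi>0)\<^sup>2 - \<mu>\<bar> \<le> 1" "\<bar>(norm (\<xi>0 + v))\<^sup>2 - \<mu>\<bar> \<le> 1"
        using sh \<xi>0 Bsh v by (auto intro!: shellD)
      moreover have "(norm v)\<^sup>2 \<le> D\<^sup>2"
        using B v by (intro power_mono) (auto simp: int_ball_def)
      ultimately show ?thesis
        using zero_le_power2[of "norm v"] zero_le_power2[of D] expand[of \<xi>0 v] by linarith
    qed
    then have *: "\<bar>\<xi>0 \<bullet> (\<xi> - \<xi>0)\<bar> \<le> K * norm (\<xi> - \<xi>0)"
      by (intro K_le[rule_format, OF B _ w])
    have "\<bar>(norm \<xi>0)\<^sup>2 - \<mu>\<bar> \<le> 1" "\<bar>(norm (\<xi>0 + (\<xi> - \<xi>0)))\<^sup>2 - \<mu>\<bar> \<le> 1"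
      using sh \<xi>0 \<xi> by (auto intro!: shellD)
    then have sq: "norm (\<xi> - \<xi>0) * norm (\<xi> - \<xi>0) \<le> 2 + 2 * (K * norm (\<xi> - \<xi>0))"
      using * expand[of \<xi>0 "\<xi> - \<xi>0"] unfolding power2_eq_square by linarith
    show ?thesis
    proof (rule ccontr)
      assume "\<not> ?thesis"
      then have big: "2 * K + 2 < norm (\<xi> - \<xi>0)" by simp
      then have "(2 * K + 2) * norm (\<xi> - \<xi>0) \<le> norm (\<xi> - \<xi>0) * norm (\<xi> - \<xi>0)"
        by (intro mult_right_mono) auto
      then have "2 * norm (\<xi> - \<xi>0) \<le> 2" using sq by (simp add: algebra_simps)
      then show False using big K by linarith
    qed
  qed
  then show ?thesis by blast
qed

definition steps :: "nat \<Rightarrow> 'a::euclidean_space set \<Rightarrow> ('a \<times> 'a) set"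
  where "steps J \<Lambda> = {(\<xi>, \<eta>). \<xi> \<in> \<Lambda> \<and> \<eta> \<in> \<Lambda> \<and> \<not> far J (\<xi> - \<eta>)}"

lemma not_far_norm: "\<not> far J m \<Longrightarrow> norm (m :: 'a::euclidean_space) \<le> DIM('a) * real J"
proof -
  assume "\<not> far J m"
  then have "(\<Sum>b\<in>(Basis :: 'a set). \<bar>m \<bullet> b\<bar>) \<le> (\<Sum>b\<in>(Basis :: 'a set). real J)"
    by (intro sum_mono) (auto simp: far_def not_less)
  then show ?thesis
    using norm_le_l1[of m] by simp
qed

lemma far_uminus: "far J (- m) \<longleftrightarrow> far J m"
proof -
  have "- m \<in> int_lattice \<longleftrightarrow> m \<in> int_lattice"
    by (auto simp: int_lattice_def)
  then show ?thesis by (simp add: far_def)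
qed

lemma sym_steps: "sym (steps J \<Lambda>)"
  unfolding sym_def steps_def using far_uminus by (metis (no_types, lifting) case_prodD case_prodI mem_Collect_eq minus_diff_eq)

text \<open>As long as the cluster of \<open>\<xi>0\<close> is not contained in the affine span of
  the vectors collected so far, some step leads out of that span. Its starting point is near
  \<open>\<xi>0\<close> by the shell condition, hence so is its end point, which raises the
  dimension by one. The radius is fixed before \<Lambda>, \<mu> and \<open>\<xi>0\<close> are
  chosen.\<close>

lemma cluster_growth:
  "\<exists>D. \<forall>\<Lambda> \<mu> \<xi>0. shell \<mu> \<Lambda> \<longrightarrow> diffs \<Lambda> \<subseteq> int_lattice \<longrightarrow> \<xi>0 \<in> \<Lambda> \<longrightarrow>
    (\<exists>B \<subseteq> (int_ball D :: 'a::euclidean_space set). (+) \<xi>0 ` B \<subseteq> \<Lambda> \<and>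
      (j \<le> dim B \<or> (\<forall>\<eta>. (\<xi>0, \<eta>) \<in> (steps J \<Lambda>)\<^sup>* \<longrightarrow> \<eta> - \<xi>0 \<in> span B)))"
  (is "\<exists>D. ?P j D")
proof (induction j)
  case 0
  show ?case by (rule exI[of _ 0]) auto
next
  case (Suc j)
  then obtain D where "?P j D" ..
  note D = this[rule_format]
  obtain D' where D': "\<And>\<Lambda> \<mu> \<xi>0 B \<xi>. shell \<mu> \<Lambda> \<Longrightarrow>
    B \<subseteq> (int_ball D :: 'a set) \<Longrightarrow> \<xi>0 \<in> \<Lambda> \<Longrightarrow> (+) \<xi>0 ` B \<subseteq> \<Lambda> \<Longrightarrow>
    \<xi> \<in> \<Lambda> \<Longrightarrow> \<xi> - \<xi>0 \<in> span B \<Longrightarrow> norm (\<xi> - \<xi>0) \<le> D'"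
    using shell_span_bounded[where D = D and 'a = 'a] by (elim exE) (rule that, iprover)
  \<comment> \<open>\<open>D'\<close> reaches the last point inside the span; one step, which
    changes every coordinate by at most \<open>J\<close>, adds at most the other summand.\<close>
  define D1 where "D1 = max D (D' + DIM('a) * real J)"
  have "\<exists>B \<subseteq> (int_ball D1 :: 'a set). (+) \<xi>0 ` B \<subseteq> \<Lambda> \<and>
      (Suc j \<le> dim B \<or> (\<forall>\<eta>. (\<xi>0, \<eta>) \<in> (steps J \<Lambda>)\<^sup>* \<longrightarrow> \<eta> - \<xi>0 \<in> span B))"
    if sh: "shell \<mu> \<Lambda>" and int: "diffs \<Lambda> \<subseteq> int_lattice" and \<xi>0: "\<xi>0 \<in> \<Lambda>" for \<Lambda> \<mu> \<xi>0
  proof -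
    obtain B where B: "B \<subseteq> (int_ball D :: 'a set)" "(+) \<xi>0 ` B \<subseteq> \<Lambda>"
      "j \<le> dim B \<or> (\<forall>\<eta>. (\<xi>0, \<eta>) \<in> (steps J \<Lambda>)\<^sup>* \<longrightarrow> \<eta> - \<xi>0 \<in> span B)"
      using D[OF sh int \<xi>0] by blast
    have BD1: "B \<subseteq> int_ball D1"
      using B(1) by (auto simp: D1_def int_ball_def)
    show ?thesis
    proof (cases "\<forall>\<eta>. (\<xi>0, \<eta>) \<in> (steps J \<Lambda>)\<^sup>* \<longrightarrow> \<eta> - \<xi>0 \<in> span B")
      case True
      then show ?thesis using B(2) BD1 by blast
    next
      case False
      then have dimB: "j \<le> dim B" using B(3) by blast
      obtain \<zeta> where "(\<xi>0, \<zeta>) \<in> (steps J \<Lambda>)\<^sup>*" "\<zeta> - \<xi>0 \<notin> span B"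
        using False by blast
      \<comment> \<open>The first step at which the path from \<open>\<xi>0\<close> to \<zeta>
        leaves the affine span.\<close>
      then obtain \<eta> \<eta>' where \<eta>: "(\<eta>, \<eta>') \<in> steps J \<Lambda>" "\<eta> - \<xi>0 \<in> span B" "\<eta>' - \<xi>0 \<notin> span B"
        by (induction rule: rtrancl_induct) (auto simp: span_zero)
      then have \<eta>\<Lambda>: "\<eta> \<in> \<Lambda>" "\<eta>' \<in> \<Lambda>" and nf: "\<not> far J (\<eta>' - \<eta>)"
        using far_uminus[of J "\<eta> - \<eta>'"] by (auto simp: steps_def)
      have "norm (\<eta>' - \<xi>0) \<le> norm (\<eta>' - \<eta>) + norm (\<eta> - \<xi>0)"
        using norm_triangle_ineq[of "\<eta>' - \<eta>" "\<eta> - \<xi>0"] by simp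
      also have "\<dots> \<le> DIM('a) * real J + D'"
        using not_far_norm[OF nf] D'[OF sh B(1) \<xi>0 B(2) \<eta>\<Lambda>(1) \<eta>(2)] by (rule add_mono)
      finally have "insert (\<eta>' - \<xi>0) B \<subseteq> int_ball D1"
        using BD1 int diffsI[OF \<eta>\<Lambda>(2) \<xi>0] by (auto simp: D1_def int_ball_def)
      moreover have "Suc j \<le> dim (insert (\<eta>' - \<xi>0) B)"
        using dimB \<eta>(3) by (simp add: dim_insert)
      ultimately show ?thesis
        using B(2) \<eta>\<Lambda>(2) by (intro exI[of _ "insert (\<eta>' - \<xi>0) B"]) auto
    qed
  qed
  then show ?case by blast
qed

text \<open>Induction on the dimension of a subspace \<open>W\<close> containing all differences. If
  some point of \<Lambda> has nearby neighbours in \<Lambda> spanning all of \<open>W\<close>, then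
  the whole of \<Lambda> has bounded diameter. Otherwise each cluster lies in a translate of a
  subspace of smaller dimension, where the induction hypothesis applies, and the clusters
  decouple.\<close>

lemma coset_bound:
  fixes p :: "'a::euclidean_space"
  assumes r: "0 < r"
  shows "\<exists>c>0. \<forall>N \<alpha> \<mu> \<Lambda> a W. period_cell N \<longrightarrow> finite \<Lambda> \<longrightarrow> \<Lambda> \<subseteq> freq_lattice N \<longrightarrow>
    shell \<mu> \<Lambda> \<longrightarrow> diffs \<Lambda> \<subseteq> int_lattice \<inter> W \<longrightarrow> subspace W \<longrightarrow> dim W \<le> k \<longrightarrow>
    c * coef_sq a \<Lambda> \<le> tent_energy p r N \<alpha> a \<Lambda>"
  (is "\<exists>c>0. ?P k c")
proof (induction k)
  case 0
  obtain c where c: "0 < c" "\<And>N \<alpha> F a. \<lbrakk>period_cell N; finite F; F \<subseteq> freq_lattice N;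
     diffs F \<subseteq> int_ball 0\<rbrakk> \<Longrightarrow>
    c * coef_sq a F \<le> tent_energy p r N \<alpha> a F"
    using bounded_cluster_bound[OF r, where D = 0 and p = p] by (elim exE conjE) (erule that, iprover)
  have W0: "diffs \<Lambda> \<subseteq> int_ball 0" if "dim W \<le> 0" "diffs \<Lambda> \<subseteq> int_lattice \<inter> W" for W and \<Lambda> :: "'a set"
    using that dim_eq_0[of W] by (auto simp: int_ball_def)
  show ?case
    using c(1) W0 by (intro exI[of _ c] conjI allI impI c(2))
next
  case (Suc k)
  then obtain c where c: "0 < c" "?P k c" by (elim exE conjE)
  note c = c(1) c(2)[rule_format]
  \<comment> \<open>The order of the choices matters: the constant of the lower dimension fixes the
    precision, hence the degree \<open>J\<close>, hence which frequencies count as linked. With this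
    \<epsilon>, half of \<open>c\<close> survives the splitting into clusters.\<close>
  define \<epsilon> where "\<epsilon> = c / 4"
  have "0 < \<epsilon>" using c(1) by (simp add: \<epsilon>_def)
  then obtain J and d :: "nat \<Rightarrow> real" where d: "\<And>x. \<bar>tent p r x - (\<Sum>i\<le>J. d i * cosdist p x ^ i)\<bar> \<le> \<epsilon>"
    using tent_poly_approx by metis
  obtain D where D: "\<And>\<Lambda> \<mu> \<xi>0. shell \<mu> \<Lambda> \<Longrightarrow> diffs \<Lambda> \<subseteq> int_lattice \<Longrightarrow> \<xi>0 \<in> \<Lambda> \<Longrightarrow>
    (\<exists>B \<subseteq> (int_ball D :: 'a set). (+) \<xi>0 ` B \<subseteq> \<Lambda> \<and>
      (Suc k \<le> dim B \<or> (\<forall>\<eta>. (\<xi>0, \<eta>) \<in> (steps J \<Lambda>)\<^sup>* \<longrightarrow> \<eta> - \<xi>0 \<in> span B)))"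
    using cluster_growth[where 'a = 'a and j = "Suc k" and J = J] by (elim exE) (rule that, iprover)
  obtain D' where D': "\<And>\<Lambda> \<mu> \<xi>0 B \<xi>. shell \<mu> \<Lambda> \<Longrightarrow>
    B \<subseteq> (int_ball D :: 'a set) \<Longrightarrow> \<xi>0 \<in> \<Lambda> \<Longrightarrow> (+) \<xi>0 ` B \<subseteq> \<Lambda> \<Longrightarrow>
    \<xi> \<in> \<Lambda> \<Longrightarrow> \<xi> - \<xi>0 \<in> span B \<Longrightarrow> norm (\<xi> - \<xi>0) \<le> D'"
    using shell_span_bounded[where D = D and 'a = 'a] by (elim exE) (rule that, iprover)
  obtain c' where c': "0 < c'" "\<And>N \<alpha> F a. \<lbrakk>period_cell N; finite F; F \<subseteq> freq_lattice N;
     diffs F \<subseteq> int_ball (2 * D')\<rbrakk> \<Longrightarrow>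
    c' * coef_sq a F \<le> tent_energy p r N \<alpha> a F"
    using bounded_cluster_bound[OF r, where D = "2 * D'" and p = p] by (elim exE conjE) (erule that, iprover)
  have "min (c / 2) c' * coef_sq a \<Lambda> \<le> tent_energy p r N \<alpha> a \<Lambda>"
    if N: "period_cell N" and fin: "finite \<Lambda>" and \<Lambda>: "\<Lambda> \<subseteq> freq_lattice N"
      and sh: "shell \<mu> \<Lambda>" and W: "diffs \<Lambda> \<subseteq> int_lattice \<inter> W"
      and sub: "subspace W" and dimW: "dim W \<le> Suc k" for N \<alpha> \<mu> \<Lambda> a W
  proof -
    interpret period_cell N \<alpha> by (rule N)
    let ?S = "\<Sum>\<xi>\<in>\<Lambda>. (norm (a \<xi>))\<^sup>2"
    have S0: "0 \<le> ?S" by (intro sum_nonneg) auto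
    have int: "diffs \<Lambda> \<subseteq> int_lattice" using W by blast
    show ?thesis
    proof (cases "\<exists>\<xi>0\<in>\<Lambda>. \<exists>B \<subseteq> (int_ball D :: 'a set). (+) \<xi>0 ` B \<subseteq> \<Lambda> \<and> Suc k \<le> dim B")
      case True
      then obtain \<xi>0 B where \<xi>0: "\<xi>0 \<in> \<Lambda>" and B: "B \<subseteq> (int_ball D :: 'a set)"
        "(+) \<xi>0 ` B \<subseteq> \<Lambda>" "Suc k \<le> dim B" by blast
      have "v \<in> W" if "v \<in> B" for v
      proof -
        have "(\<xi>0 + v) - \<xi>0 \<in> W" using W \<xi>0 B(2) that diffsI[of "\<xi>0 + v" \<Lambda> \<xi>0] by blast
        then show ?thesis by simp
      qed
      then have "span B \<subseteq> W" using sub by (simp add: span_minimal subsetI)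
      then have "span B = W"
        using sub B(3) dimW by (intro subspace_dim_equal) auto
      then have near: "norm (\<xi> - \<xi>0) \<le> D'" if "\<xi> \<in> \<Lambda>" for \<xi>
        using D'[OF sh B(1) \<xi>0 B(2) that] W diffsI[OF that \<xi>0] by blast
      have "norm (\<xi> - \<eta>) \<le> 2 * D'" if "\<xi> \<in> \<Lambda>" "\<eta> \<in> \<Lambda>" for \<xi> \<eta>
        using norm_triangle_ineq4[of "\<xi> - \<xi>0" "\<eta> - \<xi>0"] near[OF that(1)] near[OF that(2)] by simp
      then have "c' * ?S \<le> tent_energy p r N \<alpha> a \<Lambda>"
        using int by (intro c'(2) N fin \<Lambda> diffs_subsetI) (auto simp: int_ball_def intro: diffsI)
      moreover have "min (c / 2) c' * ?S \<le> c' * ?S"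
        using S0 by (intro mult_right_mono) auto
      ultimately show ?thesis by linarith
    next
      case False
      define cl where "cl \<xi> = {\<eta>. (\<xi>, \<eta>) \<in> (steps J \<Lambda>)\<^sup>*}" for \<xi>
      have symr: "sym ((steps J \<Lambda>)\<^sup>*)" by (rule sym_rtrancl[OF sym_steps])
      have "(c - 2 * \<epsilon>) * ?S \<le> tent_energy p r N \<alpha> a \<Lambda>"
      proof (rule block_lower_bound[OF fin \<Lambda> d])
        fix \<xi> \<eta> assume *: "\<xi> \<in> \<Lambda>" "\<eta> \<in> \<Lambda>" "cl \<xi> \<noteq> cl \<eta>"
        show "far J (\<xi> - \<eta>)"
        proof (rule ccontr)
          assume "\<not> far J (\<xi> - \<eta>)"
          then have "(\<xi>, \<eta>) \<in> (steps J \<Lambda>)\<^sup>*" using * by (auto simp: steps_def)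
          then have "cl \<xi> = cl \<eta>"
            unfolding cl_def using symr by (auto dest: symD intro: rtrancl_trans)
          with * show False by simp
        qed
      next
        fix y assume "y \<in> cl ` \<Lambda>"
        then obtain \<xi>0 where \<xi>0: "\<xi>0 \<in> \<Lambda>" "y = cl \<xi>0" by blast
        obtain B where B: "B \<subseteq> (int_ball D :: 'a set)" "(+) \<xi>0 ` B \<subseteq> \<Lambda>"
          "Suc k \<le> dim B \<or> (\<forall>\<eta>. (\<xi>0, \<eta>) \<in> (steps J \<Lambda>)\<^sup>* \<longrightarrow> \<eta> - \<xi>0 \<in> span B)"
          using D[OF sh int \<xi>0(1)] by blast
        then have dimB: "dim B \<le> k" and sp: "\<And>\<eta>. (\<xi>0, \<eta>) \<in> (steps J \<Lambda>)\<^sup>* \<Longrightarrow> \<eta> - \<xi>0 \<in> span B"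
          using False \<xi>0(1) not_less_eq_eq by blast+
        have mem: "\<xi> - \<xi>0 \<in> span B" if "\<xi> \<in> \<Lambda>" "cl \<xi> = y" for \<xi>
        proof (rule sp)
          have "\<xi> \<in> cl \<xi>" by (simp add: cl_def)
          then have "\<xi> \<in> cl \<xi>0" using that \<xi>0 by simp
          then show "(\<xi>0, \<xi>) \<in> (steps J \<Lambda>)\<^sup>*" by (simp add: cl_def)
        qed
        have mem2: "\<xi> - \<eta> \<in> span B" if "\<xi> \<in> \<Lambda>" "cl \<xi> = y" "\<eta> \<in> \<Lambda>" "cl \<eta> = y" for \<xi> \<eta>
          using span_diff[OF mem[OF that(1,2)] mem[OF that(3,4)]] by simp
        show "c * (\<Sum>\<xi> | \<xi> \<in> \<Lambda> \<and> cl \<xi> = y. (norm (a \<xi>))\<^sup>2)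
            \<le> tent_energy p r N \<alpha> a {\<xi> \<in> \<Lambda>. cl \<xi> = y}"
          using fin \<Lambda> sh int mem2 dimB
          by (intro c(2)[where W = "span B" and \<mu> = \<mu>] N diffs_subsetI)
            (auto intro: shell_subset diffsI)
      qed
      moreover have "min (c / 2) c' * ?S \<le> (c - 2 * \<epsilon>) * ?S"
        using S0 by (intro mult_right_mono) (auto simp: \<epsilon>_def)
      ultimately show ?thesis by linarith
    qed
  qed
  moreover have "0 < min (c / 2) c'" using c(1) c'(1) by simp
  ultimately show ?case by blast
qed

text \<open>Frequencies in different cosets of the integer lattice are far at every level
  \<open>J\<close>, so the bound for one coset extends to all of \<Lambda>. However fine
  \<open>freq_lattice N\<close> is, the number of cosets does not enter.\<close>

theorem trig_observability:
  fixes p :: "'a::euclidean_space"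
  assumes r: "0 < r"
  shows "\<exists>c>0. \<forall>N \<alpha> \<mu> \<Lambda> a. period_cell N \<longrightarrow> finite \<Lambda> \<longrightarrow> \<Lambda> \<subseteq> freq_lattice N \<longrightarrow>
    shell \<mu> \<Lambda> \<longrightarrow>
    c * coef_sq a \<Lambda> \<le> tent_energy p r N \<alpha> a \<Lambda>"
proof -
  obtain c where c: "0 < c" "\<And>N \<alpha> \<mu> \<Lambda> a W. \<lbrakk>period_cell N; finite \<Lambda>; \<Lambda> \<subseteq> freq_lattice N;
    shell \<mu> \<Lambda>; diffs \<Lambda> \<subseteq> int_lattice \<inter> W; subspace W; dim W \<le> DIM('a)\<rbrakk> \<Longrightarrow>
    c * coef_sq a \<Lambda> \<le> tent_energy p r N \<alpha> a \<Lambda>"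
    using coset_bound[OF r, where k = "DIM('a)" and p = p] by (elim exE conjE) (erule that, iprover)
  define \<epsilon> where "\<epsilon> = c / 4"
  have "0 < \<epsilon>" using c(1) by (simp add: \<epsilon>_def)
  then obtain J and d :: "nat \<Rightarrow> real" where d: "\<And>x. \<bar>tent p r x - (\<Sum>i\<le>J. d i * cosdist p x ^ i)\<bar> \<le> \<epsilon>"
    using tent_poly_approx by metis
  have "c / 2 * coef_sq a \<Lambda> \<le> tent_energy p r N \<alpha> a \<Lambda>"
    if N: "period_cell N" and fin: "finite \<Lambda>" and \<Lambda>: "\<Lambda> \<subseteq> freq_lattice N"
      and sh: "shell \<mu> \<Lambda>" for N \<alpha> \<mu> \<Lambda> a
  proof -
    interpret period_cell N \<alpha> by (rule N)
    define cl where "cl \<xi> = {\<eta>. \<xi> - \<eta> \<in> int_lattice}" for \<xi> :: 'a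
    have self: "\<xi> \<in> cl \<xi>" for \<xi> by (simp add: cl_def int_lattice_def)
    have cl_eq: "cl \<xi> = cl \<eta>" if "\<xi> - \<eta> \<in> int_lattice" for \<xi> \<eta>
    proof -
      have "\<xi> - \<zeta> \<in> int_lattice \<longleftrightarrow> \<eta> - \<zeta> \<in> int_lattice" for \<zeta>
        using int_lattice_diff[OF _ that, of "\<xi> - \<zeta>"] int_lattice_add[OF that, of "\<eta> - \<zeta>"] by auto
      then show ?thesis by (simp add: cl_def)
    qed
    have "(c - 2 * \<epsilon>) * coef_sq a \<Lambda> \<le> tent_energy p r N \<alpha> a \<Lambda>"
    proof (rule block_lower_bound[OF fin \<Lambda> d, where cl = cl])
      show "far J (\<xi> - \<eta>)" if "cl \<xi> \<noteq> cl \<eta>" for \<xi> \<eta>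
        using cl_eq[of \<xi> \<eta>] that by (auto simp: far_def)
      fix y assume "y \<in> cl ` \<Lambda>"
      have "\<xi> - \<eta> \<in> int_lattice" if "cl \<xi> = y" "cl \<eta> = y" for \<xi> \<eta>
        using self[of \<eta>] that unfolding cl_def by blast
      then show "c * (\<Sum>\<xi> | \<xi> \<in> \<Lambda> \<and> cl \<xi> = y. (norm (a \<xi>))\<^sup>2)
            \<le> tent_energy p r N \<alpha> a {\<xi> \<in> \<Lambda>. cl \<xi> = y}"
        using fin \<Lambda> sh
        by (intro c(2)[where W = UNIV and \<mu> = \<mu>] N diffs_subsetI)
          (auto intro: shell_subset dim_subset_UNIV)
    qed
    then show ?thesis by (simp add: \<epsilon>_def)
  qed
  then show ?thesis
    using c(1) by (intro exI[of _ "c / 2"]) auto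
qed

subsection \<open>Completeness of the exponentials\<close>

context period_cell
begin

definition sq_int :: "('a \<Rightarrow> complex) \<Rightarrow> bool"
  where "sq_int v \<longleftrightarrow> v \<in> borel_measurable borel \<and> integrable (avg \<alpha> N) (\<lambda>x. (norm (v x))\<^sup>2)"

definition trig_poly :: "('a \<Rightarrow> complex) \<Rightarrow> bool"
  where "trig_poly f \<longleftrightarrow> (\<exists>\<Lambda> a. finite \<Lambda> \<and> \<Lambda> \<subseteq> freq_lattice N \<and> f = trig a \<Lambda>)"

lemma trig_poly_add:
  assumes "trig_poly f" "trig_poly g"
  shows "trig_poly (\<lambda>x. f x + g x)"
proof -
  obtain \<Lambda> a \<Lambda>' a' where *: "finite \<Lambda>" "\<Lambda> \<subseteq> freq_lattice N" "f = trig a \<Lambda>"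
    "finite \<Lambda>'" "\<Lambda>' \<subseteq> freq_lattice N" "g = trig a' \<Lambda>'"
    using assms unfolding trig_poly_def by blast
  define d where "d \<xi> = (if \<xi> \<in> \<Lambda> then a \<xi> else 0) + (if \<xi> \<in> \<Lambda>' then a' \<xi> else 0)" for \<xi>
  have "trig d (\<Lambda> \<union> \<Lambda>') x = f x + g x" for x
  proof -
    have "trig d (\<Lambda> \<union> \<Lambda>') x = (\<Sum>\<xi>\<in>\<Lambda> \<union> \<Lambda>'. if \<xi> \<in> \<Lambda> then a \<xi> * cis (\<xi> \<bullet> x) else 0)
      + (\<Sum>\<xi>\<in>\<Lambda> \<union> \<Lambda>'. if \<xi> \<in> \<Lambda>' then a' \<xi> * cis (\<xi> \<bullet> x) else 0)"
      unfolding trig_def d_def sum.distrib[symmetric] by (intro sum.cong refl) (simp add: distrib_right)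
    also have "\<dots> = f x + g x"
      using * by (simp add: trig_def sum.If_cases Int_absorb1 Int_absorb2 flip: sum.inter_restrict)
    finally show ?thesis .
  qed
  then have "(\<lambda>x. f x + g x) = trig d (\<Lambda> \<union> \<Lambda>')" by auto
  then show ?thesis
    unfolding trig_poly_def using * by (metis finite_UnI le_sup_iff)
qed

lemma trig_poly_cis: "\<xi> \<in> freq_lattice N \<Longrightarrow> trig_poly (\<lambda>x. c * cis (\<xi> \<bullet> x))"
  unfolding trig_poly_def by (intro exI[of _ "{\<xi>}"] exI[of _ "\<lambda>_. c"]) (auto simp: trig_def fun_eq_iff)

lemma trig_poly_const: "trig_poly (\<lambda>x. c)"
  using trig_poly_cis[of 0 c] by simp

lemma trig_poly_sum:
  "(\<And>i. i \<in> I \<Longrightarrow> trig_poly (f i)) \<Longrightarrow> trig_poly (\<lambda>x. \<Sum>i\<in>I. f i x)"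
proof (induction I rule: infinite_finite_induct)
  case (insert i I)
  then have "trig_poly (\<lambda>x. f i x + (\<Sum>i\<in>I. f i x))"
    by (intro trig_poly_add) auto
  then show ?case using insert.hyps by simp
qed (auto simp: trig_poly_const)

lemma trig_poly_mult:
  assumes "trig_poly f" "trig_poly g"
  shows "trig_poly (\<lambda>x. f x * g x)"
proof -
  obtain \<Lambda> a \<Lambda>' a' where *: "\<Lambda> \<subseteq> freq_lattice N" "f = trig a \<Lambda>"
    "\<Lambda>' \<subseteq> freq_lattice N" "g = trig a' \<Lambda>'"
    using assms unfolding trig_poly_def by blast
  have "f x * g x = (\<Sum>\<xi>\<in>\<Lambda>. \<Sum>\<eta>\<in>\<Lambda>'. (a \<xi> * a' \<eta>) * cis ((\<xi> + \<eta>) \<bullet> x))" for x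
    unfolding * trig_def sum_product
    by (intro sum.cong refl) (simp add: inner_add_left mult_ac flip: cis_mult)
  moreover have "trig_poly (\<lambda>x. \<Sum>\<xi>\<in>\<Lambda>. \<Sum>\<eta>\<in>\<Lambda>'. (a \<xi> * a' \<eta>) * cis ((\<xi> + \<eta>) \<bullet> x))"
    using * by (intro trig_poly_sum trig_poly_cis freq_lattice_add) auto
  ultimately show ?thesis by simp
qed

lemma trig_poly_cos_sin:
  assumes "b \<in> Basis"
  shows "trig_poly (\<lambda>x. complex_of_real (cos (x \<bullet> b / real (N b))))"
    and "trig_poly (\<lambda>x. complex_of_real (sin (x \<bullet> b / real (N b))))"
proof -
  define \<xi> where "\<xi> = (1 / real (N b)) *\<^sub>R b"
  have \<xi>: "\<xi> \<in> freq_lattice N" "- \<xi> \<in> freq_lattice N"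
    using assms N_pos[OF assms] by (auto simp: freq_lattice_def \<xi>_def inner_Basis)
  have x: "x \<bullet> b / real (N b) = \<xi> \<bullet> x" for x
    by (simp add: \<xi>_def inner_commute)
  have "complex_of_real (cos (\<xi> \<bullet> x)) = 1 / 2 * cis (\<xi> \<bullet> x) + 1 / 2 * cis (- \<xi> \<bullet> x)"
    "complex_of_real (sin (\<xi> \<bullet> x)) = - \<i> / 2 * cis (\<xi> \<bullet> x) + \<i> / 2 * cis (- \<xi> \<bullet> x)" for x
    by (simp_all add: complex_eq_iff)
  then show "trig_poly (\<lambda>x. complex_of_real (cos (x \<bullet> b / real (N b))))"
    "trig_poly (\<lambda>x. complex_of_real (sin (x \<bullet> b / real (N b))))"
    unfolding x using \<xi> by (simp_all only:) (intro trig_poly_add trig_poly_cis; assumption)+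
qed

text \<open>Embeds the torus belonging to the periods \<open>N\<close> into Euclidean space by
  cosines and sines, so that Stone-Weierstrass for ordinary polynomials yields trigonometric
  ones.\<close>

definition torus_map :: "'a \<Rightarrow> 'a \<times> 'a"
  where "torus_map x = (\<Sum>b\<in>Basis. cos (x \<bullet> b / real (N b)) *\<^sub>R b, \<Sum>b\<in>Basis. sin (x \<bullet> b / real (N b)) *\<^sub>R b)"

lemma trig_poly_real_polynomial:
  "real_polynomial_function q \<Longrightarrow> trig_poly (\<lambda>x. complex_of_real (q (torus_map x)))"
proof (induction rule: real_polynomial_function.induct)
  case (linear f)
  then interpret f: bounded_linear f .
  have "f (torus_map x) = (\<Sum>b\<in>Basis. cos (x \<bullet> b / real (N b)) * f (b, 0)) + (\<Sum>b\<in>Basis. sin (x \<bullet> b / real (N b)) * f (0, b))" for x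
  proof -
    have eq: "torus_map x = (\<Sum>b\<in>Basis. cos (x \<bullet> b / real (N b)) *\<^sub>R (b, 0)) + (\<Sum>b\<in>Basis. sin (x \<bullet> b / real (N b)) *\<^sub>R (0, b))"
      by (simp add: torus_map_def prod_eq_iff fst_sum snd_sum)
    show ?thesis unfolding eq f.add f.sum f.scaleR by simp
  qed
  moreover have "trig_poly (\<lambda>x. (\<Sum>b\<in>Basis. complex_of_real (cos (x \<bullet> b / real (N b))) * complex_of_real (f (b, 0)))
      + (\<Sum>b\<in>Basis. complex_of_real (sin (x \<bullet> b / real (N b))) * complex_of_real (f (0, b))))"
    by (intro trig_poly_add trig_poly_sum trig_poly_mult trig_poly_cos_sin trig_poly_const)
  ultimately show ?case by simp
next
  case (add f g)
  then show ?case unfolding of_real_add by (intro trig_poly_add)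
next
  case (mult f g)
  then show ?case unfolding of_real_mult by (intro trig_poly_mult)
qed (rule trig_poly_const)

text \<open>\<open>torus_map\<close> identifies only boundary points of the closed cell. There \<open>w\<close> vanishes, so it descends to
  the image, on which polynomials are trigonometric polynomials.\<close>

lemma uniform_approx:
  assumes w: "continuous_on UNIV w" and w0: "\<And>x. x \<notin> box \<alpha> corner \<Longrightarrow> w x = 0" and e: "0 < e"
  shows "\<exists>P. trig_poly P \<and> (\<forall>x\<in>cbox \<alpha> corner. norm (w x - P x) < e)"
proof -
  let ?C = "cbox \<alpha> corner"
  define T where "T = torus_map ` ?C"
  have cont: "continuous_on S torus_map" for S
    unfolding torus_map_def using N_pos by (intro continuous_intros) auto
  have T: "compact T"
    unfolding T_def by (intro compact_continuous_image cont) auto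
  have inj: "w x = w y" if x: "x \<in> ?C" and y: "y \<in> ?C" and eq: "torus_map x = torus_map y" for x y
  proof (cases "x = y")
    case False
    then obtain b where b: "b \<in> Basis" "x \<bullet> b \<noteq> y \<bullet> b"
      using euclidean_eqI by blast
    have "cos (x \<bullet> b / real (N b)) = fst (torus_map x) \<bullet> b" "sin (x \<bullet> b / real (N b)) = snd (torus_map x) \<bullet> b" for x
      using b by (simp_all add: torus_map_def inner_sum_left_Basis)
    then have "sin (x \<bullet> b / real (N b)) = sin (y \<bullet> b / real (N b)) \<and> cos (x \<bullet> b / real (N b)) = cos (y \<bullet> b / real (N b))"
      by (simp add: eq)
    then obtain k :: int where "x \<bullet> b / real (N b) = y \<bullet> b / real (N b) + 2 * pi * k"
      using sin_cos_eq_iff by blast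
    then have k: "x \<bullet> b = y \<bullet> b + (2 * pi * real (N b)) * k"
      using N_pos[OF b(1)] by (simp add: field_simps)
    let ?P = "2 * pi * real (N b)"
    have P: "0 < ?P" using N_pos[OF b(1)] by simp
    have bnd: "\<alpha> \<bullet> b \<le> x \<bullet> b" "x \<bullet> b \<le> \<alpha> \<bullet> b + ?P" "\<alpha> \<bullet> b \<le> y \<bullet> b" "y \<bullet> b \<le> \<alpha> \<bullet> b + ?P"
      using x y b by (auto simp: mem_box corner_inner)
    \<comment> \<open>Two points of a closed interval of length \<open>?P\<close> that differ by a
      nonzero multiple of \<open>?P\<close> are its two end points.\<close>
    have "k \<noteq> 0" using k b by auto
    then have "1 \<le> real_of_int k \<or> real_of_int k \<le> - 1" by linarith
    then have "?P * 1 \<le> ?P * k \<or> ?P * k \<le> ?P * - 1"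
      using P mult_le_cancel_left_pos by blast
    then have "\<not> (\<alpha> \<bullet> b < x \<bullet> b \<and> x \<bullet> b < \<alpha> \<bullet> b + ?P)" "\<not> (\<alpha> \<bullet> b < y \<bullet> b \<and> y \<bullet> b < \<alpha> \<bullet> b + ?P)"
      using bnd k by linarith+
    then have "x \<notin> box \<alpha> corner \<and> y \<notin> box \<alpha> corner"
      using b by (auto simp: mem_box corner_inner)
    then show ?thesis using w0 by simp
  qed simp
  define W where "W t = w (SOME x. x \<in> ?C \<and> torus_map x = t)" for t
  have W: "W (torus_map x) = w x" if "x \<in> ?C" for x
  proof -
    let ?y = "SOME y. y \<in> ?C \<and> torus_map y = torus_map x"
    have "?y \<in> ?C \<and> torus_map ?y = torus_map x"
      by (rule someI[of _ x]) (use that in simp)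
    then show ?thesis unfolding W_def using inj that by blast
  qed
  \<comment> \<open>Checked on closed sets: the preimage under \<open>W\<close> of a closed set is
    the image of a compact part of the closed cell.\<close>
  have "continuous_on T W"
    unfolding continuous_on_closed_vimage[OF compact_imp_closed[OF T]]
  proof (intro allI impI)
    fix B :: "complex set" assume "closed B"
    have "W -` B \<inter> T = torus_map ` (?C \<inter> w -` B)"
      unfolding T_def using W by force
    moreover have "closed (w -` B)"
      using \<open>closed B\<close> w by (simp add: closed_vimage)
    then have "compact (?C \<inter> w -` B)"
      by (intro compact_Int_closed) auto
    then have "compact (torus_map ` (?C \<inter> w -` B))"
      by (intro compact_continuous_image cont)
    ultimately show "closed (W -` B \<inter> T)"
      by (simp add: compact_imp_closed)
  qed
  from Stone_Weierstrass_polynomial_function[OF T this e]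
  obtain g where g: "polynomial_function g" "\<And>t. t \<in> T \<Longrightarrow> norm (W t - g t) < e"
    by auto
  have "trig_poly (\<lambda>x. complex_of_real ((Re \<circ> g) (torus_map x)) + \<i> * complex_of_real ((Im \<circ> g) (torus_map x)))"
    using g(1) unfolding polynomial_function_def
    by (intro trig_poly_add trig_poly_mult trig_poly_const trig_poly_real_polynomial)
       (blast intro: bounded_linear_Re bounded_linear_Im)+
  then have "trig_poly (\<lambda>x. g (torus_map x))"
    by (simp flip: complex_eq)
  moreover have "norm (w x - g (torus_map x)) < e" if "x \<in> ?C" for x
    using g(2)[of "torus_map x"] W[OF that] that by (auto simp: T_def)
  ultimately show ?thesis by blast
qed

lemma sq_intD: "sq_int v \<Longrightarrow> v \<in> borel_measurable borel" "sq_int v \<Longrightarrow> integrable (avg \<alpha> N) (\<lambda>x. (norm (v x))\<^sup>2)"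
  by (auto simp: sq_int_def)

lemma sq_int_continuous: "continuous_on UNIV v \<Longrightarrow> sq_int v"
  unfolding sq_int_def by (auto intro!: integrable_continuous borel_measurable_continuous_onI continuous_intros)

lemma sq_int_diff:
  assumes v: "sq_int v" and w: "sq_int w"
  shows "sq_int (\<lambda>x. v x - w x)"
  unfolding sq_int_def
proof
  have [measurable]: "v \<in> borel_measurable borel" "w \<in> borel_measurable borel"
    using v w by (auto dest: sq_intD)
  show "(\<lambda>x. v x - w x) \<in> borel_measurable borel" by measurable
  have "integrable (avg \<alpha> N) (\<lambda>x. 2 * (norm (v x))\<^sup>2 + 2 * (norm (w x))\<^sup>2)"
    by (intro Bochner_Integration.integrable_add integrable_mult_right sq_intD(2) v w)
  then show "integrable (avg \<alpha> N) (\<lambda>x. (norm (v x - w x))\<^sup>2)"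
    by (rule Bochner_Integration.integrable_bound) (auto intro!: AE_I2 norm_diff_sq_le)
qed

lemma integral_norm_diff_sq_le:
  assumes v: "sq_int u" and w: "sq_int v" "sq_int w"
  shows "mean_sq (\<lambda>x. u x - w x)
    \<le> 2 * mean_sq (\<lambda>x. u x - v x) + 2 * mean_sq (\<lambda>x. v x - w x)"
proof -
  have int: "integrable (avg \<alpha> N) (\<lambda>x. (norm (u x - w x))\<^sup>2)" "integrable (avg \<alpha> N) (\<lambda>x. (norm (u x - v x))\<^sup>2)"
    "integrable (avg \<alpha> N) (\<lambda>x. (norm (v x - w x))\<^sup>2)"
    using assms by (auto intro: sq_int_diff sq_intD(2))
  have "mean_sq (\<lambda>x. u x - w x)
    \<le> (LINT x|avg \<alpha> N. 2 * (norm (u x - v x))\<^sup>2 + 2 * (norm (v x - w x))\<^sup>2)"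
  proof (rule integral_mono)
    show "(norm (u x - w x))\<^sup>2 \<le> 2 * (norm (u x - v x))\<^sup>2 + 2 * (norm (v x - w x))\<^sup>2" for x
      using norm_diff_sq_le[of "u x - v x" "w x - v x"] by (simp add: norm_minus_commute)
  qed (use int in auto)
  also have "\<dots> = 2 * mean_sq (\<lambda>x. u x - v x) + 2 * mean_sq (\<lambda>x. v x - w x)"
    using int by simp
  finally show ?thesis .
qed

section \<open>Approximation of square integrable functions by trigonometric sums\<close>

definition clamp_norm :: "real \<Rightarrow> complex \<Rightarrow> complex"
  where "clamp_norm M z = (M / max M (norm z)) *\<^sub>R z"

lemma clamp_norm:
  assumes "0 < M"
  shows "norm (clamp_norm M z) \<le> M" "norm z \<le> M \<Longrightarrow> clamp_norm M z = z"
    "norm (z - clamp_norm M z) \<le> norm z" "continuous_on UNIV (clamp_norm M)"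
proof -
  have pos: "0 < max M (norm z)" using assms by simp
  show "norm (clamp_norm M z) \<le> M"
    using assms pos by (simp add: clamp_norm_def divide_le_eq mult_left_mono)
  show "norm z \<le> M \<Longrightarrow> clamp_norm M z = z"
    using assms by (simp add: clamp_norm_def)
  have "0 \<le> M / max M (norm z)" "M / max M (norm z) \<le> 1"
    using assms pos by (auto simp: divide_le_eq)
  moreover have "z - clamp_norm M z = (1 - M / max M (norm z)) *\<^sub>R z"
    by (simp add: clamp_norm_def scaleR_diff_left)
  ultimately show "norm (z - clamp_norm M z) \<le> norm z"
    by (simp add: mult_left_le_one_le)
  have "max M (norm w) \<noteq> 0" for w :: complex
    using assms by (auto simp: max_def)
  then show "continuous_on UNIV (clamp_norm M)"
    unfolding clamp_norm_def by (intro continuous_intros) auto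
qed

lemma AE_avg_in_box:
  assumes "negligible S"
  shows "AE x in avg \<alpha> N. x \<in> box \<alpha> corner \<and> x \<notin> S"
proof -
  have "negligible (S \<union> (cbox \<alpha> corner - box \<alpha> corner))"
    using assms negligible_frontier_interval by (rule negligible_Un)
  then have "AE x in completion lborel. x \<notin> S \<union> (cbox \<alpha> corner - box \<alpha> corner)"
    unfolding negligible_iff_null_sets by (rule AE_not_in)
  then have "AE x in lborel. x \<notin> S \<union> (cbox \<alpha> corner - box \<alpha> corner)"
    by (simp only: AE_completion_iff)
  moreover have imp: "x \<in> box \<alpha> corner \<and> x \<notin> S"
    if "x \<notin> S \<union> (cbox \<alpha> corner - box \<alpha> corner)" "0 < ennreal (indicator (cell \<alpha> N) x / measure lborel (cell \<alpha> N))" for x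
  proof -
    have "x \<in> cell \<alpha> N" using that(2) by (rule contrapos_pp) simp
    then show ?thesis using that(1) cell_subset by blast
  qed
  ultimately have "AE x in lborel. 0 < ennreal (indicator (cell \<alpha> N) x / measure lborel (cell \<alpha> N))
      \<longrightarrow> x \<in> box \<alpha> corner \<and> x \<notin> S"
    by eventually_elim (use imp in blast)
  then show ?thesis
    unfolding avg_def by (subst AE_density) simp_all
qed

text \<open>A measurable function is, off a negligible set, a pointwise limit of continuous ones.
  These have to be modified in two ways: bounded, for dominated convergence, and zero outside the
  open box, since only then do they descend to the torus.\<close>

lemma continuous_approx:
  fixes v :: "'a \<Rightarrow> complex"
  assumes v: "v \<in> borel_measurable borel" and M: "0 < M" "\<And>x. norm (v x) \<le> M" and e: "0 < e"
  shows "\<exists>w. continuous_on UNIV w \<and> (\<forall>x. x \<notin> box \<alpha> corner \<longrightarrow> w x = 0)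
    \<and> mean_sq (\<lambda>x. v x - w x) < e"
proof -
  have "v \<in> borel_measurable (lebesgue_on UNIV)"
    using v by (simp add: lebesgue_on_UNIV_eq measurable_completion)
  then have "v measurable_on UNIV"
    using measurable_on_iff_borel_measurable[of UNIV v] by simp
  then obtain S and g :: "nat \<Rightarrow> 'a \<Rightarrow> complex" where S: "negligible S" and g: "\<And>n. continuous_on UNIV (g n)"
    "\<And>x. x \<notin> S \<Longrightarrow> (\<lambda>n. g n x) \<longlonglongrightarrow> v x"
    unfolding measurable_on_def by auto
  let ?X = "- box \<alpha> corner"
  \<comment> \<open>The scalar factor vanishes off the open box and is eventually 1 at each point
    inside. Clamping at \<open>M\<close> does not disturb the limit, because \<open>v\<close> is
    bounded by \<open>M\<close>.\<close>
  define w where "w n x = (min 1 (real n * infdist x ?X)) *\<^sub>R clamp_norm M (g n x)" for n x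
  have "\<alpha> \<in> ?X"
    using SOME_Basis by (auto simp: mem_box)
  then have X: "closed ?X" "?X \<noteq> {}"
    by (auto simp: closed_Compl)
  have contw: "continuous_on UNIV (w n)" for n
    unfolding w_def
    by (intro continuous_intros continuous_on_compose2[OF clamp_norm(4)[OF M(1)]] g(1)) auto
  have w0: "w n x = 0" if "x \<notin> box \<alpha> corner" for n x
    using that by (simp add: w_def)
  have lim: "(\<lambda>n. w n x) \<longlonglongrightarrow> v x" if x: "x \<in> box \<alpha> corner" "x \<notin> S" for x
  proof -
    have "(\<lambda>n. clamp_norm M (g n x)) \<longlonglongrightarrow> clamp_norm M (v x)"
      using clamp_norm(4)[OF M(1)] g(2)[OF x(2)]
      by (intro isCont_tendsto_compose[where g = "clamp_norm M"]) (auto simp: continuous_on_eq_continuous_at)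
    then have 1: "(\<lambda>n. clamp_norm M (g n x)) \<longlonglongrightarrow> v x"
      using clamp_norm(2)[OF M(1) M(2)] by simp
    have "0 < infdist x ?X"
      using X x by (intro infdist_pos_not_in_closed) auto
    then obtain n0 where n0: "1 < real n0 * infdist x ?X"
      using reals_Archimedean3 by blast
    have "\<forall>\<^sub>F n in sequentially. min 1 (real n * infdist x ?X) = 1"
      unfolding eventually_sequentially
    proof (intro exI[of _ n0] allI impI)
      fix n assume "n0 \<le> n"
      then have "real n0 * infdist x ?X \<le> real n * infdist x ?X"
        by (intro mult_right_mono infdist_nonneg) auto
      then show "min 1 (real n * infdist x ?X) = 1" using n0 by simp
    qed
    then have "(\<lambda>n. min 1 (real n * infdist x ?X)) \<longlonglongrightarrow> 1"
      by (rule tendsto_eventually)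
    from tendsto_scaleR[OF this 1] show ?thesis by (simp add: w_def)
  qed
  have bnd: "norm (w n x) \<le> M" for n x
  proof -
    have "\<bar>min 1 (real n * infdist x ?X)\<bar> * norm (clamp_norm M (g n x)) \<le> 1 * M"
      by (intro mult_mono clamp_norm(1) M) (auto simp: infdist_nonneg abs_of_nonneg)
    then show ?thesis by (simp add: w_def)
  qed
  have "(\<lambda>n. LINT x|avg \<alpha> N. (norm (v x - w n x))\<^sup>2) \<longlonglongrightarrow> (LINT x|avg \<alpha> N. 0)"
  proof (rule integral_dominated_convergence)
    show "AE x in avg \<alpha> N. (\<lambda>n. (norm (v x - w n x))\<^sup>2) \<longlonglongrightarrow> 0"
      using AE_avg_in_box[OF S]
    proof eventually_elim
      case (elim x)
      then have "(\<lambda>n. (norm (v x - w n x))\<^sup>2) \<longlonglongrightarrow> (norm (v x - v x))\<^sup>2"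
        by (intro tendsto_intros lim) auto
      then show ?case by simp
    qed
    show "AE x in avg \<alpha> N. norm ((norm (v x - w n x))\<^sup>2) \<le> (2 * M)\<^sup>2" for n
    proof (rule AE_I2)
      fix x
      have "norm (v x - w n x) \<le> 2 * M"
        using norm_triangle_ineq4[of "v x" "w n x"] M(2)[of x] bnd[of n x] by linarith
      then show "norm ((norm (v x - w n x))\<^sup>2) \<le> (2 * M)\<^sup>2"
        unfolding real_norm_def abs_power2 by (rule power_mono) simp
    qed
    show "(\<lambda>x. (norm (v x - w n x))\<^sup>2) \<in> borel_measurable (avg \<alpha> N)" for n
      using v borel_measurable_continuous_onI[OF contw[of n]] by measurable
    show "integrable (avg \<alpha> N) (\<lambda>x. (2 * M)\<^sup>2)"
      by (intro integrable_continuous continuous_intros)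
  qed auto
  then have "\<forall>\<^sub>F n in sequentially. mean_sq (\<lambda>x. v x - w n x) < e"
    using e by (intro order_tendstoD) auto
  then obtain n where "mean_sq (\<lambda>x. v x - w n x) < e"
    by (auto simp: eventually_sequentially)
  then show ?thesis
    using contw w0 by blast
qed

lemma truncation_approx:
  assumes v: "sq_int v" and e: "0 < e"
  shows "\<exists>M>0. mean_sq (\<lambda>x. v x - clamp_norm M (v x)) < e"
proof -
  have [measurable]: "clamp_norm (real (Suc n)) \<in> borel_measurable borel" for n
    by (rule borel_measurable_continuous_onI[OF clamp_norm(4)]) simp
  have [measurable]: "v \<in> borel_measurable borel" using v by (rule sq_intD)
  have "(\<lambda>n. LINT x|avg \<alpha> N. (norm (v x - clamp_norm (real (Suc n)) (v x)))\<^sup>2) \<longlonglongrightarrow> (LINT x|avg \<alpha> N. 0)"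
  proof (rule integral_dominated_convergence)
    show "AE x in avg \<alpha> N. (\<lambda>n. (norm (v x - clamp_norm (real (Suc n)) (v x)))\<^sup>2) \<longlonglongrightarrow> 0"
    proof (rule AE_I2)
      fix x
      obtain n0 where n0: "norm (v x) \<le> real n0" using real_arch_simple by blast
      have "\<forall>\<^sub>F n in sequentially. (norm (v x - clamp_norm (real (Suc n)) (v x)))\<^sup>2 = 0"
        unfolding eventually_sequentially
        using n0 by (intro exI[of _ n0] allI impI) (simp add: clamp_norm(2))
      then show "(\<lambda>n. (norm (v x - clamp_norm (real (Suc n)) (v x)))\<^sup>2) \<longlonglongrightarrow> 0"
        by (rule tendsto_eventually)
    qed
    show "AE x in avg \<alpha> N. norm ((norm (v x - clamp_norm (real (Suc n)) (v x)))\<^sup>2) \<le> (norm (v x))\<^sup>2" for n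
      using clamp_norm(3)[of "real (Suc n)"] by (intro AE_I2) (simp add: power_mono)
    show "(\<lambda>x. (norm (v x - clamp_norm (real (Suc n)) (v x)))\<^sup>2) \<in> borel_measurable (avg \<alpha> N)" for n
      by measurable
  qed (use v in \<open>auto dest: sq_intD\<close>)
  then have "\<forall>\<^sub>F n in sequentially. mean_sq (\<lambda>x. v x - clamp_norm (real (Suc n)) (v x)) < e"
    using e by (intro order_tendstoD) auto
  then obtain n where "mean_sq (\<lambda>x. v x - clamp_norm (real (Suc n)) (v x)) < e"
    by (auto simp: eventually_sequentially)
  then show ?thesis by (intro exI[of _ "real (Suc n)"]) auto
qed

theorem trig_dense:
  assumes v: "sq_int v" and e: "0 < e"
  shows "\<exists>\<Lambda> a. finite \<Lambda> \<and> \<Lambda> \<subseteq> freq_lattice N \<and> mean_sq (\<lambda>x. v x - trig a \<Lambda> x) < e"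
proof -
  obtain M where M: "0 < M" "mean_sq (\<lambda>x. v x - clamp_norm M (v x)) < e / 16"
    using truncation_approx[OF v, of "e / 16"] e by auto
  define v' where "v' x = clamp_norm M (v x)" for x
  have v'_meas: "v' \<in> borel_measurable borel"
    unfolding v'_def using borel_measurable_continuous_onI[OF clamp_norm(4)[OF M(1)]] sq_intD(1)[OF v]
    by measurable
  obtain w where w: "continuous_on UNIV w" "\<And>x. x \<notin> box \<alpha> corner \<Longrightarrow> w x = 0"
    "mean_sq (\<lambda>x. v' x - w x) < e / 16"
    using continuous_approx[OF v'_meas M(1), of "e / 16"] clamp_norm(1)[OF M(1)] e unfolding v'_def by auto
  define d where "d = sqrt (e / 16)"
  have d: "0 < d" "d\<^sup>2 = e / 16" using e by (auto simp: d_def)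
  obtain P where P: "trig_poly P" "\<And>x. x \<in> cbox \<alpha> corner \<Longrightarrow> norm (w x - P x) < d"
    using uniform_approx[OF w(1,2) d(1)] by blast
  then obtain \<Lambda> a where \<Lambda>: "finite \<Lambda>" "\<Lambda> \<subseteq> freq_lattice N" "P = trig a \<Lambda>"
    unfolding trig_poly_def by blast
  have SI: "sq_int w" "sq_int P"
    using w(1) \<Lambda>(3) by (auto intro!: sq_int_continuous continuous_intros)
  have SIv': "sq_int v'"
    unfolding sq_int_def
  proof
    have "integrable (avg \<alpha> N) (\<lambda>x. M\<^sup>2)" by (intro integrable_continuous continuous_intros)
    then show "integrable (avg \<alpha> N) (\<lambda>x. (norm (v' x))\<^sup>2)"
    proof (rule Bochner_Integration.integrable_bound)
      show "(\<lambda>x. (norm (v' x))\<^sup>2) \<in> borel_measurable (avg \<alpha> N)"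
        using v'_meas by measurable
      show "AE x in avg \<alpha> N. norm ((norm (v' x))\<^sup>2) \<le> norm (M\<^sup>2)"
        using clamp_norm(1)[OF M(1)] by (intro AE_I2) (simp add: v'_def power_mono)
    qed
  qed (rule v'_meas)
  have "mean_sq (\<lambda>x. w x - P x) \<le> (LINT x|avg \<alpha> N. e / 16)"
  proof (rule integral_mono_AE)
    show "AE x in avg \<alpha> N. (norm (w x - P x))\<^sup>2 \<le> e / 16"
      using AE_avg_in_box[OF negligible_empty]
    proof eventually_elim
      case (elim x)
      then have "norm (w x - P x) \<le> d"
        using P(2)[of x] box_subset_cbox by (auto intro: less_imp_le)
      then show ?case using d(2) by (metis norm_ge_zero power_mono)
    qed
    show "integrable (avg \<alpha> N) (\<lambda>x. (norm (w x - P x))\<^sup>2)"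
      by (intro sq_intD(2) sq_int_diff SI)
    show "integrable (avg \<alpha> N) (\<lambda>x. e / 16)"
      by (intro integrable_continuous continuous_intros)
  qed
  then have "mean_sq (\<lambda>x. w x - P x) \<le> e / 16"
    unfolding integral_const .
  moreover have "mean_sq (\<lambda>x. v x - P x)
    \<le> 2 * mean_sq (\<lambda>x. v x - v' x) + 2 * mean_sq (\<lambda>x. v' x - P x)"
    by (rule integral_norm_diff_sq_le[OF v SIv' SI(2)])
  moreover have "mean_sq (\<lambda>x. v' x - P x)
    \<le> 2 * mean_sq (\<lambda>x. v' x - w x) + 2 * mean_sq (\<lambda>x. w x - P x)"
    by (rule integral_norm_diff_sq_le[OF SIv' SI])
  \<comment> \<open>Each use of the quadratic triangle inequality doubles its terms, which gives (2
    + 4 + 4)/16 of \<open>e\<close> in total.\<close>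
  ultimately have "mean_sq (\<lambda>x. v x - P x) < e"
    using M(2) w(3) e unfolding v'_def by linarith
  then show ?thesis using \<Lambda> by blast
qed

section \<open>Fourier coefficients and the part of a function outside finitely many
  frequencies\<close>

definition coef :: "('a \<Rightarrow> complex) \<Rightarrow> 'a \<Rightarrow> complex"
  where "coef v \<xi> = (LINT x|avg \<alpha> N. v x * cis (- (\<xi> \<bullet> x)))"

lemma integrable_mult_cis:
  assumes v: "sq_int v"
  shows "integrable (avg \<alpha> N) (\<lambda>x. v x * cis (\<xi> \<bullet> x))"
proof -
  have [measurable]: "v \<in> borel_measurable borel" using v by (rule sq_intD)
  have "integrable (avg \<alpha> N) (\<lambda>x. 1 + (norm (v x))\<^sup>2)"
    using v by (intro Bochner_Integration.integrable_add integrable_continuous continuous_intros sq_intD)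
  moreover have [measurable]: "(\<lambda>x. cis (\<xi> \<bullet> x)) \<in> borel_measurable borel"
    by (intro borel_measurable_continuous_onI continuous_intros)
  have "(\<lambda>x. v x * cis (\<xi> \<bullet> x)) \<in> borel_measurable (avg \<alpha> N)"
    by measurable
  moreover have "norm (v x) \<le> 1 + (norm (v x))\<^sup>2" for x
    using zero_le_power2[of "norm (v x) - 1"] unfolding power2_diff
    by (simp add: algebra_simps) (smt (verit) norm_ge_zero)
  ultimately show ?thesis
    by (elim Bochner_Integration.integrable_bound) (auto simp: norm_mult intro!: AE_I2)
qed

text \<open>Completing the square in each coefficient. The last sum is the only place where
  \<open>a\<close> enters, so the Fourier coefficients are the best choice.\<close>

lemma integral_norm_sq_diff_trig:
  assumes v: "sq_int v" and \<Lambda>: "finite \<Lambda>" "\<Lambda> \<subseteq> freq_lattice N"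
  shows "mean_sq (\<lambda>x. v x - trig a \<Lambda> x)
    = mean_sq v - (\<Sum>\<xi>\<in>\<Lambda>. (norm (coef v \<xi>))\<^sup>2) + (\<Sum>\<xi>\<in>\<Lambda>. (norm (a \<xi> - coef v \<xi>))\<^sup>2)"
proof -
  have nd: "(norm (z - w))\<^sup>2 = (norm z)\<^sup>2 - 2 * Re (z * cnj w) + (norm w)\<^sup>2" for z w :: complex
    by (simp add: cmod_power2 power2_diff algebra_simps)
  have ct: "v x * cnj (trig a \<Lambda> x) = (\<Sum>\<xi>\<in>\<Lambda>. cnj (a \<xi>) * (v x * cis (- \<xi> \<bullet> x)))" for x
    unfolding trig_def cnj_sum sum_distrib_left by (intro sum.cong refl) (simp add: cis_cnj mult_ac)
  have ict: "integrable (avg \<alpha> N) (\<lambda>x. v x * cnj (trig a \<Lambda> x))"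
    unfolding ct by (intro Bochner_Integration.integrable_sum integrable_mult_right integrable_mult_cis v)
  have "(LINT x|avg \<alpha> N. v x * cnj (trig a \<Lambda> x)) = (\<Sum>\<xi>\<in>\<Lambda>. cnj (a \<xi>) * (LINT x|avg \<alpha> N. v x * cis (- \<xi> \<bullet> x)))"
    unfolding ct
    by (subst Bochner_Integration.integral_sum, rule integrable_mult_right, rule integrable_mult_cis[OF v], simp)
  then have I: "(LINT x|avg \<alpha> N. v x * cnj (trig a \<Lambda> x)) = (\<Sum>\<xi>\<in>\<Lambda>. coef v \<xi> * cnj (a \<xi>))"
    by (simp add: coef_def mult.commute)
  have it: "integrable (avg \<alpha> N) (\<lambda>x. (norm (trig a \<Lambda> x))\<^sup>2)"
    by (intro integrable_continuous continuous_intros)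
  have lin: "(LINT x|avg \<alpha> N. A x - 2 * R x + B x)
      = integral\<^sup>L (avg \<alpha> N) A - 2 * integral\<^sup>L (avg \<alpha> N) R + integral\<^sup>L (avg \<alpha> N) B"
    if "integrable (avg \<alpha> N) A" "integrable (avg \<alpha> N) R" "integrable (avg \<alpha> N) B" for A R B :: "'a \<Rightarrow> real"
    using that by simp
  have "mean_sq (\<lambda>x. v x - trig a \<Lambda> x)
    = (LINT x|avg \<alpha> N. (norm (v x))\<^sup>2 - 2 * Re (v x * cnj (trig a \<Lambda> x)) + (norm (trig a \<Lambda> x))\<^sup>2)"
    unfolding nd ..
  also have "\<dots> = mean_sq v - 2 * Re (LINT x|avg \<alpha> N. v x * cnj (trig a \<Lambda> x))
      + mean_sq (trig a \<Lambda>)"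
    unfolding integral_Re[OF ict, symmetric] by (rule lin[OF sq_intD(2)[OF v] integrable_Re[OF ict] it])
  also have "\<dots> = mean_sq v + (\<Sum>\<xi>\<in>\<Lambda>. (norm (a \<xi>))\<^sup>2 - 2 * Re (coef v \<xi> * cnj (a \<xi>)))"
    unfolding I integral_norm_sq_trig[OF \<Lambda>] by (simp add: sum_subtractf sum_distrib_left)
  also have "(\<Sum>\<xi>\<in>\<Lambda>. (norm (a \<xi>))\<^sup>2 - 2 * Re (coef v \<xi> * cnj (a \<xi>)))
      = (\<Sum>\<xi>\<in>\<Lambda>. (norm (a \<xi> - coef v \<xi>))\<^sup>2 - (norm (coef v \<xi>))\<^sup>2)"
    unfolding nd by (intro sum.cong refl) (simp add: mult.commute)
  finally show ?thesis by (simp add: sum_subtractf)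
qed

lemma bessel:
  assumes v: "sq_int v" and \<Lambda>: "finite \<Lambda>" "\<Lambda> \<subseteq> freq_lattice N"
  shows "(\<Sum>\<xi>\<in>\<Lambda>. (norm (coef v \<xi>))\<^sup>2) \<le> mean_sq v"
proof -
  have "0 \<le> mean_sq (\<lambda>x. v x - trig (coef v) \<Lambda> x)"
    by (intro integral_nonneg_AE) auto
  then show ?thesis
    unfolding integral_norm_sq_diff_trig[OF assms] by simp
qed

text \<open>Parseval without infinite sums: by density, finitely many frequencies carry all but
  \<open>e\<close> of \<open>v\<close>. Those of them outside \<Lambda> are compared with
  \<open>g\<close> coefficient by coefficient, and Bessel bounds the result by the mean square of
  \<open>g\<close>.\<close>

theorem spectral_remainder:
  assumes v: "sq_int v" and g: "sq_int g" and \<Lambda>: "finite \<Lambda>" "\<Lambda> \<subseteq> freq_lattice N"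
    and le: "\<And>\<xi>. \<xi> \<in> freq_lattice N \<Longrightarrow> \<xi> \<notin> \<Lambda> \<Longrightarrow> norm (coef v \<xi>) \<le> norm (coef g \<xi>)"
  shows "mean_sq (\<lambda>x. v x - trig (coef v) \<Lambda> x) \<le> mean_sq g"
proof (rule field_le_epsilon)
  fix e :: real assume "0 < e"
  then obtain \<Lambda>0 a where \<Lambda>0: "finite \<Lambda>0" "\<Lambda>0 \<subseteq> freq_lattice N"
    and approx: "mean_sq (\<lambda>x. v x - trig a \<Lambda>0 x) < e"
    using trig_dense[OF v] by blast
  let ?n = "\<lambda>\<xi>. (norm (coef v \<xi>))\<^sup>2" and ?V = "mean_sq v"
  let ?D = "\<Lambda>0 - \<Lambda>"
  have "?V - (\<Sum>\<xi>\<in>\<Lambda>0. ?n \<xi>) < e"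
    using approx sum_nonneg[of \<Lambda>0 "\<lambda>\<xi>. (norm (a \<xi> - coef v \<xi>))\<^sup>2"]
    unfolding integral_norm_sq_diff_trig[OF v \<Lambda>0] by simp
  moreover have "(\<Sum>\<xi>\<in>\<Lambda>0. ?n \<xi>) \<le> (\<Sum>\<xi>\<in>\<Lambda> \<union> \<Lambda>0. ?n \<xi>)"
    using \<Lambda> \<Lambda>0 by (intro sum_mono2) auto
  moreover have "(\<Sum>\<xi>\<in>\<Lambda> \<union> \<Lambda>0. ?n \<xi>) = (\<Sum>\<xi>\<in>\<Lambda>. ?n \<xi>) + (\<Sum>\<xi>\<in>?D. ?n \<xi>)"
    using \<Lambda> \<Lambda>0 by (subst sum.union_disjoint[symmetric]) (auto intro: sum.cong)
  moreover have "(\<Sum>\<xi>\<in>?D. ?n \<xi>) \<le> (\<Sum>\<xi>\<in>?D. (norm (coef g \<xi>))\<^sup>2)"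
    using \<Lambda>0 by (intro sum_mono power_mono le) auto
  moreover have "\<dots> \<le> mean_sq g"
    using \<Lambda>0 by (intro bessel[OF g]) auto
  moreover have "mean_sq (\<lambda>x. v x - trig (coef v) \<Lambda> x) = ?V - (\<Sum>\<xi>\<in>\<Lambda>. ?n \<xi>)"
    unfolding integral_norm_sq_diff_trig[OF v \<Lambda>] by simp
  ultimately show "mean_sq (\<lambda>x. v x - trig (coef v) \<Lambda> x) \<le> mean_sq g + e"
    by linarith
qed

end

subsection \<open>A smooth cutoff and test functions\<close>

text \<open>For \<open>k = 0\<close> this is the classical smooth function that is flat at 0. The
  powers of \<open>1 / t\<close> make the family closed under differentiation up to linear
  combinations.\<close>

definition psi :: "nat \<Rightarrow> real \<Rightarrow> real"
  where "psi k t = (if t \<le> 0 then 0 else (1 / t) ^ k * exp (- (1 / t)))"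

lemma psi_nonneg: "0 \<le> psi k t"
  by (simp add: psi_def)

text \<open>With x = 1/t this says that one term x^k / k! of the exponential series is at most its
  sum.\<close>

lemma psi_le_fact: "psi k t \<le> fact k"
proof (cases "t \<le> 0")
  case False
  define x where "x = 1 / t"
  have x: "0 < x" using False by (simp add: x_def)
  have "(\<Sum>n\<in>{k}. x ^ n /\<^sub>R fact n) \<le> (\<Sum>n. x ^ n /\<^sub>R fact n)"
    using x by (intro sum_le_suminf summable_exp_generic) auto
  then have "x ^ k / fact k \<le> exp x"
    by (simp add: exp_def divide_inverse mult.commute)
  then have "x ^ k * exp (- x) \<le> fact k"
    by (simp add: exp_minus field_simps)
  then show ?thesis using False by (simp add: psi_def x_def)
qed (simp add: psi_def)

lemma psi_tendsto_0: "(psi k \<longlongrightarrow> 0) (at_right 0)"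
proof -
  have "((\<lambda>t. (inverse t) ^ k / exp (inverse t)) \<longlongrightarrow> 0) (at_right (0::real))"
    by (rule filterlim_compose[OF tendsto_power_div_exp_0 filterlim_inverse_at_top_right])
  moreover have "\<forall>\<^sub>F t in at_right (0::real). (inverse t) ^ k / exp (inverse t) = psi k t"
    unfolding eventually_at_right_field
    by (intro exI[of _ 1]) (auto simp: psi_def exp_minus divide_inverse)
  ultimately show ?thesis by (rule Lim_transform_eventually)
qed

text \<open>The only delicate point is 0: from the right the difference quotient of
  \<open>psi k\<close> is \<open>psi (Suc k)\<close>, which tends to 0 like every member of the
  family.\<close>

lemma psi_has_derivative:
  "(psi k has_real_derivative (psi (k + 2) t - real k * psi (k + 1) t)) (at t)"
proof -
  consider "t < 0" | "t = 0" | "0 < t" by linarith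
  then show ?thesis
  proof cases
    case 1
    have "((\<lambda>_. 0) has_real_derivative 0) (at t)" by simp
    then have "(psi k has_real_derivative 0) (at t)"
      by (rule has_field_derivative_transform_within_open[where S = "{..<0}"]) (use 1 in \<open>auto simp: psi_def\<close>)
    then show ?thesis using 1 by (simp add: psi_def)
  next
    case 2
    have "((\<lambda>h. psi k h / h) \<longlongrightarrow> 0) (at_left 0)"
      by (rule tendsto_eventually) (auto simp: eventually_at_left_field psi_def intro!: exI[of _ "-1"])
    moreover have "((\<lambda>h. psi k h / h) \<longlongrightarrow> 0) (at_right 0)"
    proof (rule Lim_transform_eventually[OF psi_tendsto_0[of "Suc k"]])
      show "\<forall>\<^sub>F h in at_right 0. psi (Suc k) h = psi k h / h"
        unfolding eventually_at_right_field by (intro exI[of _ 1]) (auto simp: psi_def)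
    qed
    ultimately have "((\<lambda>h. psi k h / h) \<longlongrightarrow> 0) (at 0)"
      by (simp add: filterlim_split_at)
    then show ?thesis using 2 by (simp add: has_field_derivative_iff psi_def)
  next
    case 3
    have "((\<lambda>t. (1 / t) ^ k * exp (- (1 / t))) has_real_derivative
        (psi (k + 2) t - real k * psi (k + 1) t)) (at t)"
    proof (rule DERIV_cong)
      have d: "((\<lambda>t. 1 / t) has_real_derivative - (1 / t)\<^sup>2) (at t)"
        using 3 by (auto intro!: derivative_eq_intros simp: power2_eq_square field_simps)
      have e: "((\<lambda>t. exp (- (1 / t))) has_real_derivative exp (- (1 / t)) * (1 / t)\<^sup>2) (at t)"
        using DERIV_fun_exp[OF DERIV_minus[OF d]] by simp
      show "((\<lambda>t. (1 / t) ^ k * exp (- (1 / t))) has_real_derivative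
          (real k * (- (1 / t)\<^sup>2 * (1 / t) ^ (k - Suc 0)) * exp (- (1 / t)) + exp (- (1 / t)) * (1 / t)\<^sup>2 * (1 / t) ^ k)) (at t)"
        by (rule DERIV_mult[OF DERIV_power[OF d] e])
      define x where "x = 1 / t"
      have "psi j t = x ^ j * exp (- x)" for j using 3 by (simp add: psi_def x_def)
      then show "real k * (- (1 / t)\<^sup>2 * (1 / t) ^ (k - Suc 0)) * exp (- (1 / t)) + exp (- (1 / t)) * (1 / t)\<^sup>2 * (1 / t) ^ k
          = psi (k + 2) t - real k * psi (k + 1) t"
        unfolding x_def[symmetric] by (cases k) (simp_all add: power2_eq_square algebra_simps)
    qed
    then show ?thesis
      by (rule has_field_derivative_transform_within_open[where S = "{0<..}"]) (use 3 in \<open>auto simp: psi_def\<close>)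
  qed
qed

lemma continuous_on_psi [continuous_intros]:
  "continuous_on S f \<Longrightarrow> continuous_on S (\<lambda>x. psi k (f x))"
  by (rule continuous_on_compose2[of UNIV "psi k"])
    (auto intro!: DERIV_continuous_on psi_has_derivative[THEN has_field_derivative_at_within])

text \<open>Through the squared norm this is a polynomial in \<open>p\<close>, so a cutoff built
  from it has no singularity at the origin. It depends on the noncompact directions only.\<close>

definition rad :: "real \<Rightarrow> (real ^ 'n) \<times> (real ^ 'm) \<Rightarrow> real"
  where "rad R p = 1 - (fst p \<bullet> fst p) / R\<^sup>2"

lemma rad_has_derivative: "(rad R has_derivative (\<lambda>h. - 2 * (fst p \<bullet> fst h) / R\<^sup>2)) (at p)"
proof -
  have "((\<lambda>p. 1 - (fst p \<bullet> fst p) * inverse (R\<^sup>2)) has_derivative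
      (\<lambda>h. - 2 * (fst p \<bullet> fst h) * inverse (R\<^sup>2))) (at p)"
    by (auto intro!: derivative_eq_intros simp: inner_commute fun_eq_iff algebra_simps)
  then show ?thesis by (simp add: rad_def[abs_def] divide_inverse)
qed

text \<open>A class of functions that contains all cutoff waves and is closed under directional
  derivatives. Differentiability to all orders, as required of test functions, then follows by one
  induction instead of a computation for each multi-index.\<close>

inductive smooth_alg :: "real \<Rightarrow> ((real ^ 'n) \<times> (real ^ 'm) \<Rightarrow> complex) \<Rightarrow> bool" for R
  where const: "smooth_alg R (\<lambda>p. c)"
  | lin: "smooth_alg R (\<lambda>p. of_real (p \<bullet> v))"
  | psi: "smooth_alg R (\<lambda>p. of_real (psi k (rad R p)))"
  | cis: "smooth_alg R (\<lambda>p. cis (\<xi> \<bullet> p))"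
  | add: "smooth_alg R f \<Longrightarrow> smooth_alg R g \<Longrightarrow> smooth_alg R (\<lambda>p. f p + g p)"
  | mult: "smooth_alg R f \<Longrightarrow> smooth_alg R g \<Longrightarrow> smooth_alg R (\<lambda>p. f p * g p)"

lemma cis_has_derivative:
  "((\<lambda>p. cis (\<xi> \<bullet> p)) has_derivative (\<lambda>h. of_real (\<xi> \<bullet> h) * (\<i> * cis (\<xi> \<bullet> p)))) (at p)"
proof -
  have "((\<lambda>p. \<i> * complex_of_real (\<xi> \<bullet> p)) has_derivative (\<lambda>h. \<i> * of_real (\<xi> \<bullet> h))) (at p)"
    by (auto intro!: derivative_eq_intros)
  moreover have "(exp has_derivative (*) (exp z)) (at z)" for z :: complex
    using DERIV_exp unfolding has_field_derivative_def .
  ultimately have "((\<lambda>p. exp (\<i> * of_real (\<xi> \<bullet> p))) has_derivative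
      (\<lambda>h. exp (\<i> * of_real (\<xi> \<bullet> p)) * (\<i> * of_real (\<xi> \<bullet> h)))) (at p)"
    by (rule has_derivative_compose)
  then show ?thesis by (simp add: cis_conv_exp mult_ac)
qed

lemma psi_rad_has_derivative:
  "((\<lambda>p. psi k (rad R p)) has_derivative
    (\<lambda>h. (psi (k + 2) (rad R p) - real k * psi (k + 1) (rad R p)) * (- 2 * (fst p \<bullet> fst h) / R\<^sup>2))) (at p)"
proof -
  have "(psi k has_derivative (\<lambda>s. (psi (k + 2) t - real k * psi (k + 1) t) * s)) (at t)" for t
    using psi_has_derivative[of k t] unfolding has_field_derivative_def .
  then show ?thesis
    by (rule has_derivative_compose[OF rad_has_derivative])
qed

lemma smooth_alg_derivative:
  fixes f :: "(real ^ 'n) \<times> (real ^ 'm) \<Rightarrow> complex"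
  shows "smooth_alg R f \<Longrightarrow> \<exists>f'. (\<forall>p. (f has_derivative f' p) (at p)) \<and> (\<forall>b. smooth_alg R (\<lambda>p. f' p b))"
proof (induction rule: smooth_alg.induct)
  case (const c)
  show ?case by (rule exI[of _ "\<lambda>p h. 0"]) (auto intro: smooth_alg.const)
next
  case (lin v)
  have "((\<lambda>p. complex_of_real (p \<bullet> v)) has_derivative (\<lambda>h. of_real (h \<bullet> v))) (at p)" for p
    by (auto intro!: derivative_eq_intros)
  then show ?case
    by (intro exI[of _ "\<lambda>p h. of_real (h \<bullet> v)"]) (auto intro: smooth_alg.const)
next
  case (psi k)
  have alg: "smooth_alg R (\<lambda>p :: (real ^ 'n) \<times> (real ^ 'm). (of_real (psi (k + 2) (rad R p)) + of_real (- real k) * of_real (psi (k + 1) (rad R p)))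
      * (of_real (p \<bullet> (fst b, 0)) * of_real (- 2 / R\<^sup>2)))" for b :: "(real ^ 'n) \<times> (real ^ 'm)"
    by (intro smooth_alg.intros)
  have eq: "(of_real (psi (k + 2) (rad R p)) + of_real (- real k) * of_real (psi (k + 1) (rad R p)))
      * (of_real (p \<bullet> (fst b, 0)) * of_real (- 2 / R\<^sup>2))
    = complex_of_real ((psi (k + 2) (rad R p) - real k * psi (k + 1) (rad R p)) * (- 2 * (fst p \<bullet> fst b) / R\<^sup>2))"
    for p b :: "(real ^ 'n) \<times> (real ^ 'm)"
    by (simp add: inner_prod_def algebra_simps)
  have "smooth_alg R (\<lambda>p :: (real ^ 'n) \<times> (real ^ 'm). complex_of_real ((psi (k + 2) (rad R p) - real k * psi (k + 1) (rad R p)) * (- 2 * (fst p \<bullet> fst b) / R\<^sup>2)))"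
    for b :: "(real ^ 'n) \<times> (real ^ 'm)"
    using alg[of b] unfolding eq .
  then show ?case
    by (intro exI[of _ "\<lambda>p h. of_real ((psi (k + 2) (rad R p) - real k * psi (k + 1) (rad R p)) * (- 2 * (fst p \<bullet> fst h) / R\<^sup>2))"]
        conjI allI has_derivative_of_real psi_rad_has_derivative)
next
  case (cis \<xi>)
  have "smooth_alg R (\<lambda>p. of_real (\<xi> \<bullet> b) * (\<i> * cis (\<xi> \<bullet> p)))" for b
    by (intro smooth_alg.intros)
  then show ?case
    using cis_has_derivative by (intro exI conjI allI) auto
next
  case (add f g)
  then obtain f' g' where "\<And>p. (f has_derivative f' p) (at p)" "\<And>b. smooth_alg R (\<lambda>p. f' p b)"
    "\<And>p. (g has_derivative g' p) (at p)" "\<And>b. smooth_alg R (\<lambda>p. g' p b)" by blast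
  then show ?case
    by (intro exI[of _ "\<lambda>p h. f' p h + g' p h"]) (auto intro: smooth_alg.add has_derivative_add)
next
  case (mult f g)
  then obtain f' g' where "\<And>p. (f has_derivative f' p) (at p)" "\<And>b. smooth_alg R (\<lambda>p. f' p b)"
    "\<And>p. (g has_derivative g' p) (at p)" "\<And>b. smooth_alg R (\<lambda>p. g' p b)" by blast
  then show ?case using mult.hyps
    by (intro exI[of _ "\<lambda>p h. f p * g' p h + f' p h * g p"]) (auto intro!: smooth_alg.add smooth_alg.mult has_derivative_mult)
qed

lemma pderiv_cover_eq:
  assumes "\<phi> \<circ> cover = f" "(f has_derivative f') (at p)"
  shows "pderiv b \<phi> (cover p) = f' b"
  using pderiv_cover[of \<phi> p b] assms frechet_derivative_at[OF assms(2)]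
  by (auto simp: differentiable_def)

lemma smooth_alg_pderivs: "smooth_alg R (\<phi> \<circ> cover) \<Longrightarrow> smooth_alg R (pderivs bs \<phi> \<circ> cover)"
proof (induction bs)
  case Nil
  then show ?case by (simp add: pderivs_def)
next
  case (Cons b bs)
  then obtain f' where f': "\<And>p. ((pderivs bs \<phi> \<circ> cover) has_derivative f' p) (at p)" "smooth_alg R (\<lambda>p. f' p b)"
    using smooth_alg_derivative by blast
  have "pderivs (b # bs) \<phi> \<circ> cover = (\<lambda>p. f' p b)"
    using pderiv_cover_eq[OF refl f'(1)] by (simp add: pderivs_def fun_eq_iff)
  then show ?case using f'(2) by simp
qed

lemma smooth_if_smooth_alg: "smooth_alg R (\<phi> \<circ> cover) \<Longrightarrow> smooth \<phi>"
  unfolding smooth_def using smooth_alg_derivative[OF smooth_alg_pderivs]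
  by (meson differentiable_def)

section \<open>The covering map and functions that descend along it\<close>

lemma cover_eq_iff:
  "cover p = cover q \<longleftrightarrow> fst p = fst q \<and> (\<forall>i. \<exists>k::int. snd p $ i - snd q $ i = 2 * pi * of_int k)"
  by (simp add: cover_def vec_eq_iff circle.abs_eq_iff circle_rel_def)

lemma to_circle_surj_Ico: "\<exists>t\<in>{0..<2 * pi}. to_circle t = c"
proof -
  define s where "s = rep_circle c"
  define t where "t = s - 2 * pi * of_int \<lfloor>s / (2 * pi)\<rfloor>"
  define f where "f = real_of_int \<lfloor>s / (2 * pi)\<rfloor>"
  have "f \<le> s / (2 * pi)" "s / (2 * pi) < f + 1"
    unfolding f_def by linarith+
  then have "f * (2 * pi) \<le> s" "s < (f + 1) * (2 * pi)"
    by (simp_all add: pos_le_divide_eq pos_divide_less_eq)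
  then have "t \<in> {0..<2 * pi}"
    unfolding t_def f_def[symmetric] by (auto simp: algebra_simps)
  moreover have "circle_rel t s"
    unfolding circle_rel_def by (intro exI[of _ "- \<lfloor>s / (2 * pi)\<rfloor>"]) (simp add: t_def)
  then have "to_circle t = to_circle s" by (simp add: circle.abs_eq_iff)
  then have "to_circle t = c" by (simp add: s_def Quotient_abs_rep[OF Quotient_circle])
  ultimately show ?thesis by blast
qed

text \<open>The saturation of an open set is the union of its translates by multiples of 2
  pi.\<close>

lemma open_to_circle_image: "open U \<Longrightarrow> open (to_circle ` U)"
proof -
  assume "open U"
  have "to_circle -` (to_circle ` U) = (\<Union>k::int. (+) (2 * pi * of_int k) ` U)"
  proof (intro set_eqI iffI)
    fix t assume "t \<in> to_circle -` (to_circle ` U)"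
    then obtain s where s: "s \<in> U" "to_circle t = to_circle s" by auto
    then obtain k :: int where "t - s = 2 * pi * of_int k"
      by (auto simp: circle.abs_eq_iff circle_rel_def)
    then have "t = 2 * pi * of_int k + s" by simp
    then show "t \<in> (\<Union>k::int. (+) (2 * pi * of_int k) ` U)" using s by blast
  next
    fix t assume "t \<in> (\<Union>k::int. (+) (2 * pi * of_int k) ` U)"
    then obtain k :: int and s where s: "s \<in> U" "t = 2 * pi * of_int k + s" by auto
    then have "to_circle t = to_circle s"
      by (auto simp: circle.abs_eq_iff circle_rel_def)
    then show "t \<in> to_circle -` (to_circle ` U)" using s by auto
  qed
  then show ?thesis
    unfolding open_circle_def using \<open>open U\<close> by (auto intro!: open_UN open_translation)
qed

lemma open_cover_image:
  assumes O: "open (O' :: ((real ^ 'n) \<times> (real ^ 'm)) set)"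
  shows "open (cover ` O')"
proof (subst open_subopen, rule ballI)
  fix z assume "z \<in> cover ` O'"
  then obtain p where p: "p \<in> O'" "z = cover p" by blast
  obtain A B where AB: "open A" "open B" "p \<in> A \<times> B" "A \<times> B \<subseteq> O'"
    using open_prod_elim[OF O p(1)] by blast
  then have "snd p \<in> B" by auto
  then obtain D where D: "\<And>i. open (D i)" "\<And>i. snd p $ i \<in> D i" "\<And>y. (\<forall>i. y $ i \<in> D i) \<Longrightarrow> y \<in> B"
    using \<open>open B\<close> unfolding open_vec_def by metis
  let ?T = "A \<times> {y. \<forall>i. y $ i \<in> to_circle ` D i}"
  have "open {y. \<forall>i. y $ i \<in> to_circle ` D i}"
    unfolding open_vec_def using D(1)
    by (intro ballI exI[of _ "\<lambda>i. to_circle ` D i"]) (auto intro: open_to_circle_image)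
  then have "open ?T" using AB(1) by (rule open_Times[rotated])
  moreover have "z \<in> ?T"
    using p AB(3) D(2) by (auto simp: cover_def)
  moreover have "?T \<subseteq> cover ` O'"
  proof
    fix w assume w: "w \<in> ?T"
    then have "snd w $ i \<in> to_circle ` D i" for i by auto
    then have "\<forall>i. \<exists>t. t \<in> D i \<and> snd w $ i = to_circle t" by blast
    then obtain t where t: "\<And>i. t i \<in> D i" "\<And>i. snd w $ i = to_circle (t i)" by metis
    have "w = cover (fst w, \<chi> i. t i)"
      using t by (simp add: cover_def prod_eq_iff vec_eq_iff)
    moreover have "(fst w, \<chi> i. t i) \<in> O'"
      using w t D(3) AB(4) by auto
    ultimately show "w \<in> cover ` O'" by blast
  qed
  ultimately show "\<exists>T. open T \<and> z \<in> T \<and> T \<subseteq> cover ` O'" by blast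
qed

text \<open>As the covering is open and onto, the preimage of an open set under \<phi> is the image
  of an open set upstairs. Borel measurability of descended functions rests on this.\<close>

lemma continuous_on_descend:
  assumes f: "continuous_on UNIV (\<phi> \<circ> cover)"
  shows "continuous_on UNIV \<phi>"
proof -
  have "open (\<phi> -` B)" if "open B" for B
  proof -
    have "\<phi> -` B = cover ` ((\<phi> \<circ> cover) -` B)"
    proof (intro set_eqI iffI)
      fix z assume "z \<in> \<phi> -` B"
      moreover obtain p where "z = cover p" using surj_cover by (metis surjD)
      ultimately show "z \<in> cover ` ((\<phi> \<circ> cover) -` B)" by auto
    qed auto
    moreover have "open ((\<phi> \<circ> cover) -` B)"
      using f that by (simp add: continuous_on_open_vimage comp_def)
    ultimately show ?thesis by (simp add: open_cover_image)
  qed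
  then show ?thesis by (simp add: continuous_on_open_vimage)
qed

lemma compact_cball_times_torus: "compact (cball (0 :: real ^ 'n) R \<times> (UNIV :: (circle ^ 'm) set))"
proof -
  have "cball (0 :: real ^ 'n) R \<times> (UNIV :: (circle ^ 'm) set) = cover ` (cball 0 R \<times> cbox 0 (\<chi> i. 2 * pi))"
  proof (intro set_eqI iffI)
    fix z :: "(real ^ 'n) \<times> (circle ^ 'm)" assume z: "z \<in> cball 0 R \<times> UNIV"
    have "\<forall>i. \<exists>t\<in>{0..<2 * pi}. to_circle t = snd z $ i" using to_circle_surj_Ico by blast
    then obtain t where t: "\<And>i. t i \<in> {0..<2 * pi}" "\<And>i. to_circle (t i) = snd z $ i" by metis
    have "z = cover (fst z, \<chi> i. t i)"
      using t by (simp add: cover_def prod_eq_iff vec_eq_iff)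
    moreover have "(fst z, \<chi> i. t i) \<in> cball 0 R \<times> cbox 0 (\<chi> i. 2 * pi)"
      using z t by (auto simp: mem_box_cart less_imp_le)
    ultimately show "z \<in> cover ` (cball 0 R \<times> cbox 0 (\<chi> i. 2 * pi))" by blast
  qed (auto simp: cover_def)
  then show ?thesis
    by (auto intro!: compact_continuous_image compact_Times continuous_on_subset[OF continuous_on_cover])
qed

text \<open>The torus directions are compact, so vanishing for large \<open>x\<close> already makes
  the support a closed part of a compact set.\<close>

lemma test_function_descend:
  fixes \<phi> :: "(real ^ 'n) \<times> (circle ^ 'm) \<Rightarrow> complex"
  assumes smooth: "smooth_alg R (\<phi> \<circ> cover)" and supp: "\<And>p. R \<le> norm (fst p) \<Longrightarrow> \<phi> (cover p) = 0"
  shows "test_function \<phi>"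
  unfolding test_function_def
proof
  show "smooth \<phi>" using smooth by (rule smooth_if_smooth_alg)
  let ?K = "cball (0 :: real ^ 'n) R \<times> (UNIV :: (circle ^ 'm) set)"
  have "z \<in> ?K" if "\<phi> z \<noteq> 0" for z
  proof -
    obtain p where p: "z = cover p" using surj_cover by (metis surjD)
    then have "norm (fst p) < R" using supp[of p] that by (meson not_le)
    then show ?thesis by (simp add: p cover_def)
  qed
  then have "closure {z. \<phi> z \<noteq> 0} \<subseteq> ?K"
    by (intro closure_minimal closed_Times) auto
  then have "closure {z. \<phi> z \<noteq> 0} = ?K \<inter> closure {z. \<phi> z \<noteq> 0}" by blast
  then show "compact (closure {z. \<phi> z \<noteq> 0})"
    using compact_Int_closed[OF compact_cball_times_torus closed_closure] by metis
qed

section \<open>The flat measure in terms of Lebesgue measure on the strip\<close>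

definition strip :: "((real ^ 'n) \<times> (real ^ 'm)) set"
  where "strip = UNIV \<times> {y. \<forall>i. 0 \<le> y $ i \<and> y $ i < 2 * pi}"

lemma strip_measurable [measurable]: "strip \<in> sets borel"
proof -
  have "strip = {p. \<forall>i\<in>UNIV. 0 \<le> snd p $ i \<and> snd p $ i < 2 * pi}" by (auto simp: strip_def)
  also have "\<dots> \<in> sets borel"
  proof -
    have [measurable]: "(\<lambda>p. snd p $ i) \<in> borel_measurable (borel :: ((real ^ 'n) \<times> (real ^ 'm)) measure)" for i
      by (intro borel_measurable_continuous_onI continuous_intros)
    show ?thesis by measurable
  qed
  finally show ?thesis .
qed

lemma flat_strip: "flat = distr (restrict_space lborel strip) borel cover"
  by (simp add: flat_def strip_def)

lemma sets_flat [measurable_cong, simp]: "sets flat = sets borel"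
  by (simp add: flat_def)

lemma space_flat [simp]: "space flat = UNIV"
  by (simp add: flat_def)

lemma cover_borel_measurable [measurable]: "cover \<in> borel_measurable borel"
  by (rule borel_measurable_continuous_onI[OF continuous_on_cover])

lemma integral_flat:
  fixes h :: "(real ^ 'n) \<times> (circle ^ 'm) \<Rightarrow> 'b::{banach, second_countable_topology}"
  assumes "h \<in> borel_measurable borel"
  shows "integral\<^sup>L flat h = (LINT p:strip|lborel. h (cover p))"
  unfolding flat_strip using assms
  by (subst integral_distr) (auto simp: set_lebesgue_integral_def integral_restrict_space)

lemma integrable_flat_iff:
  fixes h :: "(real ^ 'n) \<times> (circle ^ 'm) \<Rightarrow> 'b::{banach, second_countable_topology}"
  assumes "h \<in> borel_measurable borel"
  shows "integrable flat h \<longleftrightarrow> set_integrable lborel strip (\<lambda>p. h (cover p))"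
  unfolding flat_strip using assms
  by (subst integrable_distr_eq) (auto simp: set_integrable_def integrable_restrict_space)

subsection \<open>Reduction to a large torus\<close>

text \<open>The cutoff. The factor \<open>exp 1\<close> makes its value 1 at
  \<open>fst p = 0\<close>, where \<open>rad R p = 1\<close> and
  \<open>psi 0 1 = exp (- 1)\<close>.\<close>

definition eta :: "real \<Rightarrow> (real ^ 'n) \<times> (real ^ 'm) \<Rightarrow> real"
  where "eta R p = exp 1 * psi 0 (rad R p)"

definition eta1 :: "real \<Rightarrow> (real ^ 'n) \<times> (real ^ 'm) \<Rightarrow> (real ^ 'n) \<times> (real ^ 'm) \<Rightarrow> real"
  where "eta1 R b p = exp 1 * (psi 2 (rad R p) * (- 2 * (fst p \<bullet> fst b) / R\<^sup>2))"

definition eta2 :: "real \<Rightarrow> (real ^ 'n) \<times> (real ^ 'm) \<Rightarrow> (real ^ 'n) \<times> (real ^ 'm) \<Rightarrow> (real ^ 'n) \<times> (real ^ 'm) \<Rightarrow> real"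
  where "eta2 R b h p = exp 1 * ((psi 4 (rad R p) - 2 * psi 3 (rad R p)) * (- 2 * (fst p \<bullet> fst h) / R\<^sup>2) * (- 2 * (fst p \<bullet> fst b) / R\<^sup>2)
    + psi 2 (rad R p) * (- 2 * (fst h \<bullet> fst b) / R\<^sup>2))"

lemma eta_has_derivative:
  "((\<lambda>p. complex_of_real (eta R p)) has_derivative (\<lambda>h. of_real (eta1 R h p))) (at p)"
  unfolding eta_def eta1_def
  by (rule has_derivative_of_real, rule has_derivative_mult_right)
     (rule has_derivative_eq_rhs[OF psi_rad_has_derivative], simp add: numeral_2_eq_2)

lemma eta1_has_derivative:
  "((\<lambda>p. complex_of_real (eta1 R b p)) has_derivative (\<lambda>h. of_real (eta2 R b h p))) (at p)"
proof -
  have 1: "((\<lambda>p. - 2 * (fst p \<bullet> fst b) / R\<^sup>2) has_derivative (\<lambda>h. - 2 * (fst h \<bullet> fst b) / R\<^sup>2)) (at p)"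
  proof -
    have "((\<lambda>p. - 2 * (fst p \<bullet> fst b) * inverse (R\<^sup>2)) has_derivative (\<lambda>h. - 2 * (fst h \<bullet> fst b) * inverse (R\<^sup>2))) (at p)"
      by (auto intro!: derivative_eq_intros)
    then show ?thesis by (simp add: divide_inverse)
  qed
  have 2: "((\<lambda>p. psi 2 (rad R p)) has_derivative
    (\<lambda>h. (psi 4 (rad R p) - 2 * psi 3 (rad R p)) * (- 2 * (fst p \<bullet> fst h) / R\<^sup>2))) (at p)"
    using psi_rad_has_derivative[of 2 R p] by simp
  show ?thesis
    unfolding eta1_def eta2_def
    by (rule has_derivative_of_real, rule has_derivative_mult_right)
       (rule has_derivative_eq_rhs[OF has_derivative_mult[OF 2 1]], simp add: fun_eq_iff)
qed

lemma continuous_on_eta [continuous_intros]: "continuous_on S (eta R)"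
  and continuous_on_eta1 [continuous_intros]: "continuous_on S (eta1 R b)"
  and continuous_on_eta2 [continuous_intros]: "continuous_on S (eta2 R b h)"
  unfolding eta_def[abs_def] eta1_def[abs_def] eta2_def[abs_def] rad_def divide_inverse
  by (intro continuous_intros)+

lemma psi_rad_eq_0: "0 < R \<Longrightarrow> R \<le> norm (fst p) \<Longrightarrow> psi k (rad R p) = 0"
proof -
  assume R: "0 < R" "R \<le> norm (fst p)"
  then have "R\<^sup>2 \<le> fst p \<bullet> fst p"
    unfolding power2_norm_eq_inner[symmetric] by (intro power_mono) auto
  then have "rad R p \<le> 0" using R by (simp add: rad_def)
  then show ?thesis by (simp add: psi_def)
qed

lemma eta_outside:
  assumes "0 < R" "R \<le> norm (fst p)"
  shows "eta R p = 0" "eta1 R b p = 0" "eta2 R b h p = 0"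
  using psi_rad_eq_0[OF assms] by (simp_all add: eta_def eta1_def eta2_def)

lemma eta_nonneg: "0 \<le> eta R p"
  by (simp add: eta_def psi_nonneg)

lemma eta_le_1: "eta R p \<le> 1"
proof (cases "rad R p \<le> 0")
  case False
  have "rad R p \<le> 1" by (simp add: rad_def)
  then have "1 \<le> 1 / rad R p" using False by simp
  then have "psi 0 (rad R p) \<le> exp (- 1)" using False by (simp add: psi_def)
  then have "eta R p \<le> exp 1 * exp (- 1)" unfolding eta_def by (intro mult_left_mono) auto
  then show ?thesis by (simp add: exp_minus)
qed (simp add: eta_def psi_def)

lemma eta_tendsto_1: "(\<lambda>R. eta (real R) p) \<longlonglongrightarrow> 1"
proof -
  have "(\<lambda>R. 1 - (fst p \<bullet> fst p) * (inverse (real R))\<^sup>2) \<longlonglongrightarrow> 1 - (fst p \<bullet> fst p) * 0\<^sup>2"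
    by (intro tendsto_intros lim_inverse_n)
  then have "(\<lambda>R. rad (real R) p) \<longlonglongrightarrow> 1"
    by (simp add: rad_def divide_inverse power_inverse)
  moreover have "isCont (psi 0) 1"
    using psi_has_derivative[of 0 1] by (rule DERIV_isCont)
  ultimately have "(\<lambda>R. psi 0 (rad (real R) p)) \<longlonglongrightarrow> psi 0 1"
    by (intro isCont_tendsto_compose[where g = "psi 0"])
  then have "(\<lambda>R. exp 1 * psi 0 (rad (real R) p)) \<longlonglongrightarrow> exp 1 * psi 0 1"
    by (intro tendsto_intros)
  then show ?thesis by (simp add: eta_def psi_def exp_minus)
qed

lemma norm_fst_Basis_le: "b \<in> Basis \<Longrightarrow> norm (fst b) \<le> 1"
  by (auto simp: Basis_prod_def)

text \<open>Where the first factor is nonzero, \<open>norm (fst p) < R\<close>; the inner product is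
  then at most \<open>R\<close>, and dividing by \<open>R\<^sup>2\<close> leaves the decay
  1/R.\<close>

lemma psi_rad_inner_le:
  assumes R: "0 < R" and b: "norm (fst b) \<le> 1"
  shows "psi k (rad R p) * \<bar>- 2 * (fst p \<bullet> fst b) / R\<^sup>2\<bar> \<le> 2 * fact k / R"
proof (cases "norm (fst p) < R")
  case True
  have "\<bar>fst p \<bullet> fst b\<bar> \<le> norm (fst p) * norm (fst b)" by (rule Cauchy_Schwarz_ineq2)
  also have "\<dots> \<le> R * 1" using True b R by (intro mult_mono) auto
  finally have "\<bar>- 2 * (fst p \<bullet> fst b) / R\<^sup>2\<bar> \<le> 2 / R"
    using R by (simp add: abs_mult power2_eq_square field_simps)
  then have "psi k (rad R p) * \<bar>- 2 * (fst p \<bullet> fst b) / R\<^sup>2\<bar> \<le> fact k * (2 / R)"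
    using R by (intro mult_mono psi_le_fact psi_nonneg) auto
  then show ?thesis by (simp add: mult.commute)
next
  case False
  then show ?thesis using R by (simp add: psi_rad_eq_0)
qed

text \<open>The constant is that of the second derivatives, so that one bound serves every term of
  the cutoff error.\<close>

lemma eta1_bound:
  assumes R: "1 \<le> R" and b: "b \<in> Basis"
  shows "\<bar>eta1 R b p\<bar> \<le> 148 * exp 1 / R"
proof -
  have "psi 2 (rad R p) * \<bar>- 2 * (fst p \<bullet> fst b) / R\<^sup>2\<bar> \<le> 2 * fact 2 / R"
    using R norm_fst_Basis_le[OF b] by (intro psi_rad_inner_le) auto
  also have "\<dots> \<le> 148 / R"
    using R by (intro divide_right_mono) (auto simp: numeral_2_eq_2)
  finally have "exp 1 * (psi 2 (rad R p) * \<bar>- 2 * (fst p \<bullet> fst b) / R\<^sup>2\<bar>) \<le> exp 1 * (148 / R)"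
    by (intro mult_left_mono) auto
  then show ?thesis
    by (simp add: eta1_def abs_mult psi_nonneg mult.commute)
qed

text \<open>Of the two factors \<open>s\<close> one provides the decay 1/R, the other is merely
  bounded by 2. This uses \<open>1 \<le> R\<close>, as does the estimate of the remaining
  term.\<close>

lemma eta2_bound:
  assumes R: "1 \<le> R" and b: "b \<in> Basis"
  shows "\<bar>eta2 R b b p\<bar> \<le> 148 * exp 1 / R"
proof -
  define s where "s = - 2 * (fst p \<bullet> fst b) / R\<^sup>2"
  have nb: "norm (fst b) \<le> 1" using b by (rule norm_fst_Basis_le)
  have f: "fact 4 = (24 :: real)" "fact 3 = (6 :: real)" "fact 2 = (2 :: real)"
    by (simp_all add: fact_numeral)
  have R': "0 < R" "1 / R \<le> 1" using R by auto
  have b4: "psi 4 (rad R p) * \<bar>s\<bar> \<le> 48 / R" and b3: "psi 3 (rad R p) * \<bar>s\<bar> \<le> 12 / R"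
    using psi_rad_inner_le[OF R'(1) nb, of 4 p] psi_rad_inner_le[OF R'(1) nb, of 3 p] by (simp_all add: f s_def)
  have in0: "psi k (rad R p) * \<bar>s\<bar> * \<bar>s\<bar> \<le> psi k (rad R p) * \<bar>s\<bar> * 2" for k
  proof (cases "norm (fst p) < R")
    case True
    have "\<bar>fst p \<bullet> fst b\<bar> \<le> norm (fst p) * norm (fst b)" by (rule Cauchy_Schwarz_ineq2)
    also have "\<dots> \<le> R * 1" using True nb R by (intro mult_mono) auto
    also have "\<dots> \<le> R * R" using R by (intro mult_left_mono) auto
    finally have "\<bar>s\<bar> \<le> 2"
      using R by (simp add: s_def abs_mult power2_eq_square field_simps)
    then show ?thesis by (intro mult_left_mono) (auto simp: psi_nonneg)
  next
    case False
    then show ?thesis using R by (simp add: psi_rad_eq_0)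
  qed
  have inn: "\<bar>- 2 * (fst b \<bullet> fst b) / R\<^sup>2\<bar> \<le> 2 / R"
  proof -
    have "fst b \<bullet> fst b \<le> 1"
      using nb power_mono[of "norm (fst b)" 1 2] by (simp add: power2_norm_eq_inner)
    also have "1 \<le> R" by (rule R)
    finally have "fst b \<bullet> fst b * R \<le> R * R" using R by (intro mult_right_mono) auto
    then show ?thesis using R by (simp add: power2_eq_square field_simps)
  qed
  have "\<bar>(psi 4 (rad R p) - 2 * psi 3 (rad R p)) * s * s + psi 2 (rad R p) * (- 2 * (fst b \<bullet> fst b) / R\<^sup>2)\<bar>
    \<le> psi 4 (rad R p) * \<bar>s\<bar> * \<bar>s\<bar> + 2 * (psi 3 (rad R p) * \<bar>s\<bar> * \<bar>s\<bar>) + psi 2 (rad R p) * \<bar>- 2 * (fst b \<bullet> fst b) / R\<^sup>2\<bar>"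
  proof -
    have tri: "\<bar>(x - 2 * y) * s * s + z * w\<bar> \<le> x * \<bar>s\<bar> * \<bar>s\<bar> + 2 * (y * \<bar>s\<bar> * \<bar>s\<bar>) + z * \<bar>w\<bar>"
      if "0 \<le> x" "0 \<le> y" "0 \<le> z" for x y z w :: real
    proof -
      have "\<bar>(x - 2 * y) * s * s + z * w\<bar> \<le> \<bar>x * s * s\<bar> + \<bar>2 * y * s * s\<bar> + \<bar>z * w\<bar>"
        by (simp add: left_diff_distrib)
      then show ?thesis using that by (simp add: abs_mult)
    qed
    show ?thesis by (intro tri psi_nonneg)
  qed
  also have "psi 2 (rad R p) * \<bar>- 2 * (fst b \<bullet> fst b) / R\<^sup>2\<bar> \<le> fact 2 * (2 / R)"
    by (intro mult_mono psi_le_fact inn) auto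
  \<comment> \<open>The origin of 148 = 96 + 48 + 4, with 48 = 2 * 4! and 12 = 2 * 3! from the
    bounds on \<open>psi 4\<close> and \<open>psi 3\<close>.\<close>
  also have "psi 4 (rad R p) * \<bar>s\<bar> * \<bar>s\<bar> + 2 * (psi 3 (rad R p) * \<bar>s\<bar> * \<bar>s\<bar>) + fact 2 * (2 / R)
      \<le> 2 * (48 / R) + 2 * (2 * (12 / R)) + 2 * (2 / R)"
    using in0[of 4] in0[of 3] b4 b3 unfolding f by linarith
  also have "\<dots> = 148 / R" by (simp add: field_simps)
  finally have "exp 1 * \<bar>(psi 4 (rad R p) - 2 * psi 3 (rad R p)) * s * s + psi 2 (rad R p) * (- 2 * (fst b \<bullet> fst b) / R\<^sup>2)\<bar> \<le> exp 1 * (148 / R)"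
    by (intro mult_left_mono) auto
  then show ?thesis
    by (simp add: eta2_def s_def abs_mult mult.commute)
qed

definition descend :: "((real ^ 'n) \<times> (real ^ 'm) \<Rightarrow> 'b) \<Rightarrow> (real ^ 'n) \<times> (circle ^ 'm) \<Rightarrow> 'b"
  where "descend f z = f (inv cover z)"

lemma descend_cover:
  assumes "\<And>p q. cover p = cover q \<Longrightarrow> f p = f q"
  shows "descend f \<circ> cover = f"
  unfolding descend_def fun_eq_iff comp_def using assms surj_f_inv_f[OF surj_cover] by metis

lemma cis_cover_cong:
  assumes eq: "cover p = cover q" and \<xi>: "\<And>i. snd \<xi> $ i \<in> \<int>"
  shows "cis (\<xi> \<bullet> p) = cis (\<xi> \<bullet> q)"
proof -
  have "\<forall>i. \<exists>k::int. snd p $ i - snd q $ i = 2 * pi * of_int k" and fst: "fst p = fst q"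
    using eq unfolding cover_eq_iff by blast+
  then obtain k :: "_ \<Rightarrow> int" where k: "\<And>i. snd p $ i - snd q $ i = 2 * pi * of_int (k i)" by metis
  have "\<xi> \<bullet> p - \<xi> \<bullet> q = snd \<xi> \<bullet> (snd p - snd q)"
    by (simp add: inner_prod_def fst inner_diff_right)
  also have "\<dots> = 2 * pi * (\<Sum>i\<in>UNIV. snd \<xi> $ i * of_int (k i))"
    unfolding inner_vec_def by (simp add: k sum_distrib_left mult_ac)
  finally have "\<xi> \<bullet> p = \<xi> \<bullet> q + 2 * pi * (\<Sum>i\<in>UNIV. snd \<xi> $ i * of_int (k i))" by simp
  moreover have "(\<Sum>i\<in>UNIV. snd \<xi> $ i * of_int (k i)) \<in> \<int>"
    using \<xi> by (intro Ints_sum Ints_mult) auto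
  ultimately show ?thesis
    by (simp add: cis_multiple_2pi flip: cis_mult)
qed

abbreviation cut :: "((real ^ 'n) \<times> (circle ^ 'm) \<Rightarrow> complex) \<Rightarrow> ((real ^ 'n) \<times> (real ^ 'm) \<Rightarrow> real) \<Rightarrow> (real ^ 'n) \<times> (real ^ 'm) \<Rightarrow> complex"
  where "cut w \<theta> \<equiv> (\<lambda>p. w (cover p) * complex_of_real (\<theta> p))"

abbreviation wave :: "((real ^ 'n) \<times> (real ^ 'm) \<Rightarrow> real) \<Rightarrow> (real ^ 'n) \<times> (real ^ 'm) \<Rightarrow> (real ^ 'n) \<times> (real ^ 'm) \<Rightarrow> complex"
  where "wave \<theta> \<xi> \<equiv> (\<lambda>p. complex_of_real (\<theta> p) * cis (- \<xi> \<bullet> p))"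

lemma L2D: "L2 u \<Longrightarrow> u \<in> borel_measurable borel" "L2 u \<Longrightarrow> integrable flat (\<lambda>z. (norm (u z))\<^sup>2)"
  by (auto simp: L2_def cong: measurable_cong_sets)

text \<open>The large torus. Basis vectors with vanishing second component are the \<open>x\<close>
  directions and get the period 2 pi R. The corner is placed so that the ball of radius
  \<open>R\<close>, which carries the cutoff, fits into the cell, while in \<open>y\<close> the cell
  is the fundamental domain defining \<open>flat\<close>.\<close>

locale cutoff_cell =
  fixes R :: nat and A :: "(real ^ 'n) \<times> (real ^ 'm)" and N :: "(real ^ 'n) \<times> (real ^ 'm) \<Rightarrow> nat"
  assumes R_pos: "1 \<le> R" and A_def: "A = (\<chi> i. - pi * R, 0)" and N_def: "N = (\<lambda>b. if snd b = 0 then R else 1)"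
begin

sublocale period_cell N A
  by unfold_locales (use R_pos in \<open>auto simp: N_def\<close>)

lemma cell_eq: "cell A N = {p. (\<forall>i. - pi * R \<le> fst p $ i \<and> fst p $ i < pi * R) \<and> (\<forall>i. 0 \<le> snd p $ i \<and> snd p $ i < 2 * pi)}"
proof -
  have "(\<forall>b\<in>Basis. A \<bullet> b \<le> p \<bullet> b \<and> p \<bullet> b < A \<bullet> b + 2 * pi * real (N b)) \<longleftrightarrow>
     (\<forall>i. - pi * R \<le> fst p $ i \<and> fst p $ i < pi * R) \<and> (\<forall>i. 0 \<le> snd p $ i \<and> snd p $ i < 2 * pi)" for p
    by (auto simp: Basis_prod_def Basis_vec_def A_def N_def inner_prod_def inner_axis ball_Un algebra_simps)
  then show ?thesis by (simp add: cell_def)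
qed

lemma cell_subset_strip: "cell A N \<subseteq> strip"
  by (auto simp: cell_eq strip_def)

lemma in_cell: "p \<in> strip \<Longrightarrow> norm (fst p) < R \<Longrightarrow> p \<in> cell A N"
proof -
  assume p: "p \<in> strip" "norm (fst p) < R"
  have abs: "\<bar>fst p $ i\<bar> < pi * R" for i
  proof -
    have "\<bar>fst p $ i\<bar> \<le> norm (fst p)" by (rule component_le_norm_cart)
    also have "\<dots> < 1 * real R" using p by simp
    also have "\<dots> \<le> pi * R" using pi_gt3 by (intro mult_right_mono) auto
    finally show ?thesis .
  qed
  have "- pi * R < fst p $ i \<and> fst p $ i < pi * R" for i
    using abs[of i] by linarith
  then show ?thesis using p(1) by (auto simp: cell_eq strip_def intro: less_imp_le)
qed

lemma freq_snd: "\<xi> \<in> freq_lattice N \<Longrightarrow> snd \<xi> $ i \<in> \<int>"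
proof -
  assume "\<xi> \<in> freq_lattice N"
  moreover have "(0, axis i 1) \<in> (Basis :: ((real ^ 'n) \<times> (real ^ 'm)) set)"
    by (auto simp: Basis_prod_def Basis_vec_def)
  ultimately have "real (N (0, axis i 1)) * (\<xi> \<bullet> (0, axis i 1)) \<in> \<int>"
    unfolding freq_lattice_def by blast
  moreover have "axis i (1::real) \<noteq> 0" by (simp add: axis_eq_0_iff)
  ultimately show ?thesis by (simp add: N_def inner_prod_def inner_axis)
qed

abbreviation "V \<equiv> measure lborel (cell A N)"

lemma integral_flat_cell:
  fixes h :: "(real ^ 'n) \<times> (circle ^ 'm) \<Rightarrow> 'b::{banach, second_countable_topology}"
  assumes h: "h \<in> borel_measurable borel" and 0: "\<And>p. R \<le> norm (fst p) \<Longrightarrow> h (cover p) = 0"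
  shows "integral\<^sup>L flat h = V *\<^sub>R (LINT p|avg A N. h (cover p))"
proof -
  have [measurable]: "h \<in> borel_measurable borel" by (rule h)
  have "integral\<^sup>L flat h = (LINT p:strip|lborel. h (cover p))"
    by (rule integral_flat[OF h])
  also have "\<dots> = (LINT p:cell A N|lborel. h (cover p))"
    unfolding set_lebesgue_integral_def
  proof (intro Bochner_Integration.integral_cong refl)
    fix p :: "(real ^ 'n) \<times> (real ^ 'm)"
    show "indicat_real strip p *\<^sub>R h (cover p) = indicat_real (cell A N) p *\<^sub>R h (cover p)"
      using 0[of p] in_cell[of p] cell_subset_strip by (cases "R \<le> norm (fst p)") (auto simp: indicator_def)
  qed
  also have "\<dots> = V *\<^sub>R (LINT p|avg A N. h (cover p))"
    by (rule integral_avg_set) measurable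
  finally show ?thesis .
qed

text \<open>A one-sided comparison is all that is possible for \<open>k\<close> that does not
  descend along \<open>cover\<close>, such as an energy weighted with the tent.\<close>

lemma cell_le_flat:
  assumes k: "k \<in> borel_measurable borel" "integrable (avg A N) k" and h: "h \<in> borel_measurable borel" "integrable flat h"
    and le: "\<And>p. k p \<le> h (cover p)" and h0: "\<And>z. 0 \<le> (h z :: real)"
  shows "V * integral\<^sup>L (avg A N) k \<le> integral\<^sup>L flat h"
proof -
  have "V * integral\<^sup>L (avg A N) k = (LINT p:cell A N|lborel. k p)"
    using integral_avg_set[OF k(1)] by simp
  also have "\<dots> \<le> (LINT p:strip|lborel. h (cover p))"
    unfolding set_lebesgue_integral_def
  proof (rule integral_mono)
    show "integrable lborel (\<lambda>p. indicat_real (cell A N) p *\<^sub>R k p)"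
      using k(2) unfolding integrable_avg_iff[OF k(1)] set_integrable_def .
    show "integrable lborel (\<lambda>p. indicat_real strip p *\<^sub>R h (cover p))"
      using h(2) unfolding integrable_flat_iff[OF h(1)] set_integrable_def .
    show "indicat_real (cell A N) p *\<^sub>R k p \<le> indicat_real strip p *\<^sub>R h (cover p)" for p
      using le[of p] h0[of "cover p"] cell_subset_strip by (auto simp: indicator_def)
  qed
  also have "\<dots> = integral\<^sup>L flat h"
    by (rule integral_flat[OF h(1), symmetric])
  finally show ?thesis .
qed

lemma sq_int_cutoff:
  assumes w: "L2 w" and \<theta>: "continuous_on UNIV \<theta>" "\<And>p. \<bar>\<theta> p\<bar> \<le> B"
  shows "sq_int (\<lambda>p. w (cover p) * complex_of_real (\<theta> p))"
  unfolding sq_int_def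
proof
  have [measurable]: "w \<in> borel_measurable borel" "\<theta> \<in> borel_measurable borel"
    using w \<theta>(1) by (auto intro: L2D borel_measurable_continuous_onI)
  show "(\<lambda>p. w (cover p) * complex_of_real (\<theta> p)) \<in> borel_measurable borel" by measurable
  have "set_integrable lborel strip (\<lambda>p. (norm (w (cover p)))\<^sup>2)"
    using L2D(2)[OF w] by (subst (asm) integrable_flat_iff) auto
  then have "set_integrable lborel (cell A N) (\<lambda>p. (norm (w (cover p)))\<^sup>2)"
    by (rule set_integrable_subset) (use cell_subset_strip in auto)
  then have "integrable (avg A N) (\<lambda>p. (norm (w (cover p)))\<^sup>2)"
    by (subst integrable_avg_iff) auto
  then have "integrable (avg A N) (\<lambda>p. B\<^sup>2 * (norm (w (cover p)))\<^sup>2)"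
    by (rule integrable_mult_right)
  then show "integrable (avg A N) (\<lambda>p. (norm (w (cover p) * complex_of_real (\<theta> p)))\<^sup>2)"
  proof (rule Bochner_Integration.integrable_bound)
    show "AE p in avg A N. norm ((norm (w (cover p) * complex_of_real (\<theta> p)))\<^sup>2) \<le> norm (B\<^sup>2 * (norm (w (cover p)))\<^sup>2)"
    proof (rule AE_I2)
      fix p
      have "\<bar>\<theta> p\<bar>\<^sup>2 \<le> B\<^sup>2" using \<theta>(2) by (intro power_mono) auto
      then have "(norm (w (cover p)))\<^sup>2 * \<bar>\<theta> p\<bar>\<^sup>2 \<le> (norm (w (cover p)))\<^sup>2 * B\<^sup>2" by (rule mult_left_mono) simp
      then show "norm ((norm (w (cover p) * complex_of_real (\<theta> p)))\<^sup>2) \<le> norm (B\<^sup>2 * (norm (w (cover p)))\<^sup>2)"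
        by (simp add: norm_mult power_mult_distrib mult.commute)
    qed
  qed measurable
qed

text \<open>Pairing with a cutoff wave on the original space is the same as taking a Fourier
  coefficient on the large torus. In this way weak derivatives become relations between
  coefficients.\<close>

lemma flat_coef:
  assumes w: "w \<in> borel_measurable borel" and \<phi>: "\<phi> \<in> borel_measurable borel"
    and eq: "\<And>p. \<phi> (cover p) = \<theta> p * cis (- (\<xi> \<bullet> p))" and 0: "\<And>p. R \<le> norm (fst p) \<Longrightarrow> \<theta> p = 0"
  shows "(LINT z|flat. w z * \<phi> z) = V *\<^sub>R coef (\<lambda>p. w (cover p) * \<theta> p) \<xi>"
proof -
  have [measurable]: "w \<in> borel_measurable borel" "\<phi> \<in> borel_measurable borel" by (rule w, rule \<phi>)
  have "(LINT z|flat. w z * \<phi> z) = V *\<^sub>R (LINT p|avg A N. w (cover p) * \<phi> (cover p))"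
    by (rule integral_flat_cell) (auto simp: eq 0)
  then show ?thesis by (simp add: coef_def eq mult.assoc)
qed

lemma coef_add: "sq_int v \<Longrightarrow> sq_int w \<Longrightarrow> coef (\<lambda>p. v p + w p) \<xi> = coef v \<xi> + coef w \<xi>"
  using integrable_mult_cis[of v "- \<xi>"] integrable_mult_cis[of w "- \<xi>"]
  by (simp add: coef_def distrib_right)

lemma coef_cmult: "coef (\<lambda>p. c * v p) \<xi> = c * coef v \<xi>"
  by (simp add: coef_def mult.assoc)

end

lemma pderivs_borel_measurable:
  fixes \<phi> :: "(real ^ 'n) \<times> (circle ^ 'm) \<Rightarrow> complex"
  assumes "test_function \<phi>" "set bs \<subseteq> Basis"
  shows "pderivs bs \<phi> \<in> borel_measurable borel"
proof -
  have "(pderivs bs \<phi> \<circ> cover) differentiable (at p)" for p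
    using assms unfolding test_function_def smooth_def by blast
  then have "continuous_on UNIV (pderivs bs \<phi> \<circ> cover)"
    by (intro continuous_at_imp_continuous_on ballI differentiable_imp_continuous_within)
  then show ?thesis
    by (intro borel_measurable_continuous_onI continuous_on_descend)
qed

context period_cell
begin

lemma sq_int_cmult: "sq_int v \<Longrightarrow> sq_int (\<lambda>x. c * v x)"
  by (auto simp: sq_int_def norm_mult power_mult_distrib)

lemma sq_int_zero: "sq_int (\<lambda>_. 0)"
  by (simp add: sq_int_def)

lemma sq_int_add: "sq_int v \<Longrightarrow> sq_int w \<Longrightarrow> sq_int (\<lambda>x. v x + w x)"
  using sq_int_diff[of v "\<lambda>x. - 1 * w x"] sq_int_cmult[of w "- 1"] by simp

lemma sq_int_sum: "(\<And>i. i \<in> I \<Longrightarrow> sq_int (v i)) \<Longrightarrow> sq_int (\<lambda>x. \<Sum>i\<in>I. v i x)"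
proof (induction I rule: infinite_finite_induct)
  case (insert i I)
  then have "sq_int (\<lambda>x. v i x + (\<Sum>i\<in>I. v i x))" by (intro sq_int_add) auto
  then show ?case using insert.hyps by simp
qed (simp_all add: sq_int_zero)

lemma coef_sum: "(\<And>i. i \<in> I \<Longrightarrow> sq_int (v i)) \<Longrightarrow> coef (\<lambda>x. \<Sum>i\<in>I. v i x) \<xi> = (\<Sum>i\<in>I. coef (v i) \<xi>)"
  using integrable_mult_cis[of _ "- \<xi>"]
  by (simp add: coef_def sum_distrib_right Bochner_Integration.integral_sum)

end

context cutoff_cell
begin

lemma real_R: "1 \<le> real R" "0 < real R"
  using R_pos by simp_all

lemma sq_int_eta:
  assumes "L2 w"
  shows "sq_int (cut w (eta R))"
    and "b \<in> Basis \<Longrightarrow> sq_int (cut w (eta1 R b))"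
    and "b \<in> Basis \<Longrightarrow> sq_int (cut w (eta2 R b b))"
proof -
  show "sq_int (cut w (eta R))"
    by (rule sq_int_cutoff[OF assms, where B = 1])
      (auto intro: continuous_intros simp: eta_nonneg eta_le_1)
  show "b \<in> Basis \<Longrightarrow> sq_int (cut w (eta1 R b))"
    by (rule sq_int_cutoff[OF assms continuous_on_eta1 eta1_bound[OF real_R(1)]])
  show "b \<in> Basis \<Longrightarrow> sq_int (cut w (eta2 R b b))"
    by (rule sq_int_cutoff[OF assms continuous_on_eta2 eta2_bound[OF real_R(1)]])
qed

text \<open>A wave descends because its frequency is integral in the \<open>y\<close> coordinates,
  the only ones in which points are identified; in \<open>x\<close> the cutoff gives compact
  support. The wave cut off by a derivative of \<eta> is itself needed as a test function
  below.\<close>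

lemma test_functions:
  assumes \<xi>: "\<xi> \<in> freq_lattice N"
  shows "descend (wave (eta R) \<xi>) \<circ> cover = wave (eta R) \<xi>"
    and "descend (wave (eta1 R b) \<xi>) \<circ> cover = wave (eta1 R b) \<xi>"
    and "test_function (descend (wave (eta R) \<xi>))"
    and "test_function (descend (wave (eta1 R b) \<xi>))"
proof -
  have cis_eq: "cis (- \<xi> \<bullet> p) = cis (- \<xi> \<bullet> q)" and fst_eq: "fst p = fst q" if "cover p = cover q" for p q
    using cis_cover_cong[OF that, of "- \<xi>"] freq_snd[OF \<xi>] that by (auto simp: cover_eq_iff)
  show 1: "descend (wave (eta R) \<xi>) \<circ> cover = wave (eta R) \<xi>"
    by (rule descend_cover) (metis cis_eq fst_eq eta_def rad_def)
  show 2: "descend (wave (eta1 R b) \<xi>) \<circ> cover = wave (eta1 R b) \<xi>"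
    by (rule descend_cover) (metis cis_eq fst_eq eta1_def rad_def)
  have "smooth_alg R (\<lambda>p. complex_of_real (exp 1) * complex_of_real (psi 0 (rad R p)) * cis (- \<xi> \<bullet> p))"
    by (intro smooth_alg.intros)
  moreover have "smooth_alg R (\<lambda>p. complex_of_real (exp 1) * (complex_of_real (psi 2 (rad R p)) *
      (of_real (- 2 / (real R)\<^sup>2) * of_real (p \<bullet> (fst b, 0)))) * cis (- \<xi> \<bullet> p))"
    by (intro smooth_alg.intros)
  ultimately have alg: "smooth_alg R (wave (eta R) \<xi>)"
    "smooth_alg R (wave (eta1 R b) \<xi>)"
    by (simp_all add: eta_def eta1_def inner_prod_def)
  show "test_function (descend (wave (eta R) \<xi>))"
  proof (rule test_function_descend[of R])
    show "smooth_alg R (descend (wave (eta R) \<xi>) \<circ> cover)"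
      unfolding 1 by (rule alg)
    show "descend (wave (eta R) \<xi>) (cover p) = 0" if "R \<le> norm (fst p)" for p
      using fun_cong[OF 1, of p] eta_outside[OF real_R(2) that] by simp
  qed
  show "test_function (descend (wave (eta1 R b) \<xi>))"
  proof (rule test_function_descend[of R])
    show "smooth_alg R (descend (wave (eta1 R b) \<xi>) \<circ> cover)"
      unfolding 2 by (rule alg)
    show "descend (wave (eta1 R b) \<xi>) (cover p) = 0" if "R \<le> norm (fst p)" for p
      using fun_cong[OF 2, of p] eta_outside[OF real_R(2) that] by simp
  qed
qed

text \<open>Expanding the second derivative of \<open>\<eta> e\<^bsup>-i\<xi>x\<^esup>\<close> leaves a term \<open>\<partial>\<eta> \<partial>e\<^bsup>-i\<xi>x\<^esup>\<close> of size \<open>|\<xi>|\<close>. Testing the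
  first weak derivative against \<open>\<partial>\<eta> e\<^bsup>-i\<xi>x\<^esup>\<close> trades it for a term without \<open>\<xi>\<close>.\<close>

lemma coef_second_derivative:
  fixes u u1 u2 :: "(real ^ 'n) \<times> (circle ^ 'm) \<Rightarrow> complex"
  assumes \<xi>: "\<xi> \<in> freq_lattice N" and b: "b \<in> Basis" and L2: "L2 u" "L2 u1" "L2 u2"
    and weak: "has_weak_pderivs u u1 [b]" "has_weak_pderivs u u2 [b, b]"
  shows "coef (cut u2 (eta R)) \<xi>
    = - 2 * coef (cut u1 (eta1 R b)) \<xi>
      - coef (cut u (eta2 R b b)) \<xi>
      - complex_of_real ((\<xi> \<bullet> b)\<^sup>2) * coef (cut u (eta R)) \<xi>"
proof -
  let ?e = "\<lambda>p. cis (- \<xi> \<bullet> p)"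
  define f where "f = (\<lambda>p. complex_of_real (eta R p) * ?e p)"
  define f1 where "f1 = (\<lambda>p. complex_of_real (eta1 R b p) * ?e p)"
  define f2 where "f2 = (\<lambda>p. complex_of_real (eta2 R b b p) * ?e p)"
  \<comment> \<open>The factor that differentiation along \<open>b\<close> puts in front of the
    exponential.\<close>
  define \<kappa> where "\<kappa> = - \<i> * complex_of_real (\<xi> \<bullet> b)"
  define \<phi> where "\<phi> = descend f"
  define \<psi> where "\<psi> = descend f1"
  have cov: "\<phi> \<circ> cover = f" "\<psi> \<circ> cover = f1" and test: "test_function \<phi>" "test_function \<psi>"
    unfolding \<phi>_def \<psi>_def f_def f1_def by (rule test_functions[OF \<xi>])+
  define f' where "f' p h = complex_of_real (eta R p) * (of_real (- \<xi> \<bullet> h) * (\<i> * ?e p)) + of_real (eta1 R h p) * ?e p" for p h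
  define f1' where "f1' p h = complex_of_real (eta1 R b p) * (of_real (- \<xi> \<bullet> h) * (\<i> * ?e p)) + of_real (eta2 R b h p) * ?e p" for p h
  have f': "(f has_derivative f' p) (at p)" for p
    unfolding f_def f'_def by (rule has_derivative_mult[OF eta_has_derivative cis_has_derivative])
  have f1': "(f1 has_derivative f1' p) (at p)" for p
    unfolding f1_def f1'_def by (rule has_derivative_mult[OF eta1_has_derivative cis_has_derivative])
  have f'b: "f' p b = \<kappa> * f p + f1 p" and f1'b: "f1' p b = \<kappa> * f1 p + f2 p" for p
    by (simp_all add: f'_def f1'_def f_def f1_def f2_def \<kappa>_def algebra_simps)
  have D1: "pderiv b \<phi> \<circ> cover = (\<lambda>p. \<kappa> * f p + f1 p)"
    using pderiv_cover_eq[OF cov(1) f'] f'b by (simp add: fun_eq_iff)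
  have D1': "((\<lambda>p. \<kappa> * f p + f1 p) has_derivative (\<lambda>h. \<kappa> * f' p h + f1' p h)) (at p)" for p
    by (intro has_derivative_add has_derivative_mult_right f' f1')
  have D2: "pderivs [b, b] \<phi> (cover p) = \<kappa> * (\<kappa> * f p + f1 p) + (\<kappa> * f1 p + f2 p)" for p
    using pderiv_cover_eq[OF D1 D1', of b p] by (simp add: pderivs_def f'b f1'b)
  have D3: "pderivs [b] \<psi> (cover p) = \<kappa> * f1 p + f2 p" for p
    using pderiv_cover_eq[OF cov(2) f1', of b p] by (simp add: pderivs_def f1'b)
  let ?c0 = "coef (cut u (eta R)) \<xi>"
  let ?c1 = "coef (cut u (eta1 R b)) \<xi>"
  let ?c2 = "coef (cut u (eta2 R b b)) \<xi>"
  note out = eta_outside[OF real_R(2)]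
  note meas = L2[THEN L2D(1)]
  have covp: "\<phi> (cover p) = f p" "\<psi> (cover p) = f1 p" for p
    using fun_cong[OF cov(1), of p] fun_cong[OF cov(2), of p] by simp_all
  have "V *\<^sub>R coef (\<lambda>p. u (cover p) * (\<kappa>\<^sup>2 * complex_of_real (eta R p) + 2 * \<kappa> * complex_of_real (eta1 R b p) + complex_of_real (eta2 R b b p))) \<xi>
      = (LINT z|flat. u z * pderivs [b, b] \<phi> z)"
    by (rule flat_coef[symmetric], rule meas, rule pderivs_borel_measurable[OF test(1)])
       (use b in \<open>auto simp: D2 f_def f1_def f2_def out power2_eq_square algebra_simps\<close>)
  also have "\<dots> = (LINT z|flat. u2 z * \<phi> z)"
    using weak(2) test(1) by (simp add: has_weak_pderivs_def)
  also have "\<dots> = V *\<^sub>R coef (cut u2 (eta R)) \<xi>"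
    by (rule flat_coef, rule meas, rule pderivs_borel_measurable[OF test(1), of "[]", unfolded pderivs_def foldr.simps id_apply])
       (auto simp: covp f_def out)
  finally have A: "coef (cut u2 (eta R)) \<xi>
      = coef (\<lambda>p. u (cover p) * (\<kappa>\<^sup>2 * complex_of_real (eta R p) + 2 * \<kappa> * complex_of_real (eta1 R b p) + complex_of_real (eta2 R b b p))) \<xi>"
    using measure_cell_pos by simp
  have "V *\<^sub>R coef (\<lambda>p. u (cover p) * (\<kappa> * complex_of_real (eta1 R b p) + complex_of_real (eta2 R b b p))) \<xi>
      = (LINT z|flat. u z * pderivs [b] \<psi> z)"
    by (rule flat_coef[symmetric], rule meas, rule pderivs_borel_measurable[OF test(2)])
       (use b in \<open>auto simp: D3 f1_def f2_def out algebra_simps\<close>)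
  also have "\<dots> = - (LINT z|flat. u1 z * \<psi> z)"
    using weak(1) test(2) by (simp add: has_weak_pderivs_def)
  also have "(LINT z|flat. u1 z * \<psi> z) = V *\<^sub>R coef (cut u1 (eta1 R b)) \<xi>"
    by (rule flat_coef, rule meas, rule pderivs_borel_measurable[OF test(2), of "[]", unfolded pderivs_def foldr.simps id_apply])
       (auto simp: covp f1_def out)
  finally have B: "coef (\<lambda>p. u (cover p) * (\<kappa> * complex_of_real (eta1 R b p) + complex_of_real (eta2 R b b p))) \<xi>
      = - coef (cut u1 (eta1 R b)) \<xi>"
    using measure_cell_pos by (simp flip: scaleR_minus_right)
  note SI = sq_int_eta(1)[OF L2(1)] sq_int_eta(2,3)[OF L2(1) b]
  have "coef (\<lambda>p. u (cover p) * (\<kappa>\<^sup>2 * complex_of_real (eta R p) + 2 * \<kappa> * complex_of_real (eta1 R b p) + complex_of_real (eta2 R b b p))) \<xi>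
      = coef (\<lambda>p. \<kappa>\<^sup>2 * (u (cover p) * complex_of_real (eta R p)) + 2 * \<kappa> * (u (cover p) * complex_of_real (eta1 R b p))
         + u (cover p) * complex_of_real (eta2 R b b p)) \<xi>"
    by (rule arg_cong[where f = "\<lambda>v. coef v \<xi>"]) (auto simp: fun_eq_iff algebra_simps)
  also have "\<dots> = \<kappa>\<^sup>2 * ?c0 + 2 * \<kappa> * ?c1 + ?c2"
    by (subst coef_add, (intro sq_int_add sq_int_cmult SI)+, subst coef_add, (intro sq_int_add sq_int_cmult SI)+)
       (simp only: coef_cmult)
  finally have A': "coef (cut u2 (eta R)) \<xi> = \<kappa>\<^sup>2 * ?c0 + 2 * \<kappa> * ?c1 + ?c2"
    using A by simp
  have "coef (\<lambda>p. u (cover p) * (\<kappa> * complex_of_real (eta1 R b p) + complex_of_real (eta2 R b b p))) \<xi>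
      = coef (\<lambda>p. \<kappa> * (u (cover p) * complex_of_real (eta1 R b p)) + u (cover p) * complex_of_real (eta2 R b b p)) \<xi>"
    by (rule arg_cong[where f = "\<lambda>v. coef v \<xi>"]) (auto simp: fun_eq_iff algebra_simps)
  also have "\<dots> = \<kappa> * ?c1 + ?c2"
    by (subst coef_add, (intro sq_int_add sq_int_cmult SI)+) (simp only: coef_cmult)
  finally have B': "\<kappa> * ?c1 = - coef (cut u1 (eta1 R b)) \<xi> - ?c2"
    using B by (simp add: algebra_simps)
  have "\<kappa>\<^sup>2 = - complex_of_real ((\<xi> \<bullet> b)\<^sup>2)"
    by (simp add: \<kappa>_def power_mult_distrib)
  \<comment> \<open>\<open>B'\<close> eliminates the term linear in \<kappa>; the quadratic one is
    kept as the symbol of the second derivative.\<close>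
  moreover have "2 * \<kappa> * ?c1 = 2 * (- coef (cut u1 (eta1 R b)) \<xi> - ?c2)"
    by (simp only: mult.assoc B')
  ultimately show ?thesis
    unfolding A' by (simp add: algebra_simps)
qed

text \<open>The commutator of the Laplacian with multiplication by \<eta>, applied to
  \<open>u\<close>, with \<open>u1\<close> in the place of the first derivatives.\<close>

definition cutoff_error where
  "cutoff_error u u1 p = (\<Sum>b\<in>Basis. 2 * (u1 b (cover p) * complex_of_real (eta1 R b p)) + u (cover p) * complex_of_real (eta2 R b b p))"

lemma sq_int_cutoff_error:
  assumes "L2 u" "\<And>b. b \<in> Basis \<Longrightarrow> L2 (u1 b)"
  shows "sq_int (cutoff_error u u1)"
  unfolding cutoff_error_def[abs_def] using assms
  by (intro sq_int_sum sq_int_add sq_int_cmult sq_int_eta) auto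

text \<open>The Fourier form of (\<Delta> - l)(\<eta> u) = \<eta> f + [\<Delta>, \<eta>] u. The
  product \<eta> u is never differentiated, as all derivatives fall on test functions. Summing over
  \<open>b\<close> turns the squares \<open>(\<xi> \<bullet> b)\<^sup>2\<close> into the squared
  norm of \<xi>.\<close>

lemma coef_resolvent:
  fixes u f :: "(real ^ 'n) \<times> (circle ^ 'm) \<Rightarrow> complex"
  assumes \<xi>: "\<xi> \<in> freq_lattice N" and u: "L2 u" and f: "L2 f"
    and u1: "\<And>b. b \<in> Basis \<Longrightarrow> L2 (u1 b) \<and> has_weak_pderivs u (u1 b) [b]"
    and u2: "\<And>b. b \<in> Basis \<Longrightarrow> L2 (u2 b) \<and> has_weak_pderivs u (u2 b) [b, b]"
    and eq: "AE z in flat. (\<Sum>b\<in>Basis. u2 b z) - complex_of_real l * u z = f z"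
  shows "coef (\<lambda>p. f (cover p) * complex_of_real (eta R p) + cutoff_error u u1 p) \<xi>
    = - complex_of_real ((norm \<xi>)\<^sup>2 + l) * coef (cut u (eta R)) \<xi>"
proof -
  let ?c = "\<lambda>w. coef (cut w (eta R)) \<xi>"
  let ?Bas = "Basis :: ((real ^ 'n) \<times> (real ^ 'm)) set"
  define \<phi> where "\<phi> = descend (wave (eta R) \<xi>)"
  have \<phi>_cov: "\<phi> (cover p) = complex_of_real (eta R p) * cis (- (\<xi> \<bullet> p))" for p
    using fun_cong[OF test_functions(1)[OF \<xi>], of p] by (simp add: \<phi>_def)
  have \<phi>_meas [measurable]: "\<phi> \<in> borel_measurable borel"
    using pderivs_borel_measurable[OF test_functions(3)[OF \<xi>], of "[]"] by (simp add: \<phi>_def pderivs_def)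
  have [measurable]: "u \<in> borel_measurable borel" "f \<in> borel_measurable borel"
    using u f by (auto dest: L2D)
  have u2_meas: "u2 b \<in> borel_measurable borel" if "b \<in> ?Bas" for b
    using u2[OF that] by (auto dest: L2D)
  then have S_meas [measurable]: "(\<lambda>z. \<Sum>b\<in>?Bas. u2 b z) \<in> borel_measurable borel"
    by (intro borel_measurable_sum)
  note out = eta_outside[OF real_R(2)]
  have "V *\<^sub>R ?c (\<lambda>z. \<Sum>b\<in>?Bas. u2 b z) = (LINT z|flat. (\<Sum>b\<in>?Bas. u2 b z) * \<phi> z)"
    by (rule flat_coef[symmetric]) (auto simp: \<phi>_cov out)
  also have "\<dots> = (LINT z|flat. (f z + complex_of_real l * u z) * \<phi> z)"
  proof (rule integral_cong_AE)
    show "AE z in flat. (\<Sum>b\<in>?Bas. u2 b z) * \<phi> z = (f z + complex_of_real l * u z) * \<phi> z"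
      using eq by eventually_elim (auto simp: algebra_simps)
  qed measurable
  also have "\<dots> = V *\<^sub>R ?c (\<lambda>z. f z + complex_of_real l * u z)"
    by (rule flat_coef) (auto simp: \<phi>_cov out)
  finally have 1: "?c (\<lambda>z. \<Sum>b\<in>?Bas. u2 b z) = ?c (\<lambda>z. f z + complex_of_real l * u z)"
    using measure_cell_pos by simp
  have "?c (\<lambda>z. f z + complex_of_real l * u z)
      = coef (\<lambda>p. f (cover p) * complex_of_real (eta R p) + complex_of_real l * (u (cover p) * complex_of_real (eta R p))) \<xi>"
    by (rule arg_cong[where f = "\<lambda>v. coef v \<xi>"]) (auto simp: fun_eq_iff algebra_simps)
  also have "\<dots> = ?c f + l * ?c u"
    using u f by (subst coef_add) (auto intro!: sq_int_cmult sq_int_eta simp: coef_cmult)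
  finally have 2: "?c (\<lambda>z. f z + complex_of_real l * u z) = ?c f + l * ?c u" .
  have 3: "?c (\<lambda>z. \<Sum>b\<in>?Bas. u2 b z) = (\<Sum>b\<in>?Bas. ?c (u2 b))"
    unfolding sum_distrib_right using u2 by (intro coef_sum sq_int_eta) auto
  let ?d = "\<lambda>b. 2 * coef (cut (u1 b) (eta1 R b)) \<xi> + coef (cut u (eta2 R b b)) \<xi>"
  have "coef (cutoff_error u u1) \<xi> = (\<Sum>b\<in>?Bas. ?d b)"
  proof -
    have "coef (cutoff_error u u1) \<xi> = (\<Sum>b\<in>?Bas. coef (\<lambda>p. 2 * (u1 b (cover p) * complex_of_real (eta1 R b p))
        + u (cover p) * complex_of_real (eta2 R b b p)) \<xi>)"
      unfolding cutoff_error_def[abs_def] using u u1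
      by (intro coef_sum sq_int_add sq_int_cmult sq_int_eta) auto
    also have "\<dots> = (\<Sum>b\<in>?Bas. ?d b)"
      using u u1 by (intro sum.cong refl, subst coef_add)
        (auto intro!: sq_int_cmult sq_int_eta simp: coef_cmult)
    finally show ?thesis .
  qed
  also have "\<dots> = (\<Sum>b\<in>?Bas. - ?c (u2 b) - complex_of_real ((\<xi> \<bullet> b)\<^sup>2) * ?c u)"
  proof (intro sum.cong refl)
    fix b :: "(real ^ 'n) \<times> (real ^ 'm)" assume b: "b \<in> Basis"
    show "?d b = - ?c (u2 b) - complex_of_real ((\<xi> \<bullet> b)\<^sup>2) * ?c u"
      using coef_second_derivative[OF \<xi> b u, of "u1 b" "u2 b"] u1[OF b] u2[OF b] by simp
  qed
  also have "\<dots> = - (?c f + l * ?c u) - complex_of_real ((norm \<xi>)\<^sup>2) * ?c u"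
  proof -
    have "(norm \<xi>)\<^sup>2 = (\<Sum>b\<in>?Bas. (\<xi> \<bullet> b)\<^sup>2)"
      unfolding power2_norm_eq_inner by (subst euclidean_inner) (simp add: power2_eq_square)
    then show ?thesis
      using 1 2 3 by (simp add: sum_subtractf sum_negf sum_distrib_right)
  qed
  finally have 4: "coef (cutoff_error u u1) \<xi> = - (?c f + l * ?c u) - complex_of_real ((norm \<xi>)\<^sup>2) * ?c u" .
  have "coef (\<lambda>p. f (cover p) * complex_of_real (eta R p) + cutoff_error u u1 p) \<xi> = ?c f + coef (cutoff_error u u1) \<xi>"
    using u f u1 by (intro coef_add sq_int_eta sq_int_cutoff_error) auto
  then show ?thesis
    unfolding 4 by (simp add: algebra_simps)
qed

end

section \<open>A tent supported over the observation set\<close>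

lemma cosdist_small:
  fixes p :: "'a::euclidean_space"
  assumes \<delta>: "0 < \<delta>"
  shows "\<exists>r>0. \<forall>x. cosdist p x < r \<longrightarrow> (\<exists>k\<in>int_lattice. norm (x - (2 * pi) *\<^sub>R k - p) < \<delta>)"
proof -
  \<comment> \<open>Every coordinate is to be within \<open>d\<close>, and their sum has to stay
    strictly below \<delta>, hence the factor 2. The bound pi keeps \<open>d\<close> where the
    cosine decreases.\<close>
  define d where "d = min (\<delta> / (2 * DIM('a))) pi"
  have d: "0 < d" "d \<le> pi" "d \<le> \<delta> / (2 * DIM('a))"
    unfolding d_def using \<delta> by auto
  have "\<exists>k\<in>int_lattice. norm (x - (2 * pi) *\<^sub>R k - p) < \<delta>" if x: "cosdist p x < 1 - cos d" for x
  proof -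
    \<comment> \<open>Rounding brings each coordinate into [-pi, pi] modulo 2 pi, where a cosine
      above \<open>cos d\<close> forces the modulus below \<open>d\<close>.\<close>
    define n where "n b = round ((x - p) \<bullet> b / (2 * pi))" for b
    define k where "k = (\<Sum>b\<in>Basis. of_int (n b) *\<^sub>R b :: 'a)"
    have kb: "k \<bullet> b = of_int (n b)" if "b \<in> Basis" for b
      using that by (simp add: k_def inner_sum_left_Basis)
    have small: "\<bar>(x - (2 * pi) *\<^sub>R k - p) \<bullet> b\<bar> \<le> d" if b: "b \<in> Basis" for b
    proof -
      define s where "s = (x - p) \<bullet> b - 2 * pi * of_int (n b)"
      have s: "(x - (2 * pi) *\<^sub>R k - p) \<bullet> b = s"
        by (simp add: s_def inner_diff_left kb[OF b])
      have "\<bar>(x - p) \<bullet> b / (2 * pi) - of_int (n b)\<bar> \<le> 1 / 2"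
        unfolding n_def using of_int_round_abs_le[of "(x - p) \<bullet> b / (2 * pi)"] by (simp add: abs_minus_commute)
      moreover have "(x - p) \<bullet> b / (2 * pi) - of_int (n b) = s / (2 * pi)"
        by (simp add: s_def field_simps)
      ultimately have s_pi: "\<bar>s\<bar> \<le> pi"
        by (simp add: abs_divide field_simps)
      have "cos ((x - p) \<bullet> b) = cos s"
        unfolding s_def using cos_int_2pin[of "n b"] sin_int_2pin[of "n b"] by (simp add: cos_diff)
      then have "1 - cos s \<le> cosdist p x"
        unfolding cosdist_def using b by (metis (no_types, lifting) cos_le_one diff_ge_0_iff_ge finite_Basis member_le_sum)
      then have "cos d < cos \<bar>s\<bar>" using x by (simp add: abs_if)
      then show ?thesis
        unfolding s using cos_monotone_0_pi_le[of d "\<bar>s\<bar>"] d s_pi by linarith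
    qed
    have "norm (x - (2 * pi) *\<^sub>R k - p) \<le> (\<Sum>b\<in>Basis. \<bar>(x - (2 * pi) *\<^sub>R k - p) \<bullet> b\<bar>)"
      by (rule norm_le_l1)
    also have "\<dots> \<le> (\<Sum>b\<in>(Basis :: 'a set). d)"
      using small by (rule sum_mono)
    also have "\<dots> = DIM('a) * d" by simp
    also have "\<dots> \<le> DIM('a) * (\<delta> / (2 * DIM('a)))"
      using d by (intro mult_left_mono) auto
    also have "\<dots> < \<delta>" using \<delta> by simp
    finally have "norm (x - (2 * pi) *\<^sub>R k - p) < \<delta>" .
    moreover have "k \<in> int_lattice" by (auto simp: int_lattice_def kb)
    ultimately show ?thesis by blast
  qed
  moreover have "0 < 1 - cos d"
    using cos_monotone_0_pi[of 0 d] d by simp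
  ultimately show ?thesis by blast
qed

text \<open>Periodicity of \<open>\<Omega>1\<close> in \<open>x\<close> and the identification of
  points in \<open>y\<close> make the preimage of the observation set invariant under 2 pi times the
  integer lattice. It therefore contains all translates of a small ball, and a small tent vanishes
  outside of them.\<close>

lemma tent_le_indicator:
  fixes \<Omega>1 :: "(real ^ 'n) set" and \<Omega>2 :: "(circle ^ 'm) set"
  assumes "\<Omega>1 \<noteq> {}" "open \<Omega>1" "periodic_set \<Omega>1" "\<Omega>2 \<noteq> {}" "open \<Omega>2"
  shows "\<exists>p. \<exists>r>0. \<forall>x. tent p r x \<le> indicator (\<Omega>1 \<times> \<Omega>2) (cover x)"
proof -
  obtain p where p: "cover p \<in> \<Omega>1 \<times> \<Omega>2"
    using assms surj_cover by (metis SigmaI ex_in_conv surjD)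
  have "open (cover -` (\<Omega>1 \<times> \<Omega>2))"
    using open_Times[OF assms(2,5)] continuous_on_cover by (rule open_vimage)
  then obtain \<delta> where \<delta>: "0 < \<delta>" "ball p \<delta> \<subseteq> cover -` (\<Omega>1 \<times> \<Omega>2)"
    using p by (metis open_contains_ball vimageI)
  obtain r where r: "0 < r" "\<And>x. cosdist p x < r \<Longrightarrow> \<exists>k\<in>int_lattice. norm (x - (2 * pi) *\<^sub>R k - p) < \<delta>"
    using cosdist_small[OF \<delta>(1)] by blast
  have "cover x \<in> \<Omega>1 \<times> \<Omega>2" if "cosdist p x < r" for x
  proof -
    obtain k where k: "k \<in> int_lattice" "norm (x - (2 * pi) *\<^sub>R k - p) < \<delta>" using r(2) \<open>cosdist p x < r\<close> by blast
    define q where "q = x - (2 * pi) *\<^sub>R k"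
    have "q \<in> ball p \<delta>"
      using k(2) by (simp add: q_def dist_norm norm_minus_commute)
    then have q: "cover q \<in> \<Omega>1 \<times> \<Omega>2" using \<delta>(2) by blast
    have "(axis i 1, 0) \<in> (Basis :: ((real ^ 'n) \<times> (real ^ 'm)) set)" for i
      by (auto simp: Basis_prod_def Basis_vec_def)
    then have "k \<bullet> (axis i 1, 0) \<in> \<int>" for i
      using k(1) unfolding int_lattice_def by blast
    then have 1: "of_int \<lfloor>fst k $ i\<rfloor> = fst k $ i" for i
      by (simp add: inner_prod_def inner_axis)
    have "(0, axis i 1) \<in> (Basis :: ((real ^ 'n) \<times> (real ^ 'm)) set)" for i
      by (auto simp: Basis_prod_def Basis_vec_def)
    then have "k \<bullet> (0, axis i 1) \<in> \<int>" for i
      using k(1) unfolding int_lattice_def by blast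
    then have 2: "of_int \<lfloor>snd k $ i\<rfloor> = snd k $ i" for i
      by (simp add: inner_prod_def inner_axis)
    have "fst q \<in> \<Omega>1" using q by (simp add: cover_def)
    moreover have "(\<chi> i. of_int ((\<chi> i. \<lfloor>fst k $ i\<rfloor>) $ i)) = fst k"
      by (simp add: vec_eq_iff 1)
    ultimately have "fst q + (2 * pi) *\<^sub>R fst k \<in> \<Omega>1"
      using assms(3) unfolding periodic_set_def by (metis imageI)
    then have "fst x \<in> \<Omega>1" by (simp add: q_def)
    moreover have "circle_rel (snd x $ i) (snd q $ i)" for i
      unfolding circle_rel_def by (intro exI[of _ "\<lfloor>snd k $ i\<rfloor>"]) (simp add: q_def 2)
    then have "snd (cover x) = snd (cover q)"
      by (simp add: cover_def vec_eq_iff circle.abs_eq_iff)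
    then have "snd (cover x) \<in> \<Omega>2" using q by (metis mem_Times_iff)
    ultimately show ?thesis by (simp add: cover_def mem_Times_iff)
  qed
  moreover have "tent p r x = 0" if "\<not> cosdist p x < r" for x
    using that r(1) by (simp add: tent_def field_simps)
  ultimately have "tent p r x \<le> indicator (\<Omega>1 \<times> \<Omega>2) (cover x)" for x
    using tent_le_1[OF r(1), of p x] by (cases "cosdist p x < r") (auto simp: indicator_def)
  then show ?thesis using r(1) by blast
qed

text \<open>The bound for the squared cutoff error apart from its factor of order
  \<open>1 / R\<^sup>2\<close>: Cauchy-Schwarz over the basis gives the dimension, and (2 a + b)^2
  \<le> 8 a^2 + 2 b^2 the remaining constants.\<close>

definition gradient_sq where
  "gradient_sq u u1 z = real DIM((real ^ 'n) \<times> (real ^ 'm)) *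
     (\<Sum>b\<in>(Basis :: ((real ^ 'n) \<times> (real ^ 'm)) set). 8 * (norm (u1 b z))\<^sup>2 + 2 * (norm (u z))\<^sup>2)"
  for u :: "(real ^ 'n) \<times> (circle ^ 'm) \<Rightarrow> complex"

lemma descend_eta_cover: "descend (eta R) (cover p) = eta R p"
proof -
  have "descend (eta R) \<circ> cover = eta R"
    by (rule descend_cover) (auto simp: cover_eq_iff eta_def rad_def)
  then show ?thesis by (metis comp_apply)
qed

lemma descend_eta_measurable [measurable]:
  "(descend (eta R) :: (real ^ 'n) \<times> (circle ^ 'm) \<Rightarrow> real) \<in> borel_measurable borel"
proof -
  have "descend (eta R) \<circ> cover = (eta R :: (real ^ 'n) \<times> (real ^ 'm) \<Rightarrow> real)"
    by (simp add: fun_eq_iff descend_eta_cover del: split_paired_All)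
  then have "continuous_on UNIV (descend (eta R) \<circ> (cover :: (real ^ 'n) \<times> (real ^ 'm) \<Rightarrow> _))"
    by (simp only: continuous_on_eta)
  then show ?thesis
    by (intro borel_measurable_continuous_onI continuous_on_descend)
qed

context cutoff_cell
begin

lemma norm_cutoff_error_sq_le:
  fixes p :: "(real ^ 'n) \<times> (real ^ 'm)"
  shows "(norm (cutoff_error u u1 p))\<^sup>2 \<le> (148 * exp 1 / R)\<^sup>2 * gradient_sq u u1 (cover p)"
proof -
  let ?K = "148 * exp 1 / real R" and ?B = "Basis :: ((real ^ 'n) \<times> (real ^ 'm)) set"
  let ?t = "\<lambda>b. 2 * norm (u1 b (cover p)) + norm (u (cover p))"
  have K: "0 \<le> ?K" by simp
  have "norm (cutoff_error u u1 p) \<le> (\<Sum>b\<in>?B. norm (2 * (u1 b (cover p) * complex_of_real (eta1 R b p)) + u (cover p) * complex_of_real (eta2 R b b p)))"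
    unfolding cutoff_error_def by (rule norm_sum)
  also have "\<dots> \<le> (\<Sum>b\<in>?B. ?K * ?t b)"
  proof (rule sum_mono)
    fix b assume b: "b \<in> ?B"
    have "norm (2 * (u1 b (cover p) * complex_of_real (eta1 R b p)) + u (cover p) * complex_of_real (eta2 R b b p))
      \<le> 2 * (norm (u1 b (cover p)) * \<bar>eta1 R b p\<bar>) + norm (u (cover p)) * \<bar>eta2 R b b p\<bar>"
      by (rule order_trans[OF norm_triangle_ineq]) (simp add: norm_mult)
    also have "\<dots> \<le> 2 * (norm (u1 b (cover p)) * ?K) + norm (u (cover p)) * ?K"
      using eta1_bound[OF real_R(1) b] eta2_bound[OF real_R(1) b]
      by (intro add_mono mult_left_mono) auto
    finally show "norm (2 * (u1 b (cover p) * complex_of_real (eta1 R b p)) + u (cover p) * complex_of_real (eta2 R b b p)) \<le> ?K * ?t b"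
      by (simp add: algebra_simps add_divide_distrib)
  qed
  also have "\<dots> = ?K * (\<Sum>b\<in>?B. ?t b)" by (simp add: sum_distrib_left)
  finally have "(norm (cutoff_error u u1 p))\<^sup>2 \<le> (?K * (\<Sum>b\<in>?B. ?t b))\<^sup>2"
    by (rule power_mono) simp
  also have "\<dots> = ?K\<^sup>2 * (\<Sum>b\<in>?B. ?t b)\<^sup>2" by (rule power_mult_distrib)
  also have "(\<Sum>b\<in>?B. ?t b)\<^sup>2 \<le> (\<Sum>b\<in>?B. (?t b)\<^sup>2) * card ?B"
    by (rule sum_squared_le_sum_of_squares)
  also have "(\<Sum>b\<in>?B. (?t b)\<^sup>2) \<le> (\<Sum>b\<in>?B. 8 * (norm (u1 b (cover p)))\<^sup>2 + 2 * (norm (u (cover p)))\<^sup>2)"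
  proof (rule sum_mono)
    show "(?t b)\<^sup>2 \<le> 8 * (norm (u1 b (cover p)))\<^sup>2 + 2 * (norm (u (cover p)))\<^sup>2" for b
      using sum_squares_bound[of "2 * norm (u1 b (cover p))" "norm (u (cover p))"]
      by (simp add: power2_sum power_mult_distrib)
  qed
  finally show ?thesis
    by (simp add: gradient_sq_def mult_left_mono mult_right_mono mult.commute)
qed

text \<open>Split \<open>v = \<eta> u\<close> into its frequencies in the shell and the rest. The
  rest is bounded by the mean square \<open>?G\<close> of the right-hand side \<open>g\<close>. The
  shell part is observed through the tent; replacing it there by \<open>v\<close> costs another
  multiple of the rest. Orthogonality then gives the mean square of \<open>v\<close> as
  \<open>?S + ?A\<close>.\<close>

lemma resolvent_energy:
  fixes u f :: "(real ^ 'n) \<times> (circle ^ 'm) \<Rightarrow> complex"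
  assumes u: "L2 u" and f: "L2 f"
    and u1: "\<And>b. b \<in> Basis \<Longrightarrow> L2 (u1 b) \<and> has_weak_pderivs u (u1 b) [b]"
    and u2: "\<And>b. b \<in> Basis \<Longrightarrow> L2 (u2 b) \<and> has_weak_pderivs u (u2 b) [b, b]"
    and eq: "AE z in flat. (\<Sum>b\<in>Basis. u2 b z) - complex_of_real l * u z = f z"
    and c: "0 < c" "\<And>\<mu> \<Lambda> a. finite \<Lambda> \<Longrightarrow> \<Lambda> \<subseteq> freq_lattice N \<Longrightarrow> shell \<mu> \<Lambda> \<Longrightarrow>
      c * coef_sq a \<Lambda> \<le> (LINT x|avg A N. tent p r x * (norm (trig a \<Lambda> x))\<^sup>2)"
    and r: "0 < r" and \<Omega>: "\<Omega> \<in> sets borel" and tent: "\<And>x. tent p r x \<le> indicator \<Omega> (cover x)"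
  shows "(LINT z|flat. (descend (eta R) z)\<^sup>2 * (norm (u z))\<^sup>2)
    \<le> 2 / c * (LINT z|flat. indicator \<Omega> z * (norm (u z))\<^sup>2)
      + (2 / c + 1) * (LINT z|flat. 2 * (norm (f z))\<^sup>2 + 2 * (148 * exp 1 / R)\<^sup>2 * gradient_sq u u1 z)"
proof -
  define v where "v = cut u (eta R)"
  define g where "g = (\<lambda>p. f (cover p) * complex_of_real (eta R p) + cutoff_error u u1 p)"
  have u_meas [measurable]: "u \<in> borel_measurable borel" and f_meas [measurable]: "f \<in> borel_measurable borel"
    using u f by (auto dest: L2D)
  have SIv: "sq_int v" unfolding v_def by (rule sq_int_eta[OF u])
  have SIg: "sq_int g" unfolding g_def using u f u1 by (intro sq_int_add sq_int_eta sq_int_cutoff_error) auto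
  have [measurable]: "v \<in> borel_measurable borel" "g \<in> borel_measurable borel"
    using SIv SIg by (auto dest: sq_intD)
  \<comment> \<open>The frequencies at which the multiplier of \<open>coef_resolvent\<close> is not
    invertible with inverse bounded by 1. They form a shell centred at \<open>- l\<close>.\<close>
  define \<Lambda> where "\<Lambda> = {\<xi> \<in> freq_lattice N. \<bar>(norm \<xi>)\<^sup>2 + l\<bar> \<le> 1}"
  have "norm \<xi> \<le> 1 + \<bar>l\<bar>" if "\<xi> \<in> \<Lambda>" for \<xi>
  proof (rule power2_le_imp_le)
    have "(norm \<xi>)\<^sup>2 \<le> 1 + \<bar>l\<bar>" using that by (auto simp: \<Lambda>_def)
    also have "\<dots> \<le> (1 + \<bar>l\<bar>)\<^sup>2" by (simp add: power2_eq_square algebra_simps)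
    finally show "(norm \<xi>)\<^sup>2 \<le> (1 + \<bar>l\<bar>)\<^sup>2" .
  qed simp
  then have "\<Lambda> \<subseteq> {\<xi> \<in> freq_lattice N. norm \<xi> \<le> 1 + \<bar>l\<bar>}" by (auto simp: \<Lambda>_def)
  then have fin: "finite \<Lambda>"
    by (rule finite_subset) (rule finite_freq_lattice_bounded[OF N_pos])
  have sub: "\<Lambda> \<subseteq> freq_lattice N" by (auto simp: \<Lambda>_def)
  have sh: "shell (- l) \<Lambda>" by (auto simp: shell_def \<Lambda>_def)
  have coef_g: "coef g \<xi> = - complex_of_real ((norm \<xi>)\<^sup>2 + l) * coef v \<xi>" if "\<xi> \<in> freq_lattice N" for \<xi>
    unfolding g_def v_def by (rule coef_resolvent[OF that u f u1 u2 eq])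
  let ?u1 = "trig (coef v) \<Lambda>"
  let ?A = "LINT x|avg A N. (norm (v x - ?u1 x))\<^sup>2"
  let ?G = "mean_sq g"
  let ?S = "\<Sum>\<xi>\<in>\<Lambda>. (norm (coef v \<xi>))\<^sup>2"
  let ?T = "LINT x|avg A N. tent p r x * (norm (v x))\<^sup>2"
  have AG: "?A \<le> ?G"
  proof (rule spectral_remainder[OF SIv SIg fin sub])
    fix \<xi> assume \<xi>: "\<xi> \<in> freq_lattice N" "\<xi> \<notin> \<Lambda>"
    then have "1 \<le> \<bar>(norm \<xi>)\<^sup>2 + l\<bar>" by (auto simp: \<Lambda>_def)
    then have "1 * norm (coef v \<xi>) \<le> \<bar>(norm \<xi>)\<^sup>2 + l\<bar> * norm (coef v \<xi>)"
      by (intro mult_right_mono) auto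
    also have "\<dots> = norm (coef g \<xi>)"
      unfolding coef_g[OF \<xi>(1)] norm_mult norm_minus_cancel norm_of_real ..
    finally show "norm (coef v \<xi>) \<le> norm (coef g \<xi>)" by simp
  qed
  have iv: "integrable (avg A N) (\<lambda>x. (norm (v x))\<^sup>2)" by (rule sq_intD(2)[OF SIv])
  have id: "integrable (avg A N) (\<lambda>x. (norm (v x - ?u1 x))\<^sup>2)"
    by (intro sq_intD(2) sq_int_diff SIv sq_int_continuous continuous_intros)
  have [measurable]: "tent p r \<in> borel_measurable borel"
    by (intro borel_measurable_continuous_onI continuous_intros)
  have itv: "integrable (avg A N) (\<lambda>x. tent p r x * (norm (v x))\<^sup>2)"
    by (rule Bochner_Integration.integrable_bound[OF iv])
      (auto intro!: AE_I2 mult_left_le_one_le simp: tent_nonneg tent_le_1[OF r] abs_mult)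
  have "c * ?S \<le> (LINT x|avg A N. tent p r x * (norm (?u1 x))\<^sup>2)"
    by (rule c(2)[OF fin sub sh])
  also have "\<dots> \<le> (LINT x|avg A N. 2 * (tent p r x * (norm (v x))\<^sup>2) + 2 * (norm (v x - ?u1 x))\<^sup>2)"
  proof (rule integral_mono)
    show "integrable (avg A N) (\<lambda>x. tent p r x * (norm (?u1 x))\<^sup>2)"
      by (intro integrable_continuous continuous_intros)
    show "integrable (avg A N) (\<lambda>x. 2 * (tent p r x * (norm (v x))\<^sup>2) + 2 * (norm (v x - ?u1 x))\<^sup>2)"
      by (intro Bochner_Integration.integrable_add integrable_mult_right itv id)
    show "tent p r x * (norm (?u1 x))\<^sup>2 \<le> 2 * (tent p r x * (norm (v x))\<^sup>2) + 2 * (norm (v x - ?u1 x))\<^sup>2" for x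
    proof -
      have "(norm (?u1 x))\<^sup>2 \<le> 2 * (norm (v x))\<^sup>2 + 2 * (norm (v x - ?u1 x))\<^sup>2"
        using norm_diff_sq_le[of "v x" "v x - ?u1 x"] by simp
      then have "tent p r x * (norm (?u1 x))\<^sup>2 \<le> tent p r x * (2 * (norm (v x))\<^sup>2 + 2 * (norm (v x - ?u1 x))\<^sup>2)"
        by (rule mult_left_mono[OF _ tent_nonneg])
      moreover have "tent p r x * (norm (v x - ?u1 x))\<^sup>2 \<le> 1 * (norm (v x - ?u1 x))\<^sup>2"
        by (intro mult_right_mono tent_le_1 r) simp
      ultimately show ?thesis by (simp add: algebra_simps)
    qed
  qed
  also have "\<dots> = 2 * ?T + 2 * ?A"
    using itv id by simp
  finally have cS: "c * ?S \<le> 2 * ?T + 2 * ?G" using AG by linarith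
  then have S: "?S \<le> (2 * ?T + 2 * ?G) / c"
    using c(1) by (simp add: field_simps)
  have "?A = mean_sq v - ?S"
    unfolding integral_norm_sq_diff_trig[OF SIv fin sub] by simp
  then have main: "mean_sq v \<le> 2 / c * ?T + (2 / c + 1) * ?G"
    using S AG by (simp add: add_divide_distrib algebra_simps)
  \<comment> \<open>From here on means are turned back into integrals. The volume multiplies both
    sides alike, so the constants remain free of \<open>R\<close>.\<close>
  have V0: "0 \<le> V" by simp
  have "(LINT z|flat. (descend (eta R) z)\<^sup>2 * (norm (u z))\<^sup>2) = V * mean_sq v"
  proof -
    have "(LINT z|flat. (descend (eta R) z)\<^sup>2 * (norm (u z))\<^sup>2)
        = V *\<^sub>R (LINT p|avg A N. (descend (eta R) (cover p))\<^sup>2 * (norm (u (cover p)))\<^sup>2)"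
      by (rule integral_flat_cell) (auto simp: descend_eta_cover eta_outside[OF real_R(2)])
    then show ?thesis
      by (simp add: descend_eta_cover v_def norm_mult power_mult_distrib mult.commute)
  qed
  also have "\<dots> \<le> V * (2 / c * ?T + (2 / c + 1) * ?G)"
    using main V0 by (rule mult_left_mono)
  also have "\<dots> = 2 / c * (V * ?T) + (2 / c + 1) * (V * ?G)"
    by (simp add: algebra_simps)
  also have "\<dots> \<le> 2 / c * (LINT z|flat. indicator \<Omega> z * (norm (u z))\<^sup>2)
      + (2 / c + 1) * (LINT z|flat. 2 * (norm (f z))\<^sup>2 + 2 * (148 * exp 1 / R)\<^sup>2 * gradient_sq u u1 z)"
  proof (intro add_mono mult_left_mono)
    have [measurable]: "\<Omega> \<in> sets borel" by (rule \<Omega>)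
    show "V * ?T \<le> (LINT z|flat. indicator \<Omega> z * (norm (u z))\<^sup>2)"
    proof (rule cell_le_flat)
      show "integrable flat (\<lambda>z. indicator \<Omega> z * (norm (u z))\<^sup>2)"
        by (rule Bochner_Integration.integrable_bound[OF L2D(2)[OF u]]) (auto simp: indicator_def)
      show "tent p r x * (norm (v x))\<^sup>2 \<le> indicator \<Omega> (cover x) * (norm (u (cover x)))\<^sup>2" for x
      proof (intro mult_mono tent power_mono)
        have "norm (u (cover x)) * eta R x \<le> norm (u (cover x)) * 1"
          by (intro mult_left_mono eta_le_1) simp
        then show "norm (v x) \<le> norm (u (cover x))"
          by (simp add: v_def norm_mult eta_nonneg)
      qed auto
    qed (use itv in auto)
    have u1_meas [measurable]: "u1 b \<in> borel_measurable borel" if "b \<in> Basis" for b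
      using u1[OF that] by (auto dest: L2D)
    have grad_meas [measurable]: "gradient_sq u u1 \<in> borel_measurable borel"
      unfolding gradient_sq_def[abs_def] by measurable
    have grad_int: "integrable flat (gradient_sq u u1)"
      unfolding gradient_sq_def[abs_def] using u u1
      by (intro integrable_mult_right Bochner_Integration.integrable_sum Bochner_Integration.integrable_add) (auto dest: L2D)
    have grad0: "0 \<le> gradient_sq u u1 z" for z
      unfolding gradient_sq_def by (intro mult_nonneg_nonneg sum_nonneg) auto
    show "V * ?G \<le> (LINT z|flat. 2 * (norm (f z))\<^sup>2 + 2 * (148 * exp 1 / R)\<^sup>2 * gradient_sq u u1 z)"
    proof (rule cell_le_flat)
      show "integrable (avg A N) (\<lambda>x. (norm (g x))\<^sup>2)" by (rule sq_intD(2)[OF SIg])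
      show "integrable flat (\<lambda>z. 2 * (norm (f z))\<^sup>2 + 2 * (148 * exp 1 / R)\<^sup>2 * gradient_sq u u1 z)"
        by (intro Bochner_Integration.integrable_add integrable_mult_right grad_int L2D(2) f)
      show "(norm (g x))\<^sup>2 \<le> 2 * (norm (f (cover x)))\<^sup>2 + 2 * (148 * exp 1 / R)\<^sup>2 * gradient_sq u u1 (cover x)" for x
      proof -
        have "(norm (g x))\<^sup>2 \<le> 2 * (norm (f (cover x) * complex_of_real (eta R x)))\<^sup>2 + 2 * (norm (cutoff_error u u1 x))\<^sup>2"
          using norm_diff_sq_le[of "f (cover x) * complex_of_real (eta R x)" "- cutoff_error u u1 x"] by (simp add: g_def)
        moreover have "(norm (f (cover x) * complex_of_real (eta R x)))\<^sup>2 \<le> (norm (f (cover x)))\<^sup>2"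
        proof (intro power_mono)
          have "norm (f (cover x)) * eta R x \<le> norm (f (cover x)) * 1"
            by (intro mult_left_mono eta_le_1) simp
          then show "norm (f (cover x) * complex_of_real (eta R x)) \<le> norm (f (cover x))"
            by (simp add: norm_mult eta_nonneg)
        qed simp
        ultimately show ?thesis
          using norm_cutoff_error_sq_le[of u u1 x] by linarith
      qed
      show "0 \<le> 2 * (norm (f z))\<^sup>2 + 2 * (148 * exp 1 / R)\<^sup>2 * gradient_sq u u1 z" for z
        using grad0[of z] by simp
    qed measurable
  qed (use c(1) in auto)
  finally show ?thesis .
qed

end

theorem theorem1p3:
  fixes \<Omega>\<^sub>1 :: "(real ^ 'n) set" and \<Omega>\<^sub>2 :: "(circle ^ 'm) set"
  assumes "\<Omega>\<^sub>1 \<noteq> {}" and "open \<Omega>\<^sub>1" and "periodic_set \<Omega>\<^sub>1"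
    and "\<Omega>\<^sub>2 \<noteq> {}" and "open \<Omega>\<^sub>2"
  shows "\<exists>C :: real. \<forall>(l :: real) (u :: (real ^ 'n) \<times> (circle ^ 'm) \<Rightarrow> complex) f.
    sobolev 2 u \<longrightarrow> L2 f \<longrightarrow>
    (AE z in flat. laplacian u z - complex_of_real l * u z = f z) \<longrightarrow>
    L2_norm UNIV u \<le> C * (L2_norm UNIV f + L2_norm (\<Omega>\<^sub>1 \<times> \<Omega>\<^sub>2) u)"
proof -
  let ?\<Omega> = "\<Omega>\<^sub>1 \<times> \<Omega>\<^sub>2"
  have \<Omega>: "?\<Omega> \<in> sets borel"
    using open_Times[OF assms(2,5)] by (rule borel_open)
  obtain p r where r: "0 < r" and tent: "\<And>x. tent p r x \<le> indicator ?\<Omega> (cover x)"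
    using tent_le_indicator[OF assms] by blast
  obtain c where c: "0 < c" "\<And>N \<alpha> \<mu> \<Lambda> a. \<lbrakk>period_cell N; finite \<Lambda>; \<Lambda> \<subseteq> freq_lattice N; shell \<mu> \<Lambda>\<rbrakk> \<Longrightarrow>
      c * coef_sq a \<Lambda> \<le> tent_energy p r N \<alpha> a \<Lambda>"
    using trig_observability[OF r, of p] by (elim exE conjE) (erule that, iprover)
  \<comment> \<open>Twice \<open>2 / c + 1\<close>, which is the coefficient of the squared norm of
    \<open>f\<close>; it also exceeds the coefficient \<open>2 / c\<close> of the observed
    part.\<close>
  define C where "C = 4 / c + 2"
  have C: "0 < C" using c(1) by (simp add: C_def add_pos_pos)
  \<comment> \<open>The energy estimate concerns squared norms, whence the square root of
    \<open>C\<close>.\<close>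
  have "L2_norm UNIV u \<le> sqrt C * (L2_norm UNIV f + L2_norm ?\<Omega> u)"
    if sob: "sobolev 2 u" and f: "L2 f" and eq: "AE z in flat. laplacian u z - complex_of_real l * u z = f z"
    for l u f
  proof -
    have u: "L2 u" using sob by (simp add: sobolev_def)
    have [measurable]: "u \<in> borel_measurable borel" "f \<in> borel_measurable borel"
      using u f by (auto dest: L2D)
    have ex: "\<exists>v. L2 v \<and> has_weak_pderivs u v bs" if "set bs \<subseteq> Basis" "length bs \<le> 2" for bs
      using sob that by (simp add: sobolev_def)
    have "\<forall>b\<in>Basis. \<exists>v. L2 v \<and> has_weak_pderivs u v [b]"
      using ex by simp
    then obtain u1 where u1: "\<And>b. b \<in> Basis \<Longrightarrow> L2 (u1 b) \<and> has_weak_pderivs u (u1 b) [b]"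
      by metis
    \<comment> \<open>For first derivatives any representative will do, whereas the second ones have
      to be those selected in \<open>laplacian\<close>, because the equation is stated for
      them.\<close>
    have u2: "L2 (weak_pderivs [b, b] u) \<and> has_weak_pderivs u (weak_pderivs [b, b] u) [b, b]" if "b \<in> Basis" for b
      using someI_ex[OF ex[of "[b, b]"]] that by (simp add: weak_pderivs_def)
    define I where "I h = (LINT z|flat. (norm (h z))\<^sup>2)" for h :: "(real ^ 'n) \<times> (circle ^ 'm) \<Rightarrow> complex"
    define I\<Omega> where "I\<Omega> = (LINT z|flat. indicator ?\<Omega> z * (norm (u z))\<^sup>2)"
    define H where "H = (LINT z|flat. gradient_sq u u1 z)"
    let ?K = "148 * exp (1 :: real)"
    have int_f: "integrable flat (\<lambda>z. (norm (f z))\<^sup>2)" and int_u: "integrable flat (\<lambda>z. (norm (u z))\<^sup>2)"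
      using f u by (auto dest: L2D)
    have int_H: "integrable flat (gradient_sq u u1)"
      unfolding gradient_sq_def[abs_def] using u u1
      by (intro integrable_mult_right Bochner_Integration.integrable_sum Bochner_Integration.integrable_add) (auto dest: L2D)
    \<comment> \<open>The radius is \<open>Suc n\<close>, since the cutoff estimates require a
      radius of at least 1.\<close>
    have energy: "(LINT z|flat. (descend (eta (Suc n)) z)\<^sup>2 * (norm (u z))\<^sup>2)
        \<le> 2 / c * I\<Omega> + (2 / c + 1) * (2 * I f + 2 * (?K / Suc n)\<^sup>2 * H)" for n
    proof -
      interpret cutoff_cell "Suc n" "(\<chi> i. - pi * Suc n, 0) :: (real ^ 'n) \<times> (real ^ 'm)" "\<lambda>b. if snd b = 0 then Suc n else 1"
        by unfold_locales auto
      have "(LINT z|flat. (descend (eta (Suc n)) z)\<^sup>2 * (norm (u z))\<^sup>2)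
        \<le> 2 / c * (LINT z|flat. indicator ?\<Omega> z * (norm (u z))\<^sup>2)
        + (2 / c + 1) * (LINT z|flat. 2 * (norm (f z))\<^sup>2 + 2 * (?K / Suc n)\<^sup>2 * gradient_sq u u1 z)"
        by (rule resolvent_energy[OF u f u1 u2 eq[unfolded laplacian_def] c(1) c(2)[OF period_cell_axioms] r \<Omega> tent])
      also have "(LINT z|flat. 2 * (norm (f z))\<^sup>2 + 2 * (?K / Suc n)\<^sup>2 * gradient_sq u u1 z) = 2 * I f + 2 * (?K / Suc n)\<^sup>2 * H"
        unfolding I_def H_def by (subst Bochner_Integration.integral_add) (auto intro: integrable_mult_right int_f int_H)
      finally show ?thesis by (simp add: I\<Omega>_def)
    qed
    have "(\<lambda>n. LINT z|flat. (descend (eta (Suc n)) z)\<^sup>2 * (norm (u z))\<^sup>2) \<longlonglongrightarrow> I u"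
      unfolding I_def
    proof (rule integral_dominated_convergence[OF _ _ int_u])
      show "AE z in flat. (\<lambda>n. (descend (eta (Suc n)) z)\<^sup>2 * (norm (u z))\<^sup>2) \<longlonglongrightarrow> (norm (u z))\<^sup>2"
      proof (rule AE_I2)
        fix z :: "(real ^ 'n) \<times> (circle ^ 'm)"
        have "(\<lambda>n. descend (eta (Suc n)) z) \<longlonglongrightarrow> 1"
          unfolding descend_def by (rule LIMSEQ_Suc[OF eta_tendsto_1])
        then have "(\<lambda>n. (descend (eta (Suc n)) z)\<^sup>2 * (norm (u z))\<^sup>2) \<longlonglongrightarrow> 1\<^sup>2 * (norm (u z))\<^sup>2"
          by (intro tendsto_intros)
        then show "(\<lambda>n. (descend (eta (Suc n)) z)\<^sup>2 * (norm (u z))\<^sup>2) \<longlonglongrightarrow> (norm (u z))\<^sup>2" by simp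
      qed
      show "AE z in flat. norm ((descend (eta (Suc n)) z)\<^sup>2 * (norm (u z))\<^sup>2) \<le> (norm (u z))\<^sup>2" for n
      proof (rule AE_I2)
        fix z :: "(real ^ 'n) \<times> (circle ^ 'm)"
        have "(descend (eta (Suc n)) z)\<^sup>2 \<le> 1"
          unfolding descend_def by (intro power_le_one eta_nonneg eta_le_1)
        then show "norm ((descend (eta (Suc n)) z)\<^sup>2 * (norm (u z))\<^sup>2) \<le> (norm (u z))\<^sup>2"
          by (simp add: mult_left_le_one_le)
      qed
    qed measurable
    \<comment> \<open>\<open>H\<close> may be huge, but it depends on \<open>u\<close> and the
      chosen \<open>u1\<close> and not on \<open>n\<close>, so the cutoff error disappears in the
      limit.\<close>
    moreover have "(\<lambda>n. 2 / c * I\<Omega> + (2 / c + 1) * (2 * I f + 2 * (?K / Suc n)\<^sup>2 * H)) \<longlonglongrightarrow>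
        2 / c * I\<Omega> + (2 / c + 1) * (2 * I f + 2 * (?K * 0)\<^sup>2 * H)"
      unfolding divide_inverse[of ?K] by (intro tendsto_intros LIMSEQ_inverse_real_of_nat)
    ultimately have "I u \<le> 2 / c * I\<Omega> + (2 / c + 1) * (2 * I f + 2 * (?K * 0)\<^sup>2 * H)"
      by (rule LIMSEQ_le) (use energy in blast)
    moreover have I0: "0 \<le> I f" "0 \<le> I\<Omega>"
      unfolding I_def I\<Omega>_def by (intro integral_nonneg_AE AE_I2; simp)+
    moreover have "2 / c * I\<Omega> \<le> C * I\<Omega>"
      using I0 c(1) by (intro mult_right_mono) (auto simp: C_def field_simps)
    moreover have "(2 / c + 1) * (2 * I f) = C * I f"
      by (simp add: C_def algebra_simps)
    ultimately have main: "I u \<le> C * (I f + I\<Omega>)"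
      by (simp add: distrib_left)
    have norms: "L2_norm UNIV u = sqrt (I u)" "L2_norm UNIV f = sqrt (I f)" "L2_norm ?\<Omega> u = sqrt I\<Omega>"
      by (simp_all add: L2_norm_def I_def I\<Omega>_def set_lebesgue_integral_def)
    have "sqrt (I u) \<le> sqrt C * sqrt (I f + I\<Omega>)"
      using main by (simp flip: real_sqrt_mult)
    also have "\<dots> \<le> sqrt C * (sqrt (I f) + sqrt I\<Omega>)"
      using C I0 by (intro mult_left_mono sqrt_add_le_add_sqrt) auto
    finally show ?thesis by (simp add: norms)
  qed
  then show ?thesis by blast
qed

end
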